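(* Let $d\geq 2$ and $\frac12<r<\min\left(\frac d2,\,S-\frac12\right)$. Let $$C_{rad,+}(r,S,2,d)=\sup\left\{\frac{\|D^r\varphi\|_{L^2(\mathbb{R}^d)}}{\|\varphi\|_{L^2(\mathbb{R}^d)}^{1-\frac rS}\|D^S\varphi\|_{L^2(\mathbb{R}^d)}^{\frac rS}}:\ \varphi\in H^{S,r}_{rad,+}(\mathbb{R}^d),\ \varphi\neq 0\right\}.$$ Then $\|D^r\varphi\|_{L^2}\leq C_{rad,+}(r,S,2,d)\|\varphi\|_{L^2}^{1-\frac rS}\|D^S\varphi\|_{L^2}^{\frac rS}$ for all $\varphi\in H^{S,r}_{rad,+}(\mathbb{R}^d)$, the supremum $C_{rad,+}(r,S,2,d)$ is attained by some nonzero $\varphi\in H^{S,r}_{rad,+}(\mathbb{R}^d)$, and $C_{rad,+}(r,S,2,d)<1$.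
   Context: For $s\in\mathbb{R}$, $D^s$ denotes the Fourier multiplier $\widehat{D^s\varphi}(\xi)=|\xi|^s\widehat\varphi(\xi)$. $H^S(\mathbb{R}^d)$ is the usual inhomogeneous $L^2$-Sobolev space and $H^{S,r}_{rad,+}(\mathbb{R}^d)=\{\varphi\in H^S(\mathbb{R}^d)\text{ radially symmetric}:\ D^r\varphi\geq 0\text{ a.e.}\}$. *)

theory Defs
  imports "HOL-Analysis.Analysis"
begin

definition sq_int :: "(real^'d \<Rightarrow> complex) \<Rightarrow> bool" where
  "sq_int f \<longleftrightarrow> f \<in> borel_measurable lborel \<and> integrable lborel (\<lambda>x. (cmod (f x))^2)"

definition L2norm :: "(real^'d \<Rightarrow> complex) \<Rightarrow> real" where
  "L2norm f = sqrt (integral\<^sup>L lborel (\<lambda>x. (cmod (f x))^2))"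

definition fourier_L1 :: "(real^'d \<Rightarrow> complex) \<Rightarrow> real^'d \<Rightarrow> complex" where
  "fourier_L1 \<psi> \<xi> = integral\<^sup>L lborel
      (\<lambda>x. exp (- (2 * pi * \<i>) * complex_of_real (x \<bullet> \<xi>)) * \<psi> x)"

text \<open>L^2 Fourier transform, characterised weakly (multiplication formula):
  F is the Fourier transform of f.\<close>
definition is_fourier :: "(real^'d \<Rightarrow> complex) \<Rightarrow> (real^'d \<Rightarrow> complex) \<Rightarrow> bool" where
  "is_fourier f F \<longleftrightarrow> sq_int f \<and> sq_int F \<and>
     (\<forall>\<psi>. integrable lborel \<psi> \<and> sq_int \<psi> \<longrightarrow>
        integral\<^sup>L lborel (\<lambda>\<xi>. F \<xi> * \<psi> \<xi>) = integral\<^sup>L lborel (\<lambda>x. f x * fourier_L1 \<psi> x))"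

definition Dfrac :: "real \<Rightarrow> (real^'d \<Rightarrow> complex) \<Rightarrow> (real^'d \<Rightarrow> complex) \<Rightarrow> bool" where
  "Dfrac s f g \<longleftrightarrow> (\<exists>F. is_fourier f F \<and> is_fourier g (\<lambda>\<xi>. complex_of_real (norm \<xi> powr s) * F \<xi>))"

definition Dnorm :: "real \<Rightarrow> (real^'d \<Rightarrow> complex) \<Rightarrow> real" where
  "Dnorm s f = L2norm (SOME g. Dfrac s f g)"

definition sobolev :: "real \<Rightarrow> (real^'d \<Rightarrow> complex) \<Rightarrow> bool" where
  "sobolev S f \<longleftrightarrow> (\<exists>F. is_fourier f F \<and>
     sq_int (\<lambda>\<xi>. complex_of_real ((1 + (norm \<xi>)^2) powr (S/2)) * F \<xi>))"

definition radial :: "(real^'d \<Rightarrow> complex) \<Rightarrow> bool" where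
  "radial f \<longleftrightarrow> (\<forall>x y. norm x = norm y \<longrightarrow> f x = f y)"

definition H_rad_plus :: "real \<Rightarrow> real \<Rightarrow> (real^'d \<Rightarrow> complex) \<Rightarrow> bool" where
  "H_rad_plus S r f \<longleftrightarrow> sobolev S f \<and> radial f \<and>
     (\<exists>g. Dfrac r f g \<and> (AE x in lborel. g x \<in> \<real> \<and> Re (g x) \<ge> 0))"

definition GN_ratio :: "real \<Rightarrow> real \<Rightarrow> (real^'d \<Rightarrow> complex) \<Rightarrow> real" where
  "GN_ratio r S f = Dnorm r f / (L2norm f powr (1 - r/S) * Dnorm S f powr (r/S))"

end

theory Submission
  imports Defs "HOL-Probability.Characteristic_Functions" "HOL-Complex_Analysis.Great_Picard"
begin

text \<open>
  Write \<open>g = D^r \<phi> \<ge> 0\<close>. Amplitude and dilation normalise the \<open>L^2\<close> norms of \<open>\<phi>\<close> and \<open>D^S \<phi>\<close> to 1, and the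
  quotient becomes the \<open>L^2\<close> norm of \<open>g\<close>; the point is that a maximising sequence of such \<open>g\<close> is precompact
  in \<open>L^2\<close>. High frequencies are controlled by \<open>D^S \<phi>\<close>, so it suffices to treat averages of \<open>g\<close> over small
  balls, which are equicontinuous, and only their decay at infinity is at stake. Testing the transform of \<open>g\<close>
  against a Gaussian of width \<open>R\<close> bounds the integral of \<open>g\<close> over the ball of radius \<open>R\<close> by a multiple
  of \<open>R^(d/2 - r)\<close>. As \<open>g\<close> is radial this mass is evenly spread over spheres, so a unit ball at distance \<open>R\<close>
  carries at most a multiple of \<open>R^(d/2 - r - (d - 1))\<close>. Multiplying the two bounds, the averages have squared norm at most a
  multiple of \<open>R^(1 - 2 r)\<close> on a dyadic shell, which is summable because \<open>r > 1/2\<close>. The limit is a maximiser by Fatou's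
  lemma, and the constant is smaller than 1 because equality in the interpolation inequality
  would force the Fourier transform to live on a single sphere.
\<close>

section \<open>Square integrable functions\<close>

text \<open>Compactness may fail through dilations or through mass escaping to infinity;
  normalisation removes the first, the radial mass estimate the second. That estimate controls
  \<open>g\<close> only in L^1 on balls and says nothing pointwise about \<open>g\<close>, which is
  why the compactness criterion asks for tightness of averages alone. The condition r < d/2 makes
  the growth exponent d/2 - r positive and puts |\<xi>|^(-r) times a Gaussian into L^2, so that the
  class is not trivial. The definitions shape the rest. \<open>is_fourier\<close> is a relation
  given by a weak formula and determined up to null sets, so existence, uniqueness, isometry and
  inversion are derived, starting from Gaussian regularisation. In contrast \<open>radial\<close> is
  demanded at every point, so an almost everywhere limit must be replaced by a radial
  representative. Strong convergence is obtained for D^r \<phi> only; \<phi> is recovered by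
  dividing its transform by |\<xi>|^r, and its two other norms may drop in the limit. They stand in
  the denominator of the ratio, so this loss is harmless.\<close>

lemma ball_sets_borel [measurable]: "ball c r \<in> sets borel"
  by simp

text \<open>Valued in \<open>ennreal\<close>, so that Tonelli, Fatou and monotone convergence apply
  before finiteness is known; for measurable \<open>f\<close>, membership in L^2 is then
  \<open>L2sq f < top\<close>.\<close>

definition L2sq :: "('a::euclidean_space \<Rightarrow> 'b::real_normed_vector) \<Rightarrow> ennreal" where
  "L2sq f = (\<integral>\<^sup>+x. ennreal ((norm (f x))\<^sup>2) \<partial>lborel)"

lemma sq_int_iff: "sq_int f \<longleftrightarrow> f \<in> borel_measurable borel \<and> L2sq f < top"
proof (cases "f \<in> borel_measurable borel")
  case True
  then have [measurable]: "f \<in> borel_measurable borel" .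
  show ?thesis
    unfolding sq_int_def L2sq_def by (subst integrable_iff_bounded) auto
qed (simp add: sq_int_def)

lemma L2norm_eq: "L2norm f = sqrt (enn2real (L2sq f))" if "f \<in> borel_measurable borel"
proof -
  have [measurable]: "f \<in> borel_measurable borel" using that .
  show ?thesis
    unfolding L2norm_def L2sq_def by (subst integral_eq_nn_integral) auto
qed

lemma L2sq_cong_AE: "(AE x in lborel. f x = g x) \<Longrightarrow> L2sq f = L2sq g"
  unfolding L2sq_def by (rule nn_integral_cong_AE) (auto elim: eventually_mono)

lemma L2sq_mono_AE: "(AE x in lborel. norm (f x) \<le> norm (g x)) \<Longrightarrow> L2sq f \<le> L2sq g"
  unfolding L2sq_def
  by (rule nn_integral_mono_AE) (auto elim!: eventually_mono intro!: ennreal_leI power_mono)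

lemma L2sq_eq_0_iff: "f \<in> borel_measurable borel \<Longrightarrow> L2sq f = 0 \<longleftrightarrow> (AE x in lborel. f x = 0)"
  unfolding L2sq_def by (subst nn_integral_0_iff_AE) (auto simp: ennreal_eq_0_iff)

lemma L2sq_cmult: "f \<in> borel_measurable borel \<Longrightarrow>
    L2sq (\<lambda>x. c * (f x :: 'b::{real_normed_div_algebra,second_countable_topology})) = ennreal ((norm c)\<^sup>2) * L2sq f"
  unfolding L2sq_def norm_mult power_mult_distrib
  by (subst nn_integral_cmult[symmetric]) (auto simp: ennreal_mult)

text \<open>Peter-Paul form of the triangle inequality. Keeping the weight \<open>e\<close> free
  allows the sharp Minkowski inequality to be recovered by optimisation.\<close>

lemma norm_add_sq_le:
  fixes a b :: "'b::real_normed_vector"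
  assumes "e > 0"
  shows "(norm (a + b))\<^sup>2 \<le> (1 + e) * (norm a)\<^sup>2 + (1 + 1/e) * (norm b)\<^sup>2"
proof -
  have "0 \<le> (sqrt e * norm a - norm b / sqrt e)\<^sup>2" by simp
  also have "\<dots> = e * (norm a)\<^sup>2 + (norm b)\<^sup>2 / e - 2 * norm a * norm b"
    using assms by (simp add: power2_diff power_mult_distrib power_divide field_simps)
  finally have "2 * norm a * norm b \<le> e * (norm a)\<^sup>2 + (norm b)\<^sup>2 / e" by simp
  moreover have "(norm (a + b))\<^sup>2 \<le> (norm a + norm b)\<^sup>2"
    by (intro power_mono norm_triangle_ineq) auto
  ultimately show ?thesis by (simp add: power2_sum algebra_simps)
qed

lemma L2sq_add_le:
  fixes f g :: "'a::euclidean_space \<Rightarrow> 'b::{real_normed_vector,second_countable_topology}"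
  assumes [measurable]: "f \<in> borel_measurable borel" "g \<in> borel_measurable borel" and e: "e > 0"
  shows "L2sq (\<lambda>x. f x + g x) \<le> ennreal (1 + e) * L2sq f + ennreal (1 + 1/e) * L2sq g"
proof -
  have "L2sq (\<lambda>x. f x + g x) \<le>
      (\<integral>\<^sup>+x. ennreal (1 + e) * ennreal ((norm (f x))\<^sup>2) + ennreal (1 + 1/e) * ennreal ((norm (g x))\<^sup>2) \<partial>lborel)"
    unfolding L2sq_def
  proof (rule nn_integral_mono)
    fix x
    show "ennreal ((norm (f x + g x))\<^sup>2) \<le> ennreal (1 + e) * ennreal ((norm (f x))\<^sup>2) + ennreal (1 + 1/e) * ennreal ((norm (g x))\<^sup>2)"
      using norm_add_sq_le[OF e, of "f x" "g x"] e
      by (simp add: ennreal_mult[symmetric] ennreal_plus[symmetric] del: ennreal_plus)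
  qed
  also have "\<dots> = ennreal (1 + e) * L2sq f + ennreal (1 + 1/e) * L2sq g"
    unfolding L2sq_def by (subst nn_integral_add) (auto simp: nn_integral_cmult)
  finally show ?thesis .
qed

text \<open>The triangle inequality for squared norms costs a factor 2 on each term; this is the
  origin of the many \<open>e/4\<close> below.\<close>

lemma L2sq_add_le2:
  fixes f g :: "'a::euclidean_space \<Rightarrow> 'b::{real_normed_vector,second_countable_topology}"
  assumes [measurable]: "f \<in> borel_measurable borel" "g \<in> borel_measurable borel"
  shows "L2sq (\<lambda>x. f x + g x) \<le> 2 * L2sq f + 2 * L2sq g"
  using L2sq_add_le[OF assms, of 1] by simp

lemma L2sq_diff_le:
  fixes f g :: "'a::euclidean_space \<Rightarrow> 'b::{real_normed_vector,second_countable_topology}"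
  assumes [measurable]: "f \<in> borel_measurable borel" "g \<in> borel_measurable borel"
  shows "L2sq (\<lambda>x. f x - g x) \<le> 2 * L2sq f + 2 * L2sq g"
proof -
  have "L2sq (\<lambda>x. - g x) = L2sq g" by (simp add: L2sq_def)
  then show ?thesis using L2sq_add_le2[of f "\<lambda>x. - g x"] by simp
qed

lemma L2sq_minus_commute: "L2sq (\<lambda>x. f x - g x) = L2sq (\<lambda>x. g x - f x)"
  by (simp add: L2sq_def norm_minus_commute)

lemma L2sq_diff_triangle:
  fixes f g h :: "'a::euclidean_space \<Rightarrow> 'b::{real_normed_vector,second_countable_topology}"
  assumes [measurable]: "f \<in> borel_measurable borel" "g \<in> borel_measurable borel" "h \<in> borel_measurable borel"
  shows "L2sq (\<lambda>x. f x - h x) \<le> 2 * L2sq (\<lambda>x. f x - g x) + 2 * L2sq (\<lambda>x. g x - h x)"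
  using L2sq_add_le2[of "\<lambda>x. f x - g x" "\<lambda>x. g x - h x"] by simp

text \<open>The bound is optimal at \<open>e = sqrt d / sqrt b\<close>, where the right side is the
  square of \<open>sqrt b + sqrt d\<close>. If \<open>b\<close> or \<open>d\<close> is 0 there is no
  optimal positive \<open>e\<close>, and a slack \<open>t\<close> is sent to 0 instead.\<close>

lemma sqrt_le_of_Young:
  fixes a b d :: real
  assumes "a \<ge> 0" "b \<ge> 0" "d \<ge> 0" and Y: "\<And>e. e > 0 \<Longrightarrow> a \<le> (1 + e) * b + (1 + 1/e) * d"
  shows "sqrt a \<le> sqrt b + sqrt d"
proof -
  have *: "a \<le> (sqrt b + sqrt d)\<^sup>2 + t" if "t > 0" for t
  proof -
    consider "b = 0" | "d = 0" | "b > 0" "d > 0" using assms by linarith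
    then show ?thesis
    proof cases
      case 1
      have "d * (t / (d + 1)) \<le> t" using assms that by (simp add: field_simps)
      moreover have "a \<le> d + d * (t / (d + 1))"
        using Y[of "(d+1)/t"] 1 that assms by (simp add: field_simps)
      ultimately show ?thesis using 1 assms by simp
    next
      case 2
      have "b * (t / (b + 1)) \<le> t" using assms that by (simp add: field_simps)
      moreover have "a \<le> b + b * (t / (b + 1))"
        using Y[of "t/(b+1)"] 2 that assms by (simp add: algebra_simps)
      ultimately show ?thesis using 2 assms by simp
    next
      case 3
      define p q where "p = sqrt b" and "q = sqrt d"
      have pq: "p > 0" "q > 0" "b = p\<^sup>2" "d = q\<^sup>2" using 3 by (auto simp: p_def q_def)
      have "a \<le> (1 + q/p) * b + (1 + 1/(q/p)) * d" using pq by (intro Y) auto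
      also have "\<dots> = (p + q)\<^sup>2" using pq by (simp add: field_simps power2_eq_square)
      finally show ?thesis using that by (simp add: p_def q_def)
    qed
  qed
  have "a \<le> (sqrt b + sqrt d)\<^sup>2" by (rule field_le_epsilon) (use * in auto)
  then show ?thesis using assms by (intro real_le_lsqrt) auto
qed

lemma L2sq_Minkowski:
  fixes f g :: "'a::euclidean_space \<Rightarrow> 'b::{real_normed_vector,second_countable_topology}"
  assumes [measurable]: "f \<in> borel_measurable borel" "g \<in> borel_measurable borel"
    and fin: "L2sq f < top" "L2sq g < top"
  shows "sqrt (enn2real (L2sq (\<lambda>x. f x + g x))) \<le> sqrt (enn2real (L2sq f)) + sqrt (enn2real (L2sq g))"
proof (rule sqrt_le_of_Young)
  obtain a b where ab: "L2sq f = ennreal a" "L2sq g = ennreal b" "a \<ge> 0" "b \<ge> 0"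
    using fin by (metis ennreal_cases infinity_ennreal_def less_irrefl)
  show "enn2real (L2sq (\<lambda>x. f x + g x)) \<le> (1 + e) * enn2real (L2sq f) + (1 + 1/e) * enn2real (L2sq g)"
    if "e > 0" for e
    using L2sq_add_le[OF assms(1,2) that] ab that
    by (simp add: ennreal_mult[symmetric] ennreal_plus[symmetric] enn2real_leI del: ennreal_plus)
qed auto

text \<open>The reverse triangle inequality holds for the square root of \<open>L2sq\<close>, not
  for \<open>L2sq\<close> itself; hence the detour through real square roots.\<close>

lemma L2sq_tendsto:
  fixes f :: "nat \<Rightarrow> 'a::euclidean_space \<Rightarrow> 'b::{real_normed_vector,second_countable_topology}"
  assumes [measurable]: "\<And>n. f n \<in> borel_measurable borel" "g \<in> borel_measurable borel"
    and fin: "\<And>n. L2sq (f n) < top" "L2sq g < top"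
    and lim: "(\<lambda>n. L2sq (\<lambda>x. f n x - g x)) \<longlonglongrightarrow> 0"
  shows "(\<lambda>n. L2sq (f n)) \<longlonglongrightarrow> L2sq g"
proof -
  let ?N = "\<lambda>f::'a \<Rightarrow> 'b. sqrt (enn2real (L2sq f))"
  have fd: "L2sq (\<lambda>x. f n x - g x) < top" for n
  proof -
    have "L2sq (\<lambda>x. f n x - g x) \<le> 2 * L2sq (f n) + 2 * L2sq g" by (rule L2sq_diff_le) auto
    also have "\<dots> < top" using fin by (simp add: ennreal_mult_less_top)
    finally show ?thesis .
  qed
  have "?N (f n) \<le> ?N (\<lambda>x. f n x - g x) + ?N g" for n
    using L2sq_Minkowski[of "\<lambda>x. f n x - g x" g] fd fin by simp
  moreover have "?N g \<le> ?N (\<lambda>x. f n x - g x) + ?N (f n)" for n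
    using L2sq_Minkowski[of "\<lambda>x. g x - f n x" "f n"] fd fin by (simp add: L2sq_minus_commute[of g])
  ultimately have d: "norm (?N (f n) - ?N g) \<le> ?N (\<lambda>x. f n x - g x)" for n
    by (simp add: abs_le_iff algebra_simps)
  have "(\<lambda>n. ?N (\<lambda>x. f n x - g x)) \<longlonglongrightarrow> sqrt 0"
    by (intro tendsto_real_sqrt tendsto_enn2real) (use lim in simp_all)
  then have "(\<lambda>n. ?N (f n) - ?N g) \<longlonglongrightarrow> 0"
    by (intro Lim_null_comparison[OF always_eventually[OF allI[OF d]]]) simp
  then have "(\<lambda>n. ?N (f n)) \<longlonglongrightarrow> ?N g" by (simp add: LIM_zero_iff)
  then have "(\<lambda>n. ennreal ((?N (f n))\<^sup>2)) \<longlonglongrightarrow> ennreal ((?N g)\<^sup>2)"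
    by (intro tendsto_ennrealI tendsto_power)
  moreover have "ennreal ((?N h)\<^sup>2) = L2sq h" if "L2sq h < top" for h
    using that by simp
  ultimately show ?thesis using fin by (simp only:)
qed

text \<open>Riesz-Fischer. The limit is given explicitly as a pointwise \<open>lim\<close> along a
  subsequence, so it is measurable by construction and inherits pointwise symmetries shared by all
  members of the sequence.\<close>

lemma L2sq_complete:
  fixes f :: "nat \<Rightarrow> 'a::euclidean_space \<Rightarrow> 'b::{banach,second_countable_topology}"
  assumes [measurable]: "\<And>n. f n \<in> borel_measurable borel"
    and cau: "\<And>e::real. e > 0 \<Longrightarrow> \<exists>N. \<forall>m\<ge>N. \<forall>n\<ge>N. L2sq (\<lambda>x. f m x - f n x) \<le> ennreal e"
  obtains s where "strict_mono s" "AE x in lborel. (\<lambda>k. f (s k) x) \<longlonglongrightarrow> lim (\<lambda>k. f (s k) x)"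
    "(\<lambda>n. L2sq (\<lambda>x. f n x - lim (\<lambda>k. f (s k) x))) \<longlonglongrightarrow> 0"
proof -
  have "\<exists>s. \<forall>k. (\<forall>m\<ge>s k. \<forall>n\<ge>s k. L2sq (\<lambda>x. f m x - f n x) \<le> ennreal ((1/4)^k)) \<and> s k < s (Suc k)"
  proof (rule dependent_nat_choice)
    show "\<exists>N. \<forall>m\<ge>N. \<forall>n\<ge>N. L2sq (\<lambda>x. f m x - f n x) \<le> ennreal ((1/4)^0)"
      by (rule cau) auto
    show "\<exists>y. (\<forall>m\<ge>y. \<forall>n\<ge>y. L2sq (\<lambda>x. f m x - f n x) \<le> ennreal ((1/4)^Suc k)) \<and> x < y" for x k
    proof -
      obtain N where "\<forall>m\<ge>N. \<forall>n\<ge>N. L2sq (\<lambda>x. f m x - f n x) \<le> ennreal ((1/4)^Suc k)"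
        using cau[of "(1/4)^Suc k"] by auto
      then show ?thesis by (intro exI[of _ "max N (Suc x)"]) auto
    qed
  qed
  then obtain s where s: "\<And>k m n. m \<ge> s k \<Longrightarrow> n \<ge> s k \<Longrightarrow> L2sq (\<lambda>x. f m x - f n x) \<le> ennreal ((1/4)^k)"
    and sm: "strict_mono s" by (auto simp: strict_mono_Suc_iff)
  define D where "D k x = f (s (Suc k)) x - f (s k) x" for k x
  have [measurable]: "D k \<in> borel_measurable borel" for k unfolding D_def by measurable
  have DL: "L2sq (D k) \<le> ennreal ((1/4)^k)" for k
    unfolding D_def using sm by (intro s) (auto simp: strict_mono_leD)
  \<comment> \<open>The weight \<open>2^k\<close> against the bound \<open>(1/4)^k\<close> leaves a
    convergent series; finiteness of the weighted sum at a point forces geometric decay of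
    \<open>D k x\<close> with ratio \<open>1 / sqrt 2\<close>.\<close>
  have "(\<integral>\<^sup>+x. (\<Sum>k. ennreal (2^k * (norm (D k x))\<^sup>2)) \<partial>lborel) = (\<Sum>k. ennreal (2^k) * L2sq (D k))"
    by (subst nn_integral_suminf) (auto simp: L2sq_def ennreal_mult nn_integral_cmult)
  also have "\<dots> \<le> (\<Sum>k. ennreal ((1/2)^k))"
  proof (intro suminf_le allI)
    fix k
    have "ennreal (2^k) * L2sq (D k) \<le> ennreal (2^k) * ennreal ((1/4)^k)"
      by (intro mult_left_mono DL) auto
    also have "\<dots> = ennreal ((1/2)^k)"
      by (subst ennreal_mult[symmetric]) (auto simp: power_mult_distrib[symmetric])
    finally show "ennreal (2^k) * L2sq (D k) \<le> ennreal ((1/2)^k)" .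
  qed auto
  also have "\<dots> < \<infinity>"
    by (subst suminf_ennreal2) (auto intro: summable_geometric)
  finally have "(\<integral>\<^sup>+x. (\<Sum>k. ennreal (2^k * (norm (D k x))\<^sup>2)) \<partial>lborel) \<noteq> \<infinity>" by simp
  then have AE1: "AE x in lborel. (\<Sum>k. ennreal (2^k * (norm (D k x))\<^sup>2)) \<noteq> \<infinity>"
    by (intro nn_integral_noteq_infinite) auto
  have conv: "convergent (\<lambda>k. f (s k) x)" if "(\<Sum>k. ennreal (2^k * (norm (D k x))\<^sup>2)) \<noteq> \<infinity>" for x
  proof -
    have "summable (\<lambda>k. 2^k * (norm (D k x))\<^sup>2)"
      by (rule summable_suminf_not_top) (use that in auto)
    then have "Bseq (\<lambda>k. 2^k * (norm (D k x))\<^sup>2)"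
      by (rule summable_imp_Bseq)
    then obtain K where K: "K > 0" "\<And>k. 2^k * (norm (D k x))\<^sup>2 \<le> K"
      by (auto elim!: BseqE)
    have "norm (D k x) \<le> sqrt K * (1/sqrt 2)^k" for k
    proof -
      have "(norm (D k x))\<^sup>2 \<le> K / 2^k" using K(2)[of k] by (simp add: field_simps)
      then have "norm (D k x) \<le> sqrt (K / 2^k)" by (rule real_le_rsqrt)
      then show ?thesis by (simp add: real_sqrt_divide real_sqrt_power power_divide)
    qed
    moreover have "summable (\<lambda>k. sqrt K * (1/sqrt 2)^k)"
      by (intro summable_mult summable_geometric) auto
    ultimately have "summable (\<lambda>k. D k x)"
      using summable_comparison_test'[of "\<lambda>k. sqrt K * (1/sqrt 2)^k" 0 "\<lambda>k. D k x"] by blast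
    then have "convergent (\<lambda>n. \<Sum>k<n. D k x)" by (simp add: summable_iff_convergent)
    then have "convergent (\<lambda>n. f (s 0) x + (\<Sum>k<n. D k x))"
      by (intro convergent_add convergent_const)
    moreover have "f (s 0) x + (\<Sum>k<n. D k x) = f (s n) x" for n
      using sum_lessThan_telescope[of "\<lambda>k. f (s k) x" n] by (simp add: D_def)
    ultimately show ?thesis by simp
  qed
  have AE2: "AE x in lborel. (\<lambda>k. f (s k) x) \<longlonglongrightarrow> lim (\<lambda>k. f (s k) x)"
    using AE1 by eventually_elim (use conv in \<open>auto simp: convergent_LIMSEQ_iff\<close>)
  \<comment> \<open>Fatou along the subsequence \<open>s\<close>: the Cauchy bound between
    \<open>f n\<close> and \<open>f (s k)\<close> survives the limit in \<open>k\<close>.\<close>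
  have bound: "L2sq (\<lambda>x. f n x - lim (\<lambda>k. f (s k) x)) \<le> ennreal e"
    if N: "\<forall>m\<ge>N. \<forall>n\<ge>N. L2sq (\<lambda>x. f m x - f n x) \<le> ennreal e" and n: "n \<ge> N" for N n e
  proof -
    have "L2sq (\<lambda>x. f n x - lim (\<lambda>k. f (s k) x)) = 
        (\<integral>\<^sup>+x. liminf (\<lambda>k. ennreal ((norm (f n x - f (s k) x))\<^sup>2)) \<partial>lborel)"
      unfolding L2sq_def
    proof (rule nn_integral_cong_AE)
      show "AE x in lborel. ennreal ((norm (f n x - lim (\<lambda>k. f (s k) x)))\<^sup>2) =
          liminf (\<lambda>k. ennreal ((norm (f n x - f (s k) x))\<^sup>2))"
        using AE2
      proof eventually_elim
        case (elim x)
        have "(\<lambda>k. ennreal ((norm (f n x - f (s k) x))\<^sup>2)) \<longlonglongrightarrow> ennreal ((norm (f n x - lim (\<lambda>k. f (s k) x)))\<^sup>2)"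
          by (intro tendsto_ennrealI tendsto_intros elim)
        from lim_imp_Liminf[OF _ this] show ?case by simp
      qed
    qed
    also have "\<dots> \<le> liminf (\<lambda>k. L2sq (\<lambda>x. f n x - f (s k) x))"
      unfolding L2sq_def by (rule nn_integral_liminf) auto
    also have "\<dots> \<le> ennreal e"
    proof (rule Liminf_le)
      show "\<forall>\<^sub>F k in sequentially. L2sq (\<lambda>x. f n x - f (s k) x) \<le> ennreal e"
        using eventually_ge_at_top[of N]
        by eventually_elim (use N n sm in \<open>auto intro: order_trans[OF _ strict_mono_imp_increasing]\<close>)
    qed simp
    finally show ?thesis .
  qed
  have "(\<lambda>n. L2sq (\<lambda>x. f n x - lim (\<lambda>k. f (s k) x))) \<longlonglongrightarrow> 0"
  proof (rule tendsto_zero_ennreal)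
    fix e :: real assume "0 < e"
    then obtain N where N: "\<forall>m\<ge>N. \<forall>n\<ge>N. L2sq (\<lambda>x. f m x - f n x) \<le> ennreal (e/2)"
      using cau[of "e/2"] by auto
    show "\<forall>\<^sub>F n in sequentially. L2sq (\<lambda>x. f n x - lim (\<lambda>k. f (s k) x)) < ennreal e"
      using eventually_ge_at_top[of N]
    proof eventually_elim
      case (elim n)
      have "L2sq (\<lambda>x. f n x - lim (\<lambda>k. f (s k) x)) \<le> ennreal (e/2)" by (rule bound[OF N elim])
      also have "\<dots> < ennreal e" using \<open>0 < e\<close> by (simp add: ennreal_less_iff)
      finally show ?case .
    qed
  qed
  with that sm AE2 show ?thesis by blast
qed

section \<open>Maps preserving Lebesgue measure\<close>

lemma lborel_distr_translate: "distr lborel borel (\<lambda>x. x + c) = (lborel :: 'a::euclidean_space measure)"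
proof -
  have "(\<lambda>x. x + c) = (+) c" by (auto simp: add.commute)
  then show ?thesis by (simp add: lborel_distr_plus)
qed

lemma lborel_distr_reflect: "distr lborel borel (\<lambda>x. c - x) = (lborel :: 'a::euclidean_space measure)"
  using lborel_affine[of "-1" c] by (simp add: density_1)

locale lborel_preserving =
  fixes T :: "'a::euclidean_space \<Rightarrow> 'a"
  assumes meas [measurable]: "T \<in> borel_measurable borel" and distr: "distr lborel borel T = lborel"
begin

lemma nn_integral:
  assumes [measurable]: "f \<in> borel_measurable borel"
  shows "(\<integral>\<^sup>+x. f (T x) \<partial>lborel) = (\<integral>\<^sup>+x. f x \<partial>lborel)"
proof -
  have "(\<integral>\<^sup>+x. f (T x) \<partial>lborel) = (\<integral>\<^sup>+x. f x \<partial>distr lborel borel T)"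
    by (rule nn_integral_distr[symmetric]) auto
  then show ?thesis by (simp add: distr)
qed

lemma integral:
  fixes f :: "'a \<Rightarrow> 'b::{banach,second_countable_topology}"
  assumes [measurable]: "f \<in> borel_measurable borel"
  shows "(\<integral>x. f (T x) \<partial>lborel) = (\<integral>x. f x \<partial>lborel)"
proof -
  have "(\<integral>x. f (T x) \<partial>lborel) = (\<integral>x. f x \<partial>distr lborel borel T)"
    by (rule integral_distr[symmetric]) auto
  then show ?thesis by (simp add: distr)
qed

lemma integrable:
  fixes f :: "'a \<Rightarrow> 'b::{banach,second_countable_topology}"
  assumes [measurable]: "f \<in> borel_measurable borel"
  shows "integrable lborel (\<lambda>x. f (T x)) \<longleftrightarrow> integrable lborel f"
proof -
  have "integrable lborel (\<lambda>x. f (T x)) \<longleftrightarrow> integrable (distr lborel borel T) f"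
    by (rule integrable_distr_eq[symmetric]) auto
  then show ?thesis by (simp add: distr)
qed

lemma AE:
  assumes "AE x in lborel. P x"
  shows "AE x in lborel. P (T x)"
proof (rule AE_distrD[of T lborel borel P])
  show "AE x in distr lborel borel T. P x" using assms by (subst distr)
qed simp

lemma L2sq:
  fixes f :: "'a \<Rightarrow> 'b::{real_normed_vector,second_countable_topology}"
  assumes [measurable]: "f \<in> borel_measurable borel"
  shows "L2sq (\<lambda>x. f (T x)) = L2sq f"
  unfolding L2sq_def by (rule nn_integral) auto

end

lemma lborel_preserving_translate: "lborel_preserving (\<lambda>x::'a::euclidean_space. x + c)"
  by unfold_locales (auto simp: lborel_distr_translate)

lemma lborel_preserving_reflect: "lborel_preserving (\<lambda>x::'a::euclidean_space. c - x)"
  by unfold_locales (auto simp: lborel_distr_reflect)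

lemma lborel_preserving_uminus: "lborel_preserving (\<lambda>x::'a::euclidean_space. - x)"
  using lborel_preserving_reflect[of 0] by simp

lemma orthogonal_transformation_borel:
  "orthogonal_transformation U \<Longrightarrow> U \<in> borel_measurable (borel :: 'a::euclidean_space measure)"
  by (intro borel_measurable_continuous_onI linear_continuous_on linear_conv_bounded_linear[THEN iffD1])
     (simp add: orthogonal_transformation_linear)

text \<open>A translation invariant measure \<open>\<mu>\<close> satisfies \<open>\<mu> A * \<lambda> B = \<lambda> A * \<mu> B\<close>; taking for \<open>B\<close> the unit ball,
  which \<open>U\<close> preserves, identifies the image of Lebesgue measure under \<open>U\<close>.\<close>
lemma lborel_preserving_orthogonal:
  fixes U :: "'a::euclidean_space \<Rightarrow> 'a"
  assumes U: "orthogonal_transformation U"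
  shows "lborel_preserving U"
proof
  have [measurable]: "U \<in> borel_measurable borel" by (rule orthogonal_transformation_borel[OF U])
  then show "U \<in> borel_measurable borel" .
  define V where "V = inv U"
  have V: "orthogonal_transformation V" using U unfolding V_def by (rule orthogonal_transformation_inv)
  have UV: "U (V x) = x" for x
    using U by (simp add: V_def orthogonal_transformation_surj surj_f_inv_f)
  have nU: "norm (U x) = norm x" for x using U by (simp add: orthogonal_transformation)
  let ?M = "distr lborel borel U"
  let ?B = "ball 0 1 :: 'a set"
  have [measurable]: "?B \<in> sets borel" by simp
  have *: "emeasure ?M A * emeasure lborel ?B = emeasure lborel A * emeasure lborel ?B"
    if [measurable]: "A \<in> sets borel" for A :: "'a set"
  proof -
    have "emeasure ?M A * emeasure lborel ?B = (\<integral>\<^sup>+x. indicator A (U x) \<partial>lborel) * emeasure lborel ?B"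
      by (subst emeasure_distr) (auto simp: nn_integral_indicator[symmetric] indicator_def vimage_def simp del: nn_integral_indicator intro!: nn_integral_cong arg_cong2[where f="(*)"])
    also have "\<dots> = (\<integral>\<^sup>+x. (\<integral>\<^sup>+y. indicator A (U x) * indicator ?B y \<partial>lborel) \<partial>lborel)"
    proof -
      have "(\<integral>\<^sup>+y. indicator A (U x) * indicator ?B y \<partial>lborel) = indicator A (U x) * emeasure lborel ?B" for x
        by (subst nn_integral_cmult) (auto intro!: borel_measurable_indicator)
      then show ?thesis by (subst nn_integral_multc[symmetric]) auto
    qed
    also have "\<dots> = (\<integral>\<^sup>+x. (\<integral>\<^sup>+y. indicator A (U x) * indicator ?B (y + U x) \<partial>lborel) \<partial>lborel)"
    proof (rule nn_integral_cong)
      fix x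
      show "(\<integral>\<^sup>+y. indicator A (U x) * indicator ?B y \<partial>lborel) = (\<integral>\<^sup>+y. indicator A (U x) * indicator ?B (y + U x) \<partial>lborel)"
        by (rule lborel_preserving.nn_integral[OF lborel_preserving_translate,
              of "\<lambda>y. indicator A (U x) * indicator ?B y", symmetric]) auto
    qed
    also have "\<dots> = (\<integral>\<^sup>+y. (\<integral>\<^sup>+x. indicator A (U x) * indicator ?B (y + U x) \<partial>lborel) \<partial>lborel)"
      by (rule lborel_pair.Fubini') auto
    also have "\<dots> = (\<integral>\<^sup>+y. (\<integral>\<^sup>+x. indicator A (U x - y) * indicator ?B (U x) \<partial>lborel) \<partial>lborel)"
    proof (rule nn_integral_cong)
      \<comment> \<open>Shifting \<open>x\<close> by \<open>- V y\<close> turns \<open>U x\<close>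
        into \<open>U x - y\<close>. Through this use of linearity the image measure is seen to be
        translation invariant.\<close>
      fix y
      have "(\<integral>\<^sup>+x. indicator A (U x) * indicator ?B (y + U x) \<partial>lborel)
          = (\<integral>\<^sup>+x. indicator A (U x - y) * indicator ?B (y + (U x - y)) \<partial>lborel)"
        using lborel_preserving.nn_integral[OF lborel_preserving_translate, of "\<lambda>x. indicator A (U x) * indicator ?B (y + U x)" "- V y"]
        by (simp add: UV linear_diff[OF orthogonal_transformation_linear[OF U]])
      then show "(\<integral>\<^sup>+x. indicator A (U x) * indicator ?B (y + U x) \<partial>lborel)
          = (\<integral>\<^sup>+x. indicator A (U x - y) * indicator ?B (U x) \<partial>lborel)" by simp
    qed
    also have "\<dots> = (\<integral>\<^sup>+x. (\<integral>\<^sup>+y. indicator A (U x - y) * indicator ?B (U x) \<partial>lborel) \<partial>lborel)"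
      by (rule lborel_pair.Fubini') auto
    also have "\<dots> = (\<integral>\<^sup>+x. (\<integral>\<^sup>+y. indicator A y * indicator ?B (U x) \<partial>lborel) \<partial>lborel)"
    proof (rule nn_integral_cong)
      fix x
      show "(\<integral>\<^sup>+y. indicator A (U x - y) * indicator ?B (U x) \<partial>lborel) = (\<integral>\<^sup>+y. indicator A y * indicator ?B (U x) \<partial>lborel)"
        by (rule lborel_preserving.nn_integral[OF lborel_preserving_reflect,
              of "\<lambda>y. indicator A y * indicator ?B (U x)"]) auto
    qed
    also have "\<dots> = emeasure lborel A * (\<integral>\<^sup>+x. indicator ?B (U x) \<partial>lborel)"
    proof -
      have "(\<integral>\<^sup>+y. indicator A y * indicator ?B (U x) \<partial>lborel) = emeasure lborel A * indicator ?B (U x)" for x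
        by (subst nn_integral_multc) auto
      then show ?thesis by (subst nn_integral_cmult[symmetric]) auto
    qed
    also have "(\<integral>\<^sup>+x. indicator ?B (U x) \<partial>lborel) = (\<integral>\<^sup>+x. indicator ?B x \<partial>lborel)"
      by (intro nn_integral_cong) (simp add: indicator_def nU)
    finally show ?thesis by simp
  qed
  have B: "emeasure lborel ?B \<noteq> 0" "emeasure lborel ?B \<noteq> \<infinity>"
    by (auto simp: emeasure_ball ennreal_eq_0_iff not_le)
  show "distr lborel borel U = lborel"
  proof (rule measure_eqI)
    fix A assume "A \<in> sets (distr lborel borel U)"
    then have "A \<in> sets borel" by simp
    from *[OF this] B show "emeasure (distr lborel borel U) A = emeasure lborel A"
      by (simp add: mult.commute[of _ "emeasure lborel ?B"] ennreal_mult_cancel_left)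
  qed simp
qed

section \<open>Dilations of Lebesgue measure\<close>

lemma nn_integral_lborel_scale:
  fixes f :: "'a::euclidean_space \<Rightarrow> ennreal"
  assumes [measurable]: "f \<in> borel_measurable borel" and c: "c > 0"
  shows "(\<integral>\<^sup>+x. f (c *\<^sub>R x) \<partial>lborel) = ennreal (c powr - real DIM('a)) * (\<integral>\<^sup>+x. f x \<partial>lborel)"
proof -
  have "(\<integral>\<^sup>+x. f x \<partial>lborel) = (\<integral>\<^sup>+x. f x \<partial>density (distr lborel borel (\<lambda>x. 0 + c *\<^sub>R x)) (\<lambda>_. ennreal (\<bar>c\<bar>^DIM('a))))"
    using c by (subst lborel_affine[of c 0]) auto
  also have "\<dots> = ennreal (c ^ DIM('a)) * (\<integral>\<^sup>+x. f (c *\<^sub>R x) \<partial>lborel)"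
    using c by (subst nn_integral_density) (auto simp: nn_integral_distr nn_integral_cmult)
  finally show ?thesis using c
    by (simp add: mult.assoc[symmetric] ennreal_mult[symmetric] powr_minus powr_realpow)
qed

lemma integral_lborel_scale:
  fixes f :: "'a::euclidean_space \<Rightarrow> 'b::{banach,second_countable_topology}"
  assumes [measurable]: "f \<in> borel_measurable borel" and c: "c > 0"
  shows "(\<integral>x. f (c *\<^sub>R x) \<partial>lborel) = (c powr - real DIM('a)) *\<^sub>R (\<integral>x. f x \<partial>lborel)"
proof -
  have "(\<integral>x. f x \<partial>lborel) = (\<integral>x. f x \<partial>density (distr lborel borel (\<lambda>x. 0 + c *\<^sub>R x)) (\<lambda>_. ennreal (\<bar>c\<bar>^DIM('a))))"
    using c by (subst lborel_affine[of c 0]) auto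
  also have "\<dots> = c ^ DIM('a) *\<^sub>R (\<integral>x. f (c *\<^sub>R x) \<partial>lborel)"
    using c by (subst integral_density) (auto simp: integral_distr)
  finally show ?thesis using c by (simp add: powr_minus powr_realpow)
qed

lemma integrable_lborel_scale:
  fixes f :: "'a::euclidean_space \<Rightarrow> 'b::{banach,second_countable_topology}"
  assumes [measurable]: "f \<in> borel_measurable borel" and c: "c > 0"
  shows "integrable lborel (\<lambda>x. f (c *\<^sub>R x)) \<longleftrightarrow> integrable lborel f"
  unfolding integrable_iff_bounded
  using nn_integral_lborel_scale[of "\<lambda>x. ennreal (norm (f x))" c] c
  by (auto simp: ennreal_mult_less_top)

lemma L2sq_scale:
  fixes f :: "'a::euclidean_space \<Rightarrow> 'b::{real_normed_vector,second_countable_topology}"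
  assumes [measurable]: "f \<in> borel_measurable borel" and c: "c > 0"
  shows "L2sq (\<lambda>x. f (c *\<^sub>R x)) = ennreal (c powr - real DIM('a)) * L2sq f"
  unfolding L2sq_def using c by (intro nn_integral_lborel_scale) auto

lemma AE_lborel_scale:
  fixes P :: "'a::euclidean_space \<Rightarrow> bool"
  assumes c: "c > 0" and P: "AE x in lborel. P x"
  shows "AE x in lborel. P (c *\<^sub>R x)"
proof -
  have eq: "density (distr lborel borel (\<lambda>x. c *\<^sub>R x)) (\<lambda>_. ennreal (\<bar>c\<bar>^DIM('a))) = (lborel :: 'a measure)"
    using lborel_affine[of c "0::'a"] c by simp
  have "AE x in density (distr lborel borel (\<lambda>x. c *\<^sub>R x)) (\<lambda>_. ennreal (\<bar>c\<bar>^DIM('a))). P x"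
    unfolding eq by fact
  then have "AE x in distr lborel borel (\<lambda>x. c *\<^sub>R x). P x"
    using c by (subst (asm) AE_density) auto
  then show ?thesis by (intro AE_distrD[of "\<lambda>x. c *\<^sub>R x" lborel borel]) auto
qed

section \<open>Cauchy--Schwarz and continuity of translations\<close>

lemma nn_Cauchy_Schwarz:
  fixes f :: "'a::euclidean_space \<Rightarrow> 'b::{real_normed_vector,second_countable_topology}"
    and g :: "'a \<Rightarrow> 'c::{real_normed_vector,second_countable_topology}"
  assumes [measurable]: "f \<in> borel_measurable borel" "g \<in> borel_measurable borel"
  shows "(\<integral>\<^sup>+x. ennreal (norm (f x) * norm (g x)) \<partial>lborel)\<^sup>2 \<le> L2sq f * L2sq g"
  using Cauchy_Schwarz_nn_integral[of "\<lambda>x. ennreal (norm (f x))" lborel "\<lambda>x. ennreal (norm (g x))"]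
  by (simp add: L2sq_def ennreal_mult ennreal_power)

lemma integrable_mult_L2:
  fixes f g :: "'a::euclidean_space \<Rightarrow> complex"
  assumes [measurable]: "f \<in> borel_measurable borel" "g \<in> borel_measurable borel"
    and fin: "L2sq f < top" "L2sq g < top"
  shows "integrable lborel (\<lambda>x. f x * g x)"
proof (rule integrableI_bounded)
  have "(\<integral>\<^sup>+x. ennreal (norm (f x) * norm (g x)) \<partial>lborel)\<^sup>2 < \<infinity>"
    using nn_Cauchy_Schwarz[of f g] fin by (auto simp: ennreal_mult_less_top intro: le_less_trans)
  then show "(\<integral>\<^sup>+x. ennreal (norm (f x * g x)) \<partial>lborel) < \<infinity>"
    by (simp add: norm_mult power_less_top_ennreal)
qed simp

lemma Cauchy_Schwarz_complex:
  fixes f g :: "'a::euclidean_space \<Rightarrow> complex"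
  assumes [measurable]: "f \<in> borel_measurable borel" "g \<in> borel_measurable borel"
  shows "ennreal ((norm (\<integral>x. f x * g x \<partial>lborel))\<^sup>2) \<le> L2sq f * L2sq g"
proof -
  have "ennreal (norm (\<integral>x. f x * g x \<partial>lborel)) \<le> (\<integral>\<^sup>+x. ennreal (norm (f x * g x)) \<partial>lborel)"
    by (cases "integrable lborel (\<lambda>x. f x * g x)")
       (auto simp: not_integrable_integral_eq intro: integral_norm_bound_ennreal)
  then have "(ennreal (norm (\<integral>x. f x * g x \<partial>lborel)))\<^sup>2 \<le> (\<integral>\<^sup>+x. ennreal (norm (f x) * norm (g x)) \<partial>lborel)\<^sup>2"
    by (intro power_mono) (auto simp: norm_mult)
  also have "\<dots> \<le> L2sq f * L2sq g" by (rule nn_Cauchy_Schwarz) auto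
  finally show ?thesis by (simp add: ennreal_power)
qed

text \<open>Cauchy-Schwarz applied to the difference. This is how the multiplication formula passes
  to L^2 limits.\<close>

lemma tendsto_integral_mult_L2:
  fixes f :: "nat \<Rightarrow> 'a::euclidean_space \<Rightarrow> complex"
  assumes [measurable]: "\<And>n. f n \<in> borel_measurable borel" "F \<in> borel_measurable borel" "g \<in> borel_measurable borel"
    and fin: "\<And>n. L2sq (f n) < top" "L2sq F < top" "L2sq g < top"
    and lim: "(\<lambda>n. L2sq (\<lambda>x. f n x - F x)) \<longlonglongrightarrow> 0"
  shows "(\<lambda>n. \<integral>x. f n x * g x \<partial>lborel) \<longlonglongrightarrow> (\<integral>x. F x * g x \<partial>lborel)"
proof -
  have eq: "(\<integral>x. f n x * g x \<partial>lborel) - (\<integral>x. F x * g x \<partial>lborel) = (\<integral>x. (f n x - F x) * g x \<partial>lborel)" for n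
    using fin by (subst Bochner_Integration.integral_diff[symmetric])
      (auto intro!: integrable_mult_L2 simp: algebra_simps)
  have "(\<lambda>n. L2sq (\<lambda>x. f n x - F x) * L2sq g) \<longlonglongrightarrow> 0 * L2sq g"
    using fin by (intro tendsto_mult_ennreal lim) auto
  then have "(\<lambda>n. ennreal ((norm (\<integral>x. (f n x - F x) * g x \<partial>lborel))\<^sup>2)) \<longlonglongrightarrow> 0"
    by (intro tendsto_sandwich[OF _ always_eventually[OF allI[OF Cauchy_Schwarz_complex]] tendsto_const]) auto
  then have "(\<lambda>n. (norm (\<integral>x. (f n x - F x) * g x \<partial>lborel))\<^sup>2) \<longlonglongrightarrow> 0"
    by (simp add: ennreal_tendsto_0_iff)
  then have "(\<lambda>n. sqrt ((norm (\<integral>x. (f n x - F x) * g x \<partial>lborel))\<^sup>2)) \<longlonglongrightarrow> sqrt 0"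
    by (rule tendsto_real_sqrt)
  then have "(\<lambda>n. (\<integral>x. f n x * g x \<partial>lborel) - (\<integral>x. F x * g x \<partial>lborel)) \<longlonglongrightarrow> 0"
    by (simp add: eq tendsto_norm_zero_iff)
  then show ?thesis by (simp add: LIM_zero_iff)
qed

text \<open>Regularity gives a compact \<open>K\<close> inside \<open>A\<close> and an open
  \<open>U\<close> around \<open>A\<close> with \<open>U - K\<close> small. A shift shorter than the
  distance from \<open>K\<close> to the complement of \<open>U\<close> changes the indicator only on
  \<open>U - K\<close> and its translate.\<close>

lemma translation_continuous_indicator:
  fixes A :: "'a::euclidean_space set"
  assumes [measurable]: "A \<in> sets borel" and fin: "emeasure lborel A < \<infinity>" and e: "(e::real) > 0"
  shows "\<exists>d>0. \<forall>z. norm z < d \<longrightarrow> (\<integral>\<^sup>+x. ennreal \<bar>indicator A (x + z) - indicator A x\<bar> \<partial>lborel) \<le> ennreal e"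
proof -
  obtain U where U: "open U" "A \<subseteq> U" "emeasure lborel (U - A) < ennreal (e/4)"
    using outer_regular_lborel[OF assms(1), of "e/4"] e by auto
  \<comment> \<open>Restricting Lebesgue measure to \<open>A\<close> makes it finite, as inner
    regularity is applied to a finite measure.\<close>
  let ?M = "density lborel (indicator A)"
  have "emeasure ?M A = (SUP K \<in> {K. K \<subseteq> A \<and> compact K}. emeasure ?M K)"
    by (rule inner_regular) (use fin in \<open>auto simp: emeasure_density\<close>)
  have eM: "emeasure ?M B = emeasure lborel B" if "B \<subseteq> A" "B \<in> sets borel" for B
  proof -
    have "emeasure ?M B = (\<integral>\<^sup>+x. indicator A x * indicator B x \<partial>lborel)"
      using that by (intro emeasure_density) auto
    also have "\<dots> = (\<integral>\<^sup>+x. indicator B x \<partial>lborel)"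
      using that by (intro nn_integral_cong) (auto split: split_indicator)
    finally show ?thesis using that by simp
  qed
  have "\<exists>K. K \<subseteq> A \<and> compact K \<and> emeasure lborel (A - K) \<le> ennreal (e/4)"
  proof (cases "emeasure lborel A \<le> ennreal (e/4)")
    case True
    then show ?thesis by (intro exI[of _ "{}"]) auto
  next
    case False
    obtain a where a: "emeasure lborel A = ennreal a" "a \<ge> 0" using fin by (cases "emeasure lborel A") auto
    have "ennreal (a - e/4) < (SUP K \<in> {K. K \<subseteq> A \<and> compact K}. emeasure ?M K)"
      unfolding \<open>emeasure ?M A = _\<close>[symmetric] using eM[of A] a e False
      by (auto simp: ennreal_less_iff ennreal_le_iff)
    then obtain K where K: "K \<subseteq> A" "compact K" "ennreal (a - e/4) < emeasure ?M K"
      by (auto simp: less_SUP_iff)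
    have Kb: "K \<in> sets borel" using K by (simp add: borel_closed compact_imp_closed)
    have fK: "emeasure lborel K \<noteq> \<infinity>" using emeasure_mono[of K A lborel] K fin by (auto simp: top_unique)
    obtain k where k: "emeasure lborel K = ennreal k" "k \<ge> 0" using fK by (cases "emeasure lborel K") auto
    have "a - e/4 < k" using K(3) eM[OF K(1) Kb] k a False
      by (auto simp: ennreal_less_iff ennreal_le_iff2 not_le)
    moreover have "emeasure lborel (A - K) = ennreal (a - k)"
      using emeasure_Diff[of lborel K A] fK K Kb k a by (simp add: ennreal_minus)
    ultimately show ?thesis using K by (intro exI[of _ K]) (auto intro!: ennreal_leI)
  qed
  then obtain K where K: "K \<subseteq> A" "compact K" "emeasure lborel (A - K) \<le> ennreal (e/4)" by auto
  have [measurable]: "K \<in> sets borel" "U \<in> sets borel"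
    using K U by (auto simp: borel_closed compact_imp_closed)
  have "K \<inter> - U = {}" using K U by auto
  then obtain d where d: "d > 0" "\<And>x y. x \<in> K \<Longrightarrow> y \<in> - U \<Longrightarrow> d \<le> dist x y"
    using separate_compact_closed[of K "- U"] K U by (auto simp: closed_Compl)
  have UK: "emeasure lborel (U - K) \<le> ennreal (e/2)"
  proof -
    have "U - K = (U - A) \<union> (A - K)" using K U by auto
    then have "emeasure lborel (U - K) \<le> emeasure lborel (U - A) + emeasure lborel (A - K)"
      by (simp add: emeasure_subadditive)
    also have "\<dots> \<le> ennreal (e/4) + ennreal (e/4)" using U K by (intro add_mono) auto
    also have "\<dots> = ennreal (e/2)" using e by (subst ennreal_plus[symmetric]) auto
    finally show ?thesis .
  qed
  show ?thesis
  proof (intro exI conjI allI impI)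
    show "d > 0" by fact
    fix z :: 'a assume z: "norm z < d"
    have "(\<integral>\<^sup>+x. ennreal \<bar>indicator A (x + z) - indicator A x\<bar> \<partial>lborel)
       \<le> (\<integral>\<^sup>+x. indicator (U - K) (x + z) + indicator (U - K) x \<partial>lborel)"
    proof (rule nn_integral_mono)
      fix x
      have "x + z \<in> K \<Longrightarrow> x \<in> U" using d(2)[of "x + z" x] z by (auto simp: dist_norm)
      moreover have "x \<in> K \<Longrightarrow> x + z \<in> U" using d(2)[of x "x + z"] z by (auto simp: dist_norm)
      ultimately show "ennreal \<bar>indicator A (x + z) - indicator A x\<bar> \<le> indicator (U - K) (x + z) + indicator (U - K) x"
        using K(1) U(2) by (auto simp: indicator_def)
    qed
    also have "\<dots> = (\<integral>\<^sup>+x. indicator (U - K) (x + z) \<partial>lborel) + (\<integral>\<^sup>+x. indicator (U - K) x \<partial>lborel)"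
      by (rule nn_integral_add) auto
    also have "(\<integral>\<^sup>+x. indicator (U - K) (x + z) \<partial>lborel) = (\<integral>\<^sup>+x. indicator (U - K) x \<partial>lborel)"
      by (rule lborel_preserving.nn_integral[OF lborel_preserving_translate]) auto
    also have "\<dots> + (\<integral>\<^sup>+x. indicator (U - K) x \<partial>lborel) \<le> ennreal (e/2) + ennreal (e/2)"
      using UK by (intro add_mono) auto
    also have "\<dots> = ennreal e" using e by (subst ennreal_plus[symmetric]) auto
    finally show "(\<integral>\<^sup>+x. ennreal \<bar>indicator A (x + z) - indicator A x\<bar> \<partial>lborel) \<le> ennreal e" .
  qed
qed

text \<open>Approximation by simple functions, run through the induction principle for integrable
  functions. In the limit case the approximation error occurs twice, at \<open>x\<close> and at
  \<open>x + z\<close>, and translations preserve the integral; hence \<open>e/3\<close>.\<close>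

lemma translation_continuous_L1:
  fixes f :: "'a::euclidean_space \<Rightarrow> real"
  assumes "integrable lborel f" "(e::real) > 0"
  shows "\<exists>d>0. \<forall>z. norm z < d \<longrightarrow> (\<integral>\<^sup>+x. ennreal \<bar>f (x + z) - f x\<bar> \<partial>lborel) \<le> ennreal e"
  using assms
proof (induction arbitrary: e rule: integrable_induct)
  case (base A c)
  have [measurable]: "A \<in> sets borel" using base by simp
  obtain d where d: "d > 0" "\<And>z. norm z < d \<Longrightarrow>
      (\<integral>\<^sup>+x. ennreal \<bar>indicator A (x + z) - indicator A x\<bar> \<partial>lborel) \<le> ennreal (e / (\<bar>c\<bar> + 1))"
    using translation_continuous_indicator[of A "e / (\<bar>c\<bar> + 1)"] base by auto
  show ?case
  proof (intro exI conjI allI impI)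
    show "d > 0" by fact
    fix z :: 'a assume z: "norm z < d"
    have "(\<integral>\<^sup>+x. ennreal \<bar>indicator A (x + z) *\<^sub>R c - indicator A x *\<^sub>R c\<bar> \<partial>lborel)
        = (\<integral>\<^sup>+x. ennreal \<bar>c\<bar> * ennreal \<bar>indicator A (x + z) - indicator A x\<bar> \<partial>lborel)"
      by (intro nn_integral_cong) (simp add: ennreal_mult[symmetric] abs_mult[symmetric] algebra_simps)
    also have "\<dots> = ennreal \<bar>c\<bar> * (\<integral>\<^sup>+x. ennreal \<bar>indicator A (x + z) - indicator A x\<bar> \<partial>lborel)"
      by (rule nn_integral_cmult) measurable
    also have "\<dots> \<le> ennreal \<bar>c\<bar> * ennreal (e / (\<bar>c\<bar> + 1))"
      using d(2)[OF z] by (rule mult_left_mono) simp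
    also have "\<dots> \<le> ennreal e"
      using \<open>e > 0\<close> by (subst ennreal_mult[symmetric]) (auto intro!: ennreal_leI simp: field_simps)
    finally show "(\<integral>\<^sup>+x. ennreal \<bar>indicator A (x + z) *\<^sub>R c - indicator A x *\<^sub>R c\<bar> \<partial>lborel) \<le> ennreal e" .
  qed
next
  case (add f g)
  have [measurable]: "f \<in> borel_measurable borel" "g \<in> borel_measurable borel"
    using add.hyps by (auto dest: borel_measurable_integrable)
  obtain d1 where d1: "d1 > 0" "\<And>z. norm z < d1 \<Longrightarrow> (\<integral>\<^sup>+x. ennreal \<bar>f (x + z) - f x\<bar> \<partial>lborel) \<le> ennreal (e/2)"
    using add.IH(1)[of "e/2"] add.prems by auto
  obtain d2 where d2: "d2 > 0" "\<And>z. norm z < d2 \<Longrightarrow> (\<integral>\<^sup>+x. ennreal \<bar>g (x + z) - g x\<bar> \<partial>lborel) \<le> ennreal (e/2)"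
    using add.IH(2)[of "e/2"] add.prems by auto
  show ?case
  proof (intro exI conjI allI impI)
    show "min d1 d2 > 0" using d1 d2 by simp
    fix z :: 'a assume z: "norm z < min d1 d2"
    have "(\<integral>\<^sup>+x. ennreal \<bar>f (x + z) + g (x + z) - (f x + g x)\<bar> \<partial>lborel)
        \<le> (\<integral>\<^sup>+x. ennreal \<bar>f (x + z) - f x\<bar> + ennreal \<bar>g (x + z) - g x\<bar> \<partial>lborel)"
      by (intro nn_integral_mono) (simp add: ennreal_plus[symmetric] del: ennreal_plus)
    also have "\<dots> = (\<integral>\<^sup>+x. ennreal \<bar>f (x + z) - f x\<bar> \<partial>lborel) + (\<integral>\<^sup>+x. ennreal \<bar>g (x + z) - g x\<bar> \<partial>lborel)"
      by (rule nn_integral_add) measurable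
    also have "\<dots> \<le> ennreal (e/2) + ennreal (e/2)" using d1 d2 z by (intro add_mono) auto
    also have "\<dots> = ennreal e" using add.prems by (subst ennreal_plus[symmetric]) auto
    finally show "(\<integral>\<^sup>+x. ennreal \<bar>f (x + z) + g (x + z) - (f x + g x)\<bar> \<partial>lborel) \<le> ennreal e" .
  qed
next
  case (lim f s)
  have [measurable]: "f \<in> borel_measurable borel" "\<And>i. s i \<in> borel_measurable borel"
    using lim.hyps by (auto dest: borel_measurable_integrable)
  have "(\<lambda>i. \<integral>\<^sup>+x. ennreal (norm (f x - s i x)) \<partial>lborel) \<longlonglongrightarrow> 0"
  proof (rule nn_integral_dominated_convergence_norm[where w="\<lambda>x. 2 * norm (f x)"])
    show "(\<integral>\<^sup>+x. ennreal (2 * norm (f x)) \<partial>lborel) < \<infinity>"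
      using lim.hyps(4) by (simp add: ennreal_mult nn_integral_cmult ennreal_mult_less_top integrable_iff_bounded)
  qed (use lim.hyps in auto)
  then have "\<forall>\<^sub>F i in sequentially. (\<integral>\<^sup>+x. ennreal (norm (f x - s i x)) \<partial>lborel) < ennreal (e/3)"
    using lim.prems by (intro order_tendstoD) auto
  then obtain i where i: "(\<integral>\<^sup>+x. ennreal (norm (f x - s i x)) \<partial>lborel) < ennreal (e/3)"
    by (auto simp: eventually_sequentially)
  obtain d where d: "d > 0" "\<And>z. norm z < d \<Longrightarrow> (\<integral>\<^sup>+x. ennreal \<bar>s i (x + z) - s i x\<bar> \<partial>lborel) \<le> ennreal (e/3)"
    using lim.IH[of "e/3" i] lim.prems by auto
  show ?case
  proof (intro exI conjI allI impI)
    show "d > 0" by fact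
    fix z :: 'a assume z: "norm z < d"
    let ?g = "\<lambda>x. ennreal (norm (f x - s i x))"
    have "(\<integral>\<^sup>+x. ennreal \<bar>f (x + z) - f x\<bar> \<partial>lborel)
        \<le> (\<integral>\<^sup>+x. (?g (x + z) + ?g x) + ennreal \<bar>s i (x + z) - s i x\<bar> \<partial>lborel)"
      by (intro nn_integral_mono) (simp add: ennreal_plus[symmetric] del: ennreal_plus)
    also have "\<dots> = ((\<integral>\<^sup>+x. ?g (x + z) \<partial>lborel) + (\<integral>\<^sup>+x. ?g x \<partial>lborel)) + (\<integral>\<^sup>+x. ennreal \<bar>s i (x + z) - s i x\<bar> \<partial>lborel)"
      by (subst nn_integral_add, measurable)+
    also have "(\<integral>\<^sup>+x. ?g (x + z) \<partial>lborel) = (\<integral>\<^sup>+x. ?g x \<partial>lborel)"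
      by (rule lborel_preserving.nn_integral[OF lborel_preserving_translate]) measurable
    also have "((\<integral>\<^sup>+x. ?g x \<partial>lborel) + (\<integral>\<^sup>+x. ?g x \<partial>lborel)) + (\<integral>\<^sup>+x. ennreal \<bar>s i (x + z) - s i x\<bar> \<partial>lborel)
        \<le> (ennreal (e/3) + ennreal (e/3)) + ennreal (e/3)"
      using d z i by (intro add_mono) auto
    also have "\<dots> = ennreal e" using lim.prems by (simp add: ennreal_plus[symmetric] del: ennreal_plus)
    finally show "(\<integral>\<^sup>+x. ennreal \<bar>f (x + z) - f x\<bar> \<partial>lborel) \<le> ennreal e" .
  qed
qed

text \<open>For nonnegative numbers the square of a difference is at most the absolute difference of
  the squares, so the L^1 statement for the square of \<open>u\<close> suffices.\<close>

lemma translation_continuous_L2_nonneg: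
  fixes u :: "'a::euclidean_space \<Rightarrow> real"
  assumes [measurable]: "u \<in> borel_measurable borel" and nn: "\<And>x. u x \<ge> 0" and fin: "L2sq u < top" and e: "(e::real) > 0"
  shows "\<exists>d>0. \<forall>z. norm z < d \<longrightarrow> L2sq (\<lambda>x. u (x + z) - u x) \<le> ennreal e"
proof -
  have "integrable lborel (\<lambda>x. (u x)\<^sup>2)"
    using fin by (intro integrableI_bounded) (auto simp: L2sq_def)
  from translation_continuous_L1[OF this e] obtain d where d: "d > 0"
    "\<And>z. norm z < d \<Longrightarrow> (\<integral>\<^sup>+x. ennreal \<bar>(u (x + z))\<^sup>2 - (u x)\<^sup>2\<bar> \<partial>lborel) \<le> ennreal e" by auto
  have *: "(a - b)\<^sup>2 \<le> \<bar>a\<^sup>2 - b\<^sup>2\<bar>" if "a \<ge> 0" "b \<ge> 0" for a b :: real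
  proof -
    have "(a - b)\<^sup>2 = \<bar>a - b\<bar> * \<bar>a - b\<bar>" by (simp add: power2_eq_square abs_mult[symmetric])
    also have "\<dots> \<le> \<bar>a - b\<bar> * \<bar>a + b\<bar>" using that by (intro mult_left_mono) auto
    also have "\<dots> = \<bar>a\<^sup>2 - b\<^sup>2\<bar>" by (simp add: abs_mult[symmetric] power2_eq_square algebra_simps)
    finally show ?thesis .
  qed
  have "L2sq (\<lambda>x. u (x + z) - u x) \<le> ennreal e" if "norm z < d" for z
  proof -
    have "L2sq (\<lambda>x. u (x + z) - u x) \<le> (\<integral>\<^sup>+x. ennreal \<bar>(u (x + z))\<^sup>2 - (u x)\<^sup>2\<bar> \<partial>lborel)"
      unfolding L2sq_def by (intro nn_integral_mono ennreal_leI) (use * nn in auto)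
    with d(2)[OF that] show ?thesis by (rule order_trans[rotated])
  qed
  with d(1) show ?thesis by blast
qed

lemma translation_continuous_L2_real:
  fixes u :: "'a::euclidean_space \<Rightarrow> real"
  assumes [measurable]: "u \<in> borel_measurable borel" and fin: "L2sq u < top" and e: "(e::real) > 0"
  shows "\<exists>d>0. \<forall>z. norm z < d \<longrightarrow> L2sq (\<lambda>x. u (x + z) - u x) \<le> ennreal e"
proof -
  let ?p = "\<lambda>x. max (u x) 0" and ?m = "\<lambda>x. max (- u x) 0"
  have fin': "L2sq ?p < top" "L2sq ?m < top"
    using fin by (auto intro!: le_less_trans[OF L2sq_mono_AE[of _ u]])
  obtain d1 where d1: "d1 > 0" "\<And>z. norm z < d1 \<Longrightarrow> L2sq (\<lambda>x. ?p (x + z) - ?p x) \<le> ennreal (e/4)"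
    using translation_continuous_L2_nonneg[of ?p "e/4"] fin' e by auto
  obtain d2 where d2: "d2 > 0" "\<And>z. norm z < d2 \<Longrightarrow> L2sq (\<lambda>x. ?m (x + z) - ?m x) \<le> ennreal (e/4)"
    using translation_continuous_L2_nonneg[of ?m "e/4"] fin' e by auto
  have "L2sq (\<lambda>x. u (x + z) - u x) \<le> ennreal e" if z: "norm z < min d1 d2" for z
  proof -
    have "L2sq (\<lambda>x. u (x + z) - u x) = L2sq (\<lambda>x. (?p (x + z) - ?p x) - (?m (x + z) - ?m x))"
      by (intro arg_cong[of _ _ L2sq]) (auto simp: max_def)
    also have "\<dots> \<le> 2 * L2sq (\<lambda>x. ?p (x + z) - ?p x) + 2 * L2sq (\<lambda>x. ?m (x + z) - ?m x)"
      by (rule L2sq_diff_le) measurable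
    also have "\<dots> \<le> 2 * ennreal (e/4) + 2 * ennreal (e/4)"
      using d1 d2 z by (intro add_mono mult_left_mono) auto
    also have "\<dots> = ennreal e" using e
      by (simp add: ennreal_plus[symmetric] ennreal_mult[symmetric] ennreal_numeral[symmetric] del: ennreal_plus ennreal_numeral)
    finally show ?thesis .
  qed
  then show ?thesis using d1 d2 by (intro exI[of _ "min d1 d2"]) auto
qed

lemma L2sq_complex:
  fixes f :: "'a::euclidean_space \<Rightarrow> complex"
  assumes [measurable]: "f \<in> borel_measurable borel"
  shows "L2sq f = L2sq (\<lambda>x. Re (f x)) + L2sq (\<lambda>x. Im (f x))"
  unfolding L2sq_def
  by (subst nn_integral_add[symmetric]) (auto simp: cmod_power2 ennreal_plus)

lemma translation_continuous_L2:
  fixes f :: "'a::euclidean_space \<Rightarrow> complex"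
  assumes [measurable]: "f \<in> borel_measurable borel" and fin: "L2sq f < top" and e: "(e::real) > 0"
  shows "\<exists>d>0. \<forall>z. norm z < d \<longrightarrow> L2sq (\<lambda>x. f (x + z) - f x) \<le> ennreal e"
proof -
  have fin': "L2sq (\<lambda>x. Re (f x)) < top" "L2sq (\<lambda>x. Im (f x)) < top"
    using fin by (auto simp: L2sq_complex)
  obtain d1 where d1: "d1 > 0" "\<And>z. norm z < d1 \<Longrightarrow> L2sq (\<lambda>x. Re (f (x + z)) - Re (f x)) \<le> ennreal (e/2)"
    using translation_continuous_L2_real[of "\<lambda>x. Re (f x)" "e/2"] fin' e by auto
  obtain d2 where d2: "d2 > 0" "\<And>z. norm z < d2 \<Longrightarrow> L2sq (\<lambda>x. Im (f (x + z)) - Im (f x)) \<le> ennreal (e/2)"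
    using translation_continuous_L2_real[of "\<lambda>x. Im (f x)" "e/2"] fin' e by auto
  have "L2sq (\<lambda>x. f (x + z) - f x) \<le> ennreal e" if z: "norm z < min d1 d2" for z
  proof -
    have "L2sq (\<lambda>x. f (x + z) - f x) = L2sq (\<lambda>x. Re (f (x + z)) - Re (f x)) + L2sq (\<lambda>x. Im (f (x + z)) - Im (f x))"
      by (subst L2sq_complex) auto
    also have "\<dots> \<le> ennreal (e/2) + ennreal (e/2)" using d1 d2 z by (intro add_mono) auto
    also have "\<dots> = ennreal e" using e by (subst ennreal_plus[symmetric]) auto
    finally show ?thesis .
  qed
  then show ?thesis using d1 d2 by (intro exI[of _ "min d1 d2"]) auto
qed

section \<open>Plancherel's theorem\<close>

text \<open>The character and the Gaussian both factor over \<open>Basis\<close>; this reduces the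
  Gaussian transform to dimension one.\<close>

lemma
  fixes f :: "'a::euclidean_space \<Rightarrow> real \<Rightarrow> complex"
  assumes f: "\<And>b. b \<in> Basis \<Longrightarrow> integrable lborel (f b)"
  shows integrable_lborel_Basis_prod: "integrable lborel (\<lambda>x::'a. \<Prod>b\<in>Basis. f b (x \<bullet> b))"
    and integral_lborel_Basis_prod:
      "(\<integral>(x::'a). (\<Prod>b\<in>Basis. f b (x \<bullet> b)) \<partial>lborel) = (\<Prod>b\<in>Basis. \<integral>x. f b x \<partial>lborel)"
proof -
  interpret product_sigma_finite "\<lambda>_::'a. lborel :: real measure" ..
  have [measurable]: "b \<in> Basis \<Longrightarrow> f b \<in> borel_measurable borel" for b
    using f[of b] by (auto dest: borel_measurable_integrable)
  have T: "(\<lambda>f. \<Sum>b\<in>Basis. f b *\<^sub>R b) \<in> (\<Pi>\<^sub>M b\<in>Basis. lborel) \<rightarrow>\<^sub>M (borel :: 'a measure)" by measurable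
  have m: "(\<lambda>x::'a. \<Prod>b\<in>Basis. f b (x \<bullet> b)) \<in> borel_measurable borel" by measurable
  have eq: "(\<Prod>b\<in>Basis. f b ((\<Sum>b\<in>Basis. y b *\<^sub>R b) \<bullet> b)) = (\<Prod>b\<in>Basis. f b (y b))" for y :: "'a \<Rightarrow> real"
    by (intro prod.cong) (auto simp: inner_sum_left inner_Basis if_distrib sum.delta cong: if_cong)
  show "integrable lborel (\<lambda>x::'a. \<Prod>b\<in>Basis. f b (x \<bullet> b))"
    unfolding lborel_eq[where 'a='a] integrable_distr_eq[OF T m] eq
    by (rule product_integrable_prod) (use f in auto)
  show "(\<integral>(x::'a). (\<Prod>b\<in>Basis. f b (x \<bullet> b)) \<partial>lborel) = (\<Prod>b\<in>Basis. \<integral>x. f b x \<partial>lborel)"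
    unfolding lborel_eq[where 'a='a] integral_distr[OF T m] eq
    by (rule product_integral_prod) (use f in auto)
qed

section \<open>Characters and Gaussians\<close>

definition ek :: "'a::euclidean_space \<Rightarrow> 'a \<Rightarrow> complex" where
  "ek x \<xi> = exp (- (2 * pi * \<i>) * complex_of_real (x \<bullet> \<xi>))"

text \<open>Scaled so that \<open>gauss 1\<close> is its own Fourier transform, and so that the
  transform exchanges \<open>t\<close> and \<open>1/t\<close> up to a factor.\<close>

definition gauss :: "real \<Rightarrow> 'a::euclidean_space \<Rightarrow> real" where
  "gauss t x = exp (- pi * t * (norm x)\<^sup>2)"

lemma norm_ek [simp]: "norm (ek x \<xi>) = 1"
  unfolding ek_def by (simp add: norm_exp_eq_Re)

lemma borel_measurable_ek [measurable (raw)]: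
  assumes [measurable]: "f \<in> M \<rightarrow>\<^sub>M borel" "g \<in> M \<rightarrow>\<^sub>M borel"
  shows "(\<lambda>x. ek (f x) (g x)) \<in> borel_measurable M"
  unfolding ek_def by measurable

lemma ek_commute: "ek x \<xi> = ek \<xi> x" by (simp add: ek_def inner_commute)

lemma cnj_ek: "cnj (ek x \<xi>) = ek (- x) \<xi>"
  by (simp add: ek_def exp_cnj)

lemma ek_add_left: "ek (x + y) \<xi> = ek x \<xi> * ek y \<xi>"
  by (simp add: ek_def inner_add_left exp_add[symmetric] algebra_simps)

lemma borel_measurable_cnj [measurable (raw)]:
  "f \<in> borel_measurable M \<Longrightarrow> (\<lambda>x. cnj (f x)) \<in> borel_measurable M"
  by (rule measurable_compose[OF _ borel_measurable_continuous_onI]) (auto intro: continuous_intros)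

lemma gauss_measurable [measurable]: "gauss t \<in> borel_measurable borel"
  unfolding gauss_def by measurable

lemma gauss_pos: "gauss t x > 0" by (simp add: gauss_def)

lemma gauss_le_1: "t \<ge> 0 \<Longrightarrow> gauss t x \<le> 1"
  by (simp add: gauss_def mult_nonneg_nonneg)

lemma gauss_minus: "gauss t (- x) = gauss t x" by (simp add: gauss_def)

text \<open>The characteristic function of the standard normal distribution, rescaled:
  \<open>c\<close> is chosen so that \<open>(c * x)\<^sup>2 / 2\<close> is the Gaussian exponent,
  and \<open>u\<close> so that \<open>u * (c * x)\<close> is the phase.\<close>

lemma
  fixes \<eta> :: real
  assumes t: "t > 0"
  shows integrable_gauss_real: "integrable lborel (\<lambda>x. exp (- (2 * pi * \<i>) * complex_of_real (x * \<eta>)) * complex_of_real (exp (- pi * t * x\<^sup>2)))" (is "integrable _ ?f")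
    and integral_gauss_real: "(\<integral>x. exp (- (2 * pi * \<i>) * complex_of_real (x * \<eta>)) * complex_of_real (exp (- pi * t * x\<^sup>2)) \<partial>lborel)
       = complex_of_real (t powr (-1/2) * exp (- pi * \<eta>\<^sup>2 / t))"
proof -
  define c where "c = sqrt (2 * pi * t)"
  have c: "c > 0" "c\<^sup>2 = 2 * pi * t" using t by (auto simp: c_def)
  define u where "u = - 2 * pi * \<eta> / c"
  let ?g = "\<lambda>x. std_normal_density x *\<^sub>R exp (\<i> * complex_of_real (u * x))"
  have "(CLINT x|std_normal_distribution. iexp (u * x)) = complex_of_real (exp (- (u^2) / 2))"
    using char_std_normal_distribution by (simp add: char_def fun_eq_iff)
  then have I: "(\<integral>x. ?g x \<partial>lborel) = complex_of_real (exp (- (u^2) / 2))"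
    by (subst (asm) integral_density) (auto simp: normal_density_nonneg)
  have "integrable lborel ?g"
    by (rule Bochner_Integration.integrable_bound[of _ std_normal_density]) (auto simp: normal_density_nonneg)
  then have int: "integrable lborel (\<lambda>x. ?g (c * x))"
    using lborel_integrable_real_affine[of ?g c 0] c by simp
  have I2: "(\<integral>x. ?g x \<partial>lborel) = \<bar>c\<bar> *\<^sub>R (\<integral>x. ?g (c * x) \<partial>lborel)"
    using lborel_integral_real_affine[of c ?g 0] c by simp
  have eq: "?g (c * x) = complex_of_real (1 / sqrt (2 * pi)) * ?f x" for x
  proof -
    have 1: "u * (c * x) = - 2 * pi * \<eta> * x" using c by (simp add: u_def)
    have 2: "(c * x)\<^sup>2 / 2 = pi * t * x\<^sup>2" using c by (simp add: power_mult_distrib)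
    show ?thesis unfolding 1 normal_density_def using 2
      by (simp add: scaleR_conv_of_real mult_ac)
  qed
  have "integrable lborel (\<lambda>x. complex_of_real (sqrt (2 * pi)) * (complex_of_real (1 / sqrt (2 * pi)) * ?f x))"
    using int unfolding eq by (rule integrable_mult_right)
  then show "integrable lborel ?f"
    by (simp add: mult.assoc[symmetric] of_real_mult[symmetric] del: of_real_mult)
  have "complex_of_real (c / sqrt (2 * pi)) * (\<integral>x. ?f x \<partial>lborel) = complex_of_real (exp (- (u^2) / 2))"
  proof -
    have "complex_of_real (exp (- (u^2) / 2)) = complex_of_real c * (complex_of_real (1 / sqrt (2 * pi)) * (\<integral>x. ?f x \<partial>lborel))"
      using I I2 c unfolding eq by (simp only: integral_mult_right_zero scaleR_conv_of_real abs_of_pos)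
    then show ?thesis by simp
  qed
  moreover have "c / sqrt (2 * pi) = sqrt t" by (simp add: c_def real_sqrt_mult)
  moreover have "u\<^sup>2 / 2 = pi * \<eta>\<^sup>2 / t" using t c by (simp add: u_def power_divide power_mult_distrib power2_eq_square field_simps)
  ultimately have "complex_of_real (sqrt t) * (\<integral>x. ?f x \<partial>lborel) = complex_of_real (exp (- pi * \<eta>\<^sup>2 / t))"
    by simp
  then have "(\<integral>x. ?f x \<partial>lborel) = complex_of_real (exp (- pi * \<eta>\<^sup>2 / t)) / complex_of_real (sqrt t)"
    using t by (simp add: field_simps)
  moreover have "t powr (-1/2) = 1 / sqrt t" using t by (simp add: powr_minus powr_half_sqrt field_simps)
  ultimately show "(\<integral>x. ?f x \<partial>lborel) = complex_of_real (t powr (-1/2) * exp (- pi * \<eta>\<^sup>2 / t))"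
    by simp
qed

lemma norm_sq_Basis: "(norm (x::'a::euclidean_space))\<^sup>2 = (\<Sum>b\<in>Basis. (x \<bullet> b)\<^sup>2)"
  unfolding power2_norm_eq_inner by (subst euclidean_inner) (simp add: power2_eq_square)

lemma
  fixes \<xi> :: "'a::euclidean_space"
  assumes t: "t > 0"
  shows integrable_ek_gauss: "integrable lborel (\<lambda>x::'a. ek x \<xi> * complex_of_real (gauss t x))"
    and integral_ek_gauss: "(\<integral>(x::'a). ek x \<xi> * complex_of_real (gauss t x) \<partial>lborel)
       = complex_of_real (t powr (- real DIM('a) / 2) * gauss (1/t) \<xi>)"
proof -
  let ?f = "\<lambda>b x. exp (- (2 * pi * \<i>) * complex_of_real (x * (\<xi> \<bullet> b))) * complex_of_real (exp (- pi * t * x\<^sup>2))"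
  have eq: "ek x \<xi> * complex_of_real (gauss t x) = (\<Prod>b\<in>Basis. ?f b (x \<bullet> b))" for x
  proof -
    have "ek x \<xi> = (\<Prod>b\<in>Basis. exp (- (2 * pi * \<i>) * complex_of_real ((x \<bullet> b) * (\<xi> \<bullet> b))))"
      unfolding ek_def euclidean_inner[of x \<xi>] by (simp add: sum_distrib_left exp_sum[symmetric] sum_negf)
    moreover have "gauss t x = (\<Prod>b\<in>Basis. exp (- pi * t * (x \<bullet> b)\<^sup>2))"
      unfolding gauss_def norm_sq_Basis by (simp add: sum_distrib_left exp_sum[symmetric] sum_negf)
    ultimately show ?thesis by (simp add: prod.distrib)
  qed
  show "integrable lborel (\<lambda>x::'a. ek x \<xi> * complex_of_real (gauss t x))"
    unfolding eq by (rule integrable_lborel_Basis_prod) (rule integrable_gauss_real[OF t])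
  have "(\<integral>(x::'a). ek x \<xi> * complex_of_real (gauss t x) \<partial>lborel)
      = (\<Prod>b\<in>Basis. complex_of_real (t powr (-1/2) * exp (- pi * (\<xi> \<bullet> b)\<^sup>2 / t)))"
    unfolding eq by (subst integral_lborel_Basis_prod) (auto simp only: integrable_gauss_real[OF t] integral_gauss_real[OF t])
  also have "\<dots> = complex_of_real ((t powr (-1/2)) ^ DIM('a) * exp (\<Sum>b\<in>Basis. - pi * (\<xi> \<bullet> b)\<^sup>2 / t))"
    by (simp add: prod.distrib exp_sum)
  also have "(\<Sum>b\<in>Basis. - pi * (\<xi> \<bullet> b)\<^sup>2 / t) = - pi * (1/t) * (norm \<xi>)\<^sup>2"
    unfolding norm_sq_Basis by (simp add: sum_distrib_left sum_negf sum_divide_distrib)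
  also have "(t powr (-1/2)) ^ DIM('a) = t powr (- real DIM('a) / 2)"
    using t by (simp add: powr_power)
  finally show "(\<integral>(x::'a). ek x \<xi> * complex_of_real (gauss t x) \<partial>lborel)
       = complex_of_real (t powr (- real DIM('a) / 2) * gauss (1/t) \<xi>)"
    by (simp add: gauss_def)
qed

lemma integrable_gauss: "t > 0 \<Longrightarrow> integrable lborel (gauss t :: 'a::euclidean_space \<Rightarrow> real)"
  using integrable_ek_gauss[of t "0::'a"]
  by (simp add: ek_def complex_of_real_integrable_eq)

lemma integral_gauss: 
  assumes "t > 0" 
  shows "(\<integral>x. gauss t x \<partial>(lborel :: 'a::euclidean_space measure)) = t powr (- real DIM('a) / 2)"
proof -
  have "complex_of_real (\<integral>(x::'a). gauss t x \<partial>lborel) = (\<integral>(x::'a). ek x 0 * complex_of_real (gauss t x) \<partial>lborel)"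
    by (simp add: ek_def)
  also have "\<dots> = complex_of_real (t powr (- real DIM('a) / 2))"
    by (subst integral_ek_gauss[OF assms]) (simp add: gauss_def)
  finally show ?thesis by (simp only: of_real_eq_iff)
qed

lemma fourier_L1_alt: "fourier_L1 \<psi> \<xi> = (\<integral>x. ek x \<xi> * \<psi> x \<partial>lborel)"
  by (simp add: fourier_L1_def ek_def)

lemma fourier_L1_measurable [measurable]:
  assumes [measurable]: "\<psi> \<in> borel_measurable borel"
  shows "fourier_L1 \<psi> \<in> borel_measurable borel"
  unfolding fourier_L1_alt[abs_def] by measurable

lemma integrable_ek_mult:
  "integrable lborel \<psi> \<Longrightarrow> integrable lborel (\<lambda>x. ek x \<xi> * \<psi> x)"
  by (rule Bochner_Integration.integrable_bound[of _ \<psi>]) (auto simp: norm_mult dest: borel_measurable_integrable)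

lemma norm_fourier_L1_le: "norm (fourier_L1 \<psi> \<xi>) \<le> (\<integral>x. norm (\<psi> x) \<partial>lborel)"
  unfolding fourier_L1_alt
  using integral_norm_bound[of lborel "\<lambda>x. ek x \<xi> * \<psi> x"] by (simp add: norm_mult)

lemma Fubini_lborel:
  fixes f :: "'a::euclidean_space \<Rightarrow> 'a \<Rightarrow> complex"
  assumes [measurable]: "case_prod f \<in> borel_measurable (borel \<Otimes>\<^sub>M borel)"
    and fin: "(\<integral>\<^sup>+x. (\<integral>\<^sup>+y. ennreal (norm (f x y)) \<partial>lborel) \<partial>lborel) < \<infinity>"
  shows "(\<integral>x. (\<integral>y. f x y \<partial>lborel) \<partial>lborel) = (\<integral>y. (\<integral>x. f x y \<partial>lborel) \<partial>lborel)"
proof -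
  have "(\<integral>\<^sup>+p. ennreal (norm (case_prod f p)) \<partial>(lborel \<Otimes>\<^sub>M lborel)) = (\<integral>\<^sup>+x. (\<integral>\<^sup>+y. ennreal (norm (f x y)) \<partial>lborel) \<partial>lborel)"
    by (subst lborel.nn_integral_fst[symmetric]) auto
  then have "integrable (lborel \<Otimes>\<^sub>M lborel) (case_prod f)"
    using fin by (intro integrableI_bounded) auto
  from lborel_pair.Fubini_integral[OF this] show ?thesis by simp
qed

lemma nn_integral_norm_less_top:
  fixes f :: "'a::euclidean_space \<Rightarrow> 'b::{banach,second_countable_topology}"
  shows "integrable lborel f \<Longrightarrow> (\<integral>\<^sup>+x. ennreal (norm (f x)) \<partial>lborel) < \<infinity>"
  by (simp add: integrable_iff_bounded)

text \<open>Fubini and the symmetry of the kernel. It also shows that the weak definition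
  \<open>is_fourier\<close> is consistent with the integral transform.\<close>

lemma fourier_L1_mult_formula:
  assumes f: "integrable lborel f" and g: "integrable lborel g"
  shows "(\<integral>\<xi>. fourier_L1 f \<xi> * g \<xi> \<partial>lborel) = (\<integral>x. f x * fourier_L1 g x \<partial>lborel)"
proof -
  have [measurable]: "f \<in> borel_measurable borel" "g \<in> borel_measurable borel"
    using f g by (auto dest: borel_measurable_integrable)
  have "(\<integral>\<xi>. fourier_L1 f \<xi> * g \<xi> \<partial>lborel) = (\<integral>\<xi>. (\<integral>x. ek x \<xi> * f x * g \<xi> \<partial>lborel) \<partial>lborel)"
    unfolding fourier_L1_alt by (simp add: integral_mult_left_zero)
  also have "\<dots> = (\<integral>x. (\<integral>\<xi>. ek x \<xi> * f x * g \<xi> \<partial>lborel) \<partial>lborel)"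
  proof (rule Fubini_lborel)
    have "(\<integral>\<^sup>+\<xi>. (\<integral>\<^sup>+x. ennreal (norm (ek x \<xi> * f x * g \<xi>)) \<partial>lborel) \<partial>lborel)
        = (\<integral>\<^sup>+\<xi>. (\<integral>\<^sup>+x. ennreal (norm (f x)) \<partial>lborel) * ennreal (norm (g \<xi>)) \<partial>lborel)"
      by (simp add: norm_mult ennreal_mult nn_integral_multc)
    also have "\<dots> < \<infinity>"
      using f g by (simp add: nn_integral_cmult ennreal_mult_less_top integrable_iff_bounded)
    finally show "(\<integral>\<^sup>+\<xi>. (\<integral>\<^sup>+x. ennreal (norm (ek x \<xi> * f x * g \<xi>)) \<partial>lborel) \<partial>lborel) < \<infinity>" .
  qed measurable
  also have "\<dots> = (\<integral>x. (\<integral>\<xi>. f x * (ek \<xi> x * g \<xi>) \<partial>lborel) \<partial>lborel)"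
    by (simp add: ek_commute mult_ac)
  also have "\<dots> = (\<integral>x. f x * fourier_L1 g x \<partial>lborel)"
    unfolding fourier_L1_alt by (simp add: integral_mult_right_zero)
  finally show ?thesis .
qed

text \<open>The Gaussian makes the double integral absolutely convergent, and its own transform
  appears as a Gaussian of width \<open>sqrt t\<close>, an approximate identity as \<open>t\<close>
  tends to 0.\<close>

lemma fourier_L1_weighted_conj:
  fixes f :: "real^'d \<Rightarrow> complex"
  assumes f: "integrable lborel f" and t: "t > 0"
  shows "fourier_L1 (\<lambda>\<xi>. cnj (fourier_L1 f \<xi>) * complex_of_real (gauss t \<xi>)) x
    = (\<integral>z. cnj (f (x + z)) * complex_of_real (t powr (- real CARD('d) / 2) * gauss (1/t) z) \<partial>lborel)"
proof -
  have [measurable]: "f \<in> borel_measurable borel" using f by (auto dest: borel_measurable_integrable)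
  have "fourier_L1 (\<lambda>\<xi>. cnj (fourier_L1 f \<xi>) * complex_of_real (gauss t \<xi>)) x
      = (\<integral>\<xi>. (\<integral>y. ek \<xi> x * complex_of_real (gauss t \<xi>) * cnj (ek y \<xi> * f y) \<partial>lborel) \<partial>lborel)"
    unfolding fourier_L1_alt
    by (simp only: integral_mult_right_zero Bochner_Integration.integral_cnj) (simp only: mult_ac)
  also have "\<dots> = (\<integral>y. (\<integral>\<xi>. ek \<xi> x * complex_of_real (gauss t \<xi>) * cnj (ek y \<xi> * f y) \<partial>lborel) \<partial>lborel)"
  proof (rule Fubini_lborel)
    have "(\<integral>\<^sup>+\<xi>. (\<integral>\<^sup>+y. ennreal (norm (ek \<xi> x * complex_of_real (gauss t \<xi>) * cnj (ek y \<xi> * f y))) \<partial>lborel) \<partial>lborel)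
        = (\<integral>\<^sup>+\<xi>. ennreal (norm (gauss t \<xi>)) * (\<integral>\<^sup>+y. ennreal (norm (f y)) \<partial>lborel) \<partial>(lborel :: (real^'d) measure))"
      by (simp add: norm_mult ennreal_mult nn_integral_cmult)
    also have "\<dots> < \<infinity>"
      using nn_integral_norm_less_top[OF f] nn_integral_norm_less_top[OF integrable_gauss[OF t, where 'a="real^'d"]]
      by (simp add: nn_integral_multc ennreal_mult_less_top)
    finally show "(\<integral>\<^sup>+\<xi>. (\<integral>\<^sup>+y. ennreal (norm (ek \<xi> x * complex_of_real (gauss t \<xi>) * cnj (ek y \<xi> * f y))) \<partial>lborel) \<partial>lborel) < \<infinity>" .
  qed measurable
  also have "\<dots> = (\<integral>y. cnj (f y) * complex_of_real (t powr (- real CARD('d) / 2) * gauss (1/t) (x - y)) \<partial>lborel)"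
  proof (rule Bochner_Integration.integral_cong[OF refl])
    fix y
    have "ek \<xi> x * complex_of_real (gauss t \<xi>) * cnj (ek y \<xi> * f y) = cnj (f y) * (ek \<xi> (x - y) * complex_of_real (gauss t \<xi>))" for \<xi>
      using ek_add_left[of x "- y" \<xi>] by (simp add: cnj_ek ek_commute[of \<xi>] mult_ac)
    then have "(\<integral>\<xi>. ek \<xi> x * complex_of_real (gauss t \<xi>) * cnj (ek y \<xi> * f y) \<partial>lborel)
        = cnj (f y) * (\<integral>\<xi>. ek \<xi> (x - y) * complex_of_real (gauss t \<xi>) \<partial>lborel)"
      by (simp only: integral_mult_right_zero)
    then show "(\<integral>\<xi>. ek \<xi> x * complex_of_real (gauss t \<xi>) * cnj (ek y \<xi> * f y) \<partial>lborel)
        = cnj (f y) * complex_of_real (t powr (- real CARD('d) / 2) * gauss (1/t) (x - y))"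
      by (simp only: integral_ek_gauss[OF t]) simp
  qed
  also have "\<dots> = (\<integral>z. cnj (f (z + x)) * complex_of_real (t powr (- real CARD('d) / 2) * gauss (1/t) (x - (z + x))) \<partial>lborel)"
    by (rule lborel_preserving.integral[OF lborel_preserving_translate, symmetric]) measurable
  finally show ?thesis by (simp add: gauss_minus add.commute)
qed

text \<open>Multiplication formula with the test function \<open>?\<psi>\<close>, the damped
  conjugate of the transform itself. The right side is a Gaussian average of the autocorrelation of
  \<open>f\<close>, whose value at shift 0 is the squared norm.\<close>

lemma Plancherel_gauss:
  fixes f :: "real^'d \<Rightarrow> complex"
  assumes f: "integrable lborel f" and t: "t > 0"
  shows "complex_of_real (\<integral>\<xi>. (norm (fourier_L1 f \<xi>))\<^sup>2 * gauss t \<xi> \<partial>lborel)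
    = (\<integral>w. complex_of_real (gauss 1 w) * (\<integral>x. f x * cnj (f (x + sqrt t *\<^sub>R w)) \<partial>lborel) \<partial>lborel)"
proof -
  have [measurable]: "f \<in> borel_measurable borel" using f by (auto dest: borel_measurable_integrable)
  define k where "k z = t powr (- real CARD('d) / 2) * gauss (1/t) z" for z :: "real^'d"
  have [measurable]: "k \<in> borel_measurable borel" unfolding k_def by measurable
  have k: "k z \<ge> 0" "k z \<le> t powr (- real CARD('d) / 2)" for z
    using t gauss_le_1[of "1/t" z] gauss_pos[of "1/t" z] by (auto simp: k_def mult_left_le less_imp_le)
  let ?\<psi> = "\<lambda>\<xi>. cnj (fourier_L1 f \<xi>) * complex_of_real (gauss t \<xi>)"
  have \<psi>: "integrable lborel ?\<psi>"
  proof (rule Bochner_Integration.integrable_bound)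
    show "integrable lborel (\<lambda>\<xi>::real^'d. (\<integral>x. norm (f x) \<partial>lborel) * gauss t \<xi>)"
      by (intro integrable_mult_right integrable_gauss t)
    show "AE \<xi> in lborel. norm (?\<psi> \<xi>) \<le> norm ((\<integral>x. norm (f x) \<partial>lborel) * gauss t \<xi>)"
      using norm_fourier_L1_le[of f] gauss_pos[of t]
      by (auto simp: norm_mult abs_mult intro!: mult_right_mono order_trans[OF norm_fourier_L1_le] AE_I2)
  qed measurable
  have "complex_of_real (\<integral>\<xi>. (norm (fourier_L1 f \<xi>))\<^sup>2 * gauss t \<xi> \<partial>lborel) = (\<integral>\<xi>. fourier_L1 f \<xi> * ?\<psi> \<xi> \<partial>lborel)"
    by (subst integral_complex_of_real[symmetric])
       (simp add: complex_norm_square mult_ac del: of_real_power)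
  also have "\<dots> = (\<integral>x. f x * fourier_L1 ?\<psi> x \<partial>lborel)"
    by (rule fourier_L1_mult_formula[OF f \<psi>])
  also have "\<dots> = (\<integral>x. (\<integral>z. f x * (cnj (f (x + z)) * complex_of_real (k z)) \<partial>lborel) \<partial>lborel)"
    unfolding fourier_L1_weighted_conj[OF f t] k_def[symmetric] by (simp only: integral_mult_right_zero)
  also have "\<dots> = (\<integral>z. (\<integral>x. f x * (cnj (f (x + z)) * complex_of_real (k z)) \<partial>lborel) \<partial>lborel)"
  proof (rule Fubini_lborel)
    have tr: "(\<integral>\<^sup>+z. ennreal (norm (f (x + z))) \<partial>lborel) = (\<integral>\<^sup>+z. ennreal (norm (f z)) \<partial>lborel)" for x
      using lborel_preserving.nn_integral[OF lborel_preserving_translate, of "\<lambda>z. ennreal (norm (f z))" x]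
      by (simp add: add.commute)
    have "(\<integral>\<^sup>+x. (\<integral>\<^sup>+z. ennreal (norm (f x * (cnj (f (x + z)) * complex_of_real (k z)))) \<partial>lborel) \<partial>lborel)
        \<le> (\<integral>\<^sup>+x. (\<integral>\<^sup>+z. ennreal (norm (f x)) * (ennreal (t powr (- real CARD('d) / 2)) * ennreal (norm (f (x + z)))) \<partial>lborel) \<partial>lborel)"
      using k by (intro nn_integral_mono) (auto simp: norm_mult ennreal_mult[symmetric] mult.commute[of _ "k _"] intro!: ennreal_leI mult_left_mono mult_right_mono)
    also have "\<dots> = (\<integral>\<^sup>+x. ennreal (norm (f x)) * (ennreal (t powr (- real CARD('d) / 2)) * (\<integral>\<^sup>+z. ennreal (norm (f z)) \<partial>lborel)) \<partial>lborel)"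
      by (simp add: nn_integral_cmult tr)
    also have "\<dots> < \<infinity>"
      using nn_integral_norm_less_top[OF f] by (simp add: nn_integral_multc ennreal_mult_less_top)
    finally show "(\<integral>\<^sup>+x. (\<integral>\<^sup>+z. ennreal (norm (f x * (cnj (f (x + z)) * complex_of_real (k z)))) \<partial>lborel) \<partial>lborel) < \<infinity>" .
  qed measurable
  also have "\<dots> = (\<integral>z. complex_of_real (k z) * (\<integral>x. f x * cnj (f (x + z)) \<partial>lborel) \<partial>lborel)"
    by (subst integral_mult_right_zero[symmetric]) (simp add: mult_ac)
  \<comment> \<open>Substituting \<open>z = sqrt t *\<^sub>R w\<close> moves \<open>t\<close> from
    the kernel into the shift, so that the later limit has a fixed integrable majorant.\<close>
  also have "\<dots> = t powr (real CARD('d) / 2) *\<^sub>R (\<integral>w. complex_of_real (k (sqrt t *\<^sub>R w)) * (\<integral>x. f x * cnj (f (x + sqrt t *\<^sub>R w)) \<partial>lborel) \<partial>lborel)"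
  proof -
    have "(\<integral>w. complex_of_real (k (sqrt t *\<^sub>R w)) * (\<integral>x. f x * cnj (f (x + sqrt t *\<^sub>R w)) \<partial>lborel) \<partial>lborel)
        = (sqrt t powr - real DIM(real^'d)) *\<^sub>R (\<integral>z. complex_of_real (k z) * (\<integral>x. f x * cnj (f (x + z)) \<partial>lborel) \<partial>lborel)"
      using t by (intro integral_lborel_scale) auto
    moreover have "sqrt t powr - real DIM(real^'d) = t powr (- real CARD('d) / 2)"
      using t by (simp add: powr_half_sqrt[symmetric] powr_powr)
    ultimately show ?thesis using t by (simp add: powr_add[symmetric])
  qed
  also have "\<dots> = (\<integral>w. complex_of_real (t powr (real CARD('d) / 2)) * (complex_of_real (k (sqrt t *\<^sub>R w)) * (\<integral>x. f x * cnj (f (x + sqrt t *\<^sub>R w)) \<partial>lborel)) \<partial>lborel)"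
    by (simp only: scaleR_conv_of_real integral_mult_right_zero)
  also have "\<dots> = (\<integral>w. complex_of_real (gauss 1 w) * (\<integral>x. f x * cnj (f (x + sqrt t *\<^sub>R w)) \<partial>lborel) \<partial>lborel)"
  proof -
    have "t powr (real CARD('d) / 2) * k (sqrt t *\<^sub>R w) = gauss 1 w" for w
      using t by (simp add: k_def gauss_def power_mult_distrib powr_minus)
    then have "complex_of_real (t powr (real CARD('d) / 2)) * complex_of_real (k (sqrt t *\<^sub>R w)) = complex_of_real (gauss 1 w)" for w
      by (metis of_real_mult)
    then show ?thesis by (simp only: mult.assoc[symmetric])
  qed
  finally show ?thesis .
qed

lemma L2sq_cnj: "L2sq (\<lambda>x. cnj (f x)) = L2sq f" by (simp add: L2sq_def)

text \<open>Gaussian regularisation: as \<open>t\<close> tends to 0 the left side of the previous identity increases to the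
  norm of the transform, while continuity of translations identifies the limit of the right side.\<close>
theorem Plancherel_L1_L2:
  fixes f :: "real^'d \<Rightarrow> complex"
  assumes f: "integrable lborel f" and fin: "L2sq f < top"
  shows "L2sq (fourier_L1 f) = L2sq f"
proof -
  have [measurable]: "f \<in> borel_measurable borel" using f by (auto dest: borel_measurable_integrable)
  define A where "A z = (\<integral>x. f x * cnj (f (x + z)) \<partial>lborel)" for z
  have [measurable]: "A \<in> borel_measurable borel" unfolding A_def by measurable
  have L2z: "L2sq (\<lambda>x. cnj (f (x + z))) = L2sq f" for z
    using lborel_preserving.L2sq[OF lborel_preserving_translate, of f z] by (simp add: L2sq_cnj)
  obtain a where a: "L2sq f = ennreal a" "a \<ge> 0" using fin by (cases "L2sq f") auto
  have Abound: "norm (A z) \<le> a" for z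
  proof -
    have "ennreal ((norm (A z))\<^sup>2) \<le> L2sq f * L2sq (\<lambda>x. cnj (f (x + z)))"
      unfolding A_def by (rule Cauchy_Schwarz_complex) measurable
    then have "(norm (A z))\<^sup>2 \<le> a\<^sup>2"
      using a unfolding L2z by (simp add: ennreal_mult[symmetric] power2_eq_square)
    then show ?thesis using a(2) by (rule power2_le_imp_le)
  qed
  have A0: "A 0 = complex_of_real a"
  proof -
    have "A 0 = (\<integral>x. complex_of_real ((norm (f x))\<^sup>2) \<partial>lborel)"
      unfolding A_def by (simp add: complex_norm_square[symmetric])
    also have "\<dots> = complex_of_real (\<integral>x. (norm (f x))\<^sup>2 \<partial>lborel)"
      by (rule integral_complex_of_real)
    also have "(\<integral>x. (norm (f x))\<^sup>2 \<partial>lborel) = a"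
      using a by (subst integral_eq_nn_integral) (auto simp: L2sq_def)
    finally show ?thesis .
  qed
  have Alim: "(\<lambda>n. A (z n)) \<longlonglongrightarrow> A 0" if z: "z \<longlonglongrightarrow> 0" for z
  proof -
    have "(\<lambda>n. \<integral>x. cnj (f (x + z n)) * f x \<partial>lborel) \<longlonglongrightarrow> (\<integral>x. cnj (f x) * f x \<partial>lborel)"
    proof (rule tendsto_integral_mult_L2)
      show "(\<lambda>n. L2sq (\<lambda>x. cnj (f (x + z n)) - cnj (f x))) \<longlonglongrightarrow> 0"
      proof (rule tendsto_zero_ennreal)
        fix e :: real assume e: "0 < e"
        obtain d where d: "d > 0" "\<And>z. norm z < d \<Longrightarrow> L2sq (\<lambda>x. f (x + z) - f x) \<le> ennreal (e/2)"
          using translation_continuous_L2[of f "e/2"] fin e by auto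
        have "\<forall>\<^sub>F n in sequentially. norm (z n) < d"
          using z d(1) by (auto dest!: tendstoD simp: dist_norm)
        then show "\<forall>\<^sub>F n in sequentially. L2sq (\<lambda>x. cnj (f (x + z n)) - cnj (f x)) < ennreal e"
        proof eventually_elim
          case (elim n)
          have "L2sq (\<lambda>x. cnj (f (x + z n)) - cnj (f x)) = L2sq (\<lambda>x. f (x + z n) - f x)"
            using L2sq_cnj[of "\<lambda>x. f (x + z n) - f x"] by simp
          also have "\<dots> \<le> ennreal (e/2)" by (rule d(2)[OF elim])
          also have "\<dots> < ennreal e" using e by (simp add: ennreal_less_iff)
          finally show ?case .
        qed
      qed
    qed (use fin in \<open>auto simp: L2z L2sq_cnj\<close>)
    then show ?thesis by (simp add: A_def mult.commute)
  qed
  \<comment> \<open>Squares, so that \<open>sqrt (t n)\<close> is \<open>1 / (n + 1)\<close>; the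
    sequence decreases, as monotone convergence on the frequency side requires.\<close>
  define t where "t n = (1 / real (Suc n))\<^sup>2" for n
  have t: "t n > 0" "sqrt (t n) = 1 / real (Suc n)" for n by (auto simp: t_def)
  define J where "J n = (\<integral>\<xi>. (norm (fourier_L1 f \<xi>))\<^sup>2 * gauss (t n) \<xi> \<partial>lborel)" for n
  have "(\<lambda>n. \<integral>w. complex_of_real (gauss 1 w) * A (sqrt (t n) *\<^sub>R w) \<partial>lborel) \<longlonglongrightarrow> (\<integral>w. complex_of_real (gauss 1 w) * A 0 \<partial>(lborel :: (real^'d) measure))"
  proof (rule integral_dominated_convergence[where w="\<lambda>w::real^'d. a * gauss 1 w"])
    show "integrable lborel (\<lambda>w::real^'d. a * gauss 1 w)" by (intro integrable_mult_right integrable_gauss) simp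
    show "AE w in lborel. (\<lambda>n. complex_of_real (gauss 1 w) * A (sqrt (t n) *\<^sub>R w)) \<longlonglongrightarrow> complex_of_real (gauss 1 w) * A 0"
    proof (intro AE_I2 tendsto_mult tendsto_const Alim)
      fix w :: "real^'d"
      have "(\<lambda>n. (1 / real (Suc n)) *\<^sub>R w) \<longlonglongrightarrow> 0 *\<^sub>R w"
        by (intro tendsto_scaleR tendsto_const) (rule LIMSEQ_Suc[OF lim_1_over_n])
      then show "(\<lambda>n. sqrt (t n) *\<^sub>R w) \<longlonglongrightarrow> 0" by (simp add: t)
    qed
    show "AE w in lborel. norm (complex_of_real (gauss 1 w) * A (sqrt (t n) *\<^sub>R w)) \<le> a * gauss 1 w" for n
      using Abound by (auto simp: norm_mult abs_of_pos[OF gauss_pos] mult.commute[of a] intro!: mult_left_mono less_imp_le[OF gauss_pos] AE_I2)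
  qed measurable
  moreover have "(\<integral>w. complex_of_real (gauss 1 w) * A 0 \<partial>(lborel :: (real^'d) measure)) = complex_of_real a"
    using integral_gauss[of 1, where 'a="real^'d"] by (simp add: A0 integral_mult_left_zero)
  ultimately have "(\<lambda>n. complex_of_real (J n)) \<longlonglongrightarrow> complex_of_real a"
    using Plancherel_gauss[OF f t(1)] by (simp add: J_def A_def)
  then have J: "J \<longlonglongrightarrow> a" by (simp add: tendsto_of_real_iff)
  let ?h = "\<lambda>n \<xi>. ennreal ((norm (fourier_L1 f \<xi>))\<^sup>2 * gauss (t n) \<xi>)"
  have JN: "ennreal (J n) = (\<integral>\<^sup>+\<xi>. ?h n \<xi> \<partial>lborel)" for n
  proof -
    have "integrable lborel (\<lambda>\<xi>. (norm (fourier_L1 f \<xi>))\<^sup>2 * gauss (t n) \<xi>)"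
    proof (rule Bochner_Integration.integrable_bound)
      show "integrable lborel (\<lambda>\<xi>::real^'d. (\<integral>x. norm (f x) \<partial>lborel)\<^sup>2 * gauss (t n) \<xi>)"
        by (intro integrable_mult_right integrable_gauss t)
      show "AE \<xi> in lborel. norm ((norm (fourier_L1 f \<xi>))\<^sup>2 * gauss (t n) \<xi>) \<le> norm ((\<integral>x. norm (f x) \<partial>lborel)\<^sup>2 * gauss (t n) \<xi>)"
        using norm_fourier_L1_le[of f] gauss_pos[of "t n"]
        by (auto simp: abs_mult less_imp_le intro!: mult_right_mono power_mono AE_I2)
    qed measurable
    then show ?thesis unfolding J_def
      by (intro nn_integral_eq_integral[symmetric]) (auto intro!: AE_I2 mult_nonneg_nonneg less_imp_le[OF gauss_pos])
  qed
  \<comment> \<open>Monotone rather than dominated convergence: square integrability of the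
    transform is not known yet and is part of what is proved.\<close>
  have "(\<lambda>n. \<integral>\<^sup>+\<xi>. ?h n \<xi> \<partial>lborel) \<longlonglongrightarrow> (\<integral>\<^sup>+\<xi>. (SUP n. ?h n \<xi>) \<partial>lborel)"
  proof -
    have inc: "incseq ?h"
    proof (intro incseq_SucI le_funI ennreal_leI mult_left_mono)
      fix n \<xi>
      have "t (Suc n) \<le> t n" unfolding t_def by (intro power_mono) (auto simp: field_simps)
      then show "gauss (t n) \<xi> \<le> gauss (t (Suc n)) (\<xi> :: real^'d)"
        by (auto simp: gauss_def intro!: mult_right_mono)
    qed simp
    have "(\<integral>\<^sup>+\<xi>. (SUP n. ?h n \<xi>) \<partial>lborel) = (SUP n. \<integral>\<^sup>+\<xi>. ?h n \<xi> \<partial>lborel)"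
      by (rule nn_integral_monotone_convergence_SUP[OF inc]) measurable
    moreover have "(\<lambda>n. \<integral>\<^sup>+\<xi>. ?h n \<xi> \<partial>lborel) \<longlonglongrightarrow> (SUP n. \<integral>\<^sup>+\<xi>. ?h n \<xi> \<partial>lborel)"
      by (rule LIMSEQ_SUP) (use inc in \<open>auto simp: incseq_def le_fun_def intro!: nn_integral_mono\<close>)
    ultimately show ?thesis by simp
  qed
  moreover have "(SUP n. ?h n \<xi>) = ennreal ((norm (fourier_L1 f \<xi>))\<^sup>2)" for \<xi>
  proof (rule LIMSEQ_unique[of "\<lambda>n. ?h n \<xi>"])
    show "(\<lambda>n. ?h n \<xi>) \<longlonglongrightarrow> (SUP n. ?h n \<xi>)"
    proof (rule LIMSEQ_SUP, intro incseq_SucI ennreal_leI mult_left_mono)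
      fix n
      have "t (Suc n) \<le> t n" unfolding t_def by (intro power_mono) (auto simp: field_simps)
      then show "gauss (t n) \<xi> \<le> gauss (t (Suc n)) (\<xi> :: real^'d)"
        by (auto simp: gauss_def intro!: mult_right_mono)
    qed simp
    have "(\<lambda>n. (1 / real (Suc n))\<^sup>2) \<longlonglongrightarrow> 0\<^sup>2"
      by (intro tendsto_power) (rule LIMSEQ_Suc[OF lim_1_over_n])
    then have t0: "t \<longlonglongrightarrow> 0" by (simp add: t_def[abs_def])
    have "(\<lambda>n. exp (- pi * t n * (norm \<xi>)\<^sup>2)) \<longlonglongrightarrow> exp (- pi * 0 * (norm \<xi>)\<^sup>2)"
      by (intro tendsto_exp tendsto_mult t0 tendsto_const)
    then have "(\<lambda>n. (norm (fourier_L1 f \<xi>))\<^sup>2 * gauss (t n) \<xi>) \<longlonglongrightarrow> (norm (fourier_L1 f \<xi>))\<^sup>2 * 1"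
      by (intro tendsto_mult tendsto_const) (simp add: gauss_def)
    then show "(\<lambda>n. ?h n \<xi>) \<longlonglongrightarrow> ennreal ((norm (fourier_L1 f \<xi>))\<^sup>2)"
      by (intro tendsto_ennrealI) simp
  qed
  ultimately have "(\<lambda>n. ennreal (J n)) \<longlonglongrightarrow> L2sq (fourier_L1 f)"
    by (simp add: JN L2sq_def)
  moreover have "(\<lambda>n. ennreal (J n)) \<longlonglongrightarrow> ennreal a" by (intro tendsto_ennrealI J)
  ultimately show ?thesis using a by (simp add: LIMSEQ_unique)
qed

section \<open>The Fourier transform on square integrable functions\<close>

lemma is_fourier_iff: "is_fourier f F \<longleftrightarrow>
    f \<in> borel_measurable borel \<and> L2sq f < top \<and> F \<in> borel_measurable borel \<and> L2sq F < top \<and>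
    (\<forall>\<psi>. integrable lborel \<psi> \<and> L2sq \<psi> < top \<longrightarrow>
       (\<integral>\<xi>. F \<xi> * \<psi> \<xi> \<partial>lborel) = (\<integral>x. f x * fourier_L1 \<psi> x \<partial>lborel))"
  unfolding is_fourier_def sq_int_iff by (auto dest: borel_measurable_integrable)

lemma is_fourierD:
  assumes "is_fourier f F"
  shows "f \<in> borel_measurable borel" "F \<in> borel_measurable borel" "L2sq f < top" "L2sq F < top"
  using assms by (auto simp: is_fourier_iff)

lemma is_fourier_formula:
  "is_fourier f F \<Longrightarrow> integrable lborel \<psi> \<Longrightarrow> L2sq \<psi> < top \<Longrightarrow>
    (\<integral>\<xi>. F \<xi> * \<psi> \<xi> \<partial>lborel) = (\<integral>x. f x * fourier_L1 \<psi> x \<partial>lborel)"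
  by (auto simp: is_fourier_iff)

lemma is_fourier_cong_AE:
  assumes "is_fourier f F" and [measurable]: "f' \<in> borel_measurable borel" "F' \<in> borel_measurable borel"
    and f: "AE x in lborel. f x = f' x" and F: "AE x in lborel. F x = F' x"
  shows "is_fourier f' F'"
proof -
  note [measurable] = is_fourierD(1,2)[OF assms(1)]
  have "(\<integral>\<xi>. F' \<xi> * \<psi> \<xi> \<partial>lborel) = (\<integral>x. f' x * fourier_L1 \<psi> x \<partial>lborel)"
    if \<psi>: "integrable lborel \<psi>" "L2sq \<psi> < top" for \<psi>
  proof -
    have [measurable]: "\<psi> \<in> borel_measurable borel" using \<psi> by (auto dest: borel_measurable_integrable)
    have "(\<integral>\<xi>. F' \<xi> * \<psi> \<xi> \<partial>lborel) = (\<integral>\<xi>. F \<xi> * \<psi> \<xi> \<partial>lborel)"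
      by (rule integral_cong_AE) (use F in \<open>auto elim: eventually_mono\<close>)
    also have "\<dots> = (\<integral>x. f x * fourier_L1 \<psi> x \<partial>lborel)" by (rule is_fourier_formula[OF assms(1) \<psi>])
    also have "\<dots> = (\<integral>x. f' x * fourier_L1 \<psi> x \<partial>lborel)"
      by (rule integral_cong_AE) (use f in \<open>auto elim: eventually_mono\<close>)
    finally show ?thesis .
  qed
  then show ?thesis
    unfolding is_fourier_iff using is_fourierD[OF assms(1)] L2sq_cong_AE[OF f] L2sq_cong_AE[OF F] by simp
qed

lemma L2sq_add_fin:
  fixes f g :: "'a::euclidean_space \<Rightarrow> 'b::{real_normed_vector,second_countable_topology}"
  assumes "f \<in> borel_measurable borel" "g \<in> borel_measurable borel" "L2sq f < top" "L2sq g < top"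
  shows "L2sq (\<lambda>x. f x + g x) < top"
  using L2sq_add_le2[OF assms(1,2)] assms(3,4) by (auto simp: ennreal_mult_less_top intro: le_less_trans)

lemma L2sq_diff_fin:
  fixes f g :: "'a::euclidean_space \<Rightarrow> 'b::{real_normed_vector,second_countable_topology}"
  assumes "f \<in> borel_measurable borel" "g \<in> borel_measurable borel" "L2sq f < top" "L2sq g < top"
  shows "L2sq (\<lambda>x. f x - g x) < top"
  using L2sq_diff_le[OF assms(1,2)] assms(3,4) by (auto simp: ennreal_mult_less_top intro: le_less_trans)

lemma fourier_L1_L2:
  "integrable lborel \<psi> \<Longrightarrow> L2sq \<psi> < top \<Longrightarrow> L2sq (fourier_L1 \<psi>) < top"
  by (simp add: Plancherel_L1_L2)

lemma is_fourier_fourier_L1: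
  assumes f: "integrable lborel f" "L2sq f < top"
  shows "is_fourier f (fourier_L1 f)"
proof -
  have [measurable]: "f \<in> borel_measurable borel" using f by (auto dest: borel_measurable_integrable)
  show ?thesis
    unfolding is_fourier_iff using f by (auto simp: fourier_L1_L2 fourier_L1_mult_formula)
qed

lemma is_fourier_add:
  assumes "is_fourier f F" "is_fourier g G"
  shows "is_fourier (\<lambda>x. f x + g x) (\<lambda>\<xi>. F \<xi> + G \<xi>)"
proof -
  note [measurable] = is_fourierD(1,2)[OF assms(1)] is_fourierD(1,2)[OF assms(2)]
  note fin = is_fourierD(3,4)[OF assms(1)] is_fourierD(3,4)[OF assms(2)]
  have "(\<integral>\<xi>. (F \<xi> + G \<xi>) * \<psi> \<xi> \<partial>lborel) = (\<integral>x. (f x + g x) * fourier_L1 \<psi> x \<partial>lborel)"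
    if \<psi>: "integrable lborel \<psi>" "L2sq \<psi> < top" for \<psi>
  proof -
    have [measurable]: "\<psi> \<in> borel_measurable borel" using \<psi> by (auto dest: borel_measurable_integrable)
    have "(\<integral>\<xi>. (F \<xi> + G \<xi>) * \<psi> \<xi> \<partial>lborel) = (\<integral>\<xi>. F \<xi> * \<psi> \<xi> \<partial>lborel) + (\<integral>\<xi>. G \<xi> * \<psi> \<xi> \<partial>lborel)"
      unfolding distrib_right using fin \<psi> by (intro Bochner_Integration.integral_add integrable_mult_L2) auto
    also have "\<dots> = (\<integral>x. f x * fourier_L1 \<psi> x \<partial>lborel) + (\<integral>x. g x * fourier_L1 \<psi> x \<partial>lborel)"
      using is_fourier_formula[OF assms(1) \<psi>] is_fourier_formula[OF assms(2) \<psi>] by simp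
    also have "\<dots> = (\<integral>x. (f x + g x) * fourier_L1 \<psi> x \<partial>lborel)"
      unfolding distrib_right using fin fourier_L1_L2[OF \<psi>]
      by (intro Bochner_Integration.integral_add[symmetric] integrable_mult_L2) auto
    finally show ?thesis .
  qed
  then show ?thesis
    unfolding is_fourier_iff using fin by (auto intro!: L2sq_add_fin)
qed

lemma is_fourier_cmult:
  assumes "is_fourier f F"
  shows "is_fourier (\<lambda>x. c * f x) (\<lambda>\<xi>. c * F \<xi>)"
proof -
  note [measurable] = is_fourierD(1,2)[OF assms]
  show ?thesis unfolding is_fourier_iff
    using is_fourierD(3,4)[OF assms] is_fourier_formula[OF assms]
    by (auto simp: L2sq_cmult ennreal_mult_less_top mult.assoc integral_mult_right_zero)
qed

lemma is_fourier_diff: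
  assumes "is_fourier f F" "is_fourier g G"
  shows "is_fourier (\<lambda>x. f x - g x) (\<lambda>\<xi>. F \<xi> - G \<xi>)"
  using is_fourier_add[OF assms(1) is_fourier_cmult[OF assms(2), of "-1"]] by simp

lemma L2sq_indicator_fin:
  fixes n :: real
  shows "L2sq (\<lambda>x::'a::euclidean_space. indicator (ball 0 n) x :: complex) < top"
proof -
  have "L2sq (\<lambda>x::'a. indicator (ball 0 n) x :: complex) = (\<integral>\<^sup>+x. indicator (ball 0 n) x \<partial>(lborel :: 'a measure))"
    unfolding L2sq_def by (intro nn_integral_cong) (auto simp: indicator_def)
  also have "\<dots> < top" using emeasure_lborel_ball_finite[of 0 n] by simp
  finally show ?thesis .
qed

lemma integrable_indicator_mult_L2:
  fixes f :: "'a::euclidean_space \<Rightarrow> complex"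
  assumes "f \<in> borel_measurable borel" "L2sq f < top"
  shows "integrable lborel (\<lambda>x. indicator (ball 0 n) x * f x)"
  by (rule integrable_mult_L2) (use assms L2sq_indicator_fin in auto)

lemma L2sq_indicator_le: "L2sq (\<lambda>x. indicator A x * f x :: complex) \<le> L2sq f"
  by (rule L2sq_mono_AE) (auto simp: indicator_def)

lemma L2sq_truncate_tendsto:
  fixes f :: "'a::euclidean_space \<Rightarrow> complex"
  assumes [measurable]: "f \<in> borel_measurable borel" and fin: "L2sq f < top"
  shows "(\<lambda>n. L2sq (\<lambda>x. indicator (ball 0 (real n)) x * f x - f x)) \<longlonglongrightarrow> 0"
proof -
  have "(\<lambda>n. \<integral>\<^sup>+x. ennreal ((norm (indicator (ball 0 (real n)) x * f x - f x))\<^sup>2) \<partial>lborel) \<longlonglongrightarrow> (\<integral>\<^sup>+(x::'a). 0 \<partial>lborel)"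
  proof (rule nn_integral_dominated_convergence[where w="\<lambda>x. ennreal ((norm (f x))\<^sup>2)"])
    show "AE x in lborel. (\<lambda>n. ennreal ((norm (indicator (ball 0 (real n)) x * f x - f x))\<^sup>2)) \<longlonglongrightarrow> 0"
    proof (rule AE_I2)
      fix x :: 'a
      obtain N where N: "norm x < real N" using reals_Archimedean2 by blast
      show "(\<lambda>n. ennreal ((norm (indicator (ball 0 (real n)) x * f x - f x))\<^sup>2)) \<longlonglongrightarrow> 0"
        by (rule tendsto_eventually, rule eventually_sequentiallyI[of N]) (use N in \<open>auto simp: indicator_def\<close>)
    qed
    show "(\<integral>\<^sup>+x. ennreal ((norm (f x))\<^sup>2) \<partial>lborel) < \<infinity>" using fin by (simp add: L2sq_def)
    show "AE x in lborel. ennreal ((norm (indicator (ball 0 (real n)) x * f x - f x))\<^sup>2) \<le> ennreal ((norm (f x))\<^sup>2)" for n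
      by (rule AE_I2) (auto simp: indicator_def)
  qed auto
  then show ?thesis by (simp add: L2sq_def)
qed

lemma fourier_L1_diff:
  assumes "integrable lborel f" "integrable lborel g"
  shows "fourier_L1 (\<lambda>x. f x - g x) \<xi> = fourier_L1 f \<xi> - fourier_L1 g \<xi>"
  unfolding fourier_L1_alt right_diff_distrib
  by (rule Bochner_Integration.integral_diff) (intro integrable_ek_mult assms)+

text \<open>Truncations to balls lie in L^1 as well as in L^2, and Plancherel makes their transforms
  a Cauchy sequence. The norm and the multiplication formula pass to the limit.\<close>

lemma is_fourier_exists:
  fixes f :: "real^'d \<Rightarrow> complex"
  assumes [measurable]: "f \<in> borel_measurable borel" and fin: "L2sq f < top"
  obtains F where "is_fourier f F" "L2sq F = L2sq f"
proof -
  define u where "u n x = indicator (ball 0 (real n)) x * f x" for n x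
  have [measurable]: "u n \<in> borel_measurable borel" for n unfolding u_def by measurable
  have u1: "integrable lborel (u n)" for n
    unfolding u_def by (rule integrable_indicator_mult_L2) (use fin in auto)
  have u2: "L2sq (u n) < top" for n
    using fin L2sq_indicator_le[of _ f] unfolding u_def by (auto intro: le_less_trans)
  have ulim: "(\<lambda>n. L2sq (\<lambda>x. u n x - f x)) \<longlonglongrightarrow> 0"
    unfolding u_def by (rule L2sq_truncate_tendsto) (use fin in auto)
  have diff: "L2sq (\<lambda>\<xi>. fourier_L1 (u m) \<xi> - fourier_L1 (u n) \<xi>) = L2sq (\<lambda>x. u m x - u n x)" for m n
  proof -
    have "fourier_L1 (\<lambda>x. u m x - u n x) = (\<lambda>\<xi>. fourier_L1 (u m) \<xi> - fourier_L1 (u n) \<xi>)"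
      by (rule ext) (rule fourier_L1_diff[OF u1 u1])
    then show ?thesis
      using Plancherel_L1_L2[of "\<lambda>x. u m x - u n x"] u1 u2 L2sq_diff_fin[of "u m" "u n"] by simp
  qed
  have cau: "\<exists>N. \<forall>m\<ge>N. \<forall>n\<ge>N. L2sq (\<lambda>\<xi>. fourier_L1 (u m) \<xi> - fourier_L1 (u n) \<xi>) \<le> ennreal e" if e: "e > 0" for e :: real
  proof -
    have "\<forall>\<^sub>F n in sequentially. L2sq (\<lambda>x. u n x - f x) < ennreal (e/4)"
      using ulim e by (intro order_tendstoD) auto
    then obtain N where N: "\<And>n. n \<ge> N \<Longrightarrow> L2sq (\<lambda>x. u n x - f x) \<le> ennreal (e/4)"
      by (auto simp: eventually_sequentially dest: less_imp_le)
    have "L2sq (\<lambda>x. u m x - u n x) \<le> ennreal e" if "m \<ge> N" "n \<ge> N" for m n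
    proof -
      have "L2sq (\<lambda>x. u m x - u n x) \<le> 2 * L2sq (\<lambda>x. u m x - f x) + 2 * L2sq (\<lambda>x. f x - u n x)"
        by (rule L2sq_diff_triangle) auto
      also have "\<dots> \<le> 2 * ennreal (e/4) + 2 * ennreal (e/4)"
        using N that by (intro add_mono mult_left_mono) (auto simp: L2sq_minus_commute[of f])
      also have "\<dots> = ennreal e" using e
        by (simp add: ennreal_plus[symmetric] ennreal_mult[symmetric] ennreal_numeral[symmetric] del: ennreal_plus ennreal_numeral)
      finally show ?thesis .
    qed
    then show ?thesis by (intro exI[of _ N]) (auto simp: diff)
  qed
  obtain s where s: "(\<lambda>n. L2sq (\<lambda>\<xi>. fourier_L1 (u n) \<xi> - lim (\<lambda>k. fourier_L1 (u (s k)) \<xi>))) \<longlonglongrightarrow> 0"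
    using L2sq_complete[of "\<lambda>n. fourier_L1 (u n)", OF _ cau] by auto
  define F where "F \<xi> = lim (\<lambda>k. fourier_L1 (u (s k)) \<xi>)" for \<xi>
  have [measurable]: "F \<in> borel_measurable borel" unfolding F_def by measurable
  have Flim: "(\<lambda>n. L2sq (\<lambda>\<xi>. fourier_L1 (u n) \<xi> - F \<xi>)) \<longlonglongrightarrow> 0" using s by (simp add: F_def)
  have ft2: "L2sq (fourier_L1 (u n)) < top" for n using fourier_L1_L2[OF u1 u2] .
  have Ffin: "L2sq F < top"
  proof -
    have "\<forall>\<^sub>F n in sequentially. L2sq (\<lambda>\<xi>. fourier_L1 (u n) \<xi> - F \<xi>) < 1"
      using Flim by (intro order_tendstoD) auto
    then obtain n where n: "L2sq (\<lambda>\<xi>. fourier_L1 (u n) \<xi> - F \<xi>) < 1" by (auto simp: eventually_sequentially)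
    have "L2sq (\<lambda>\<xi>. fourier_L1 (u n) \<xi> - F \<xi>) < top" using n by (rule less_trans) simp
    then show ?thesis
      using L2sq_diff_fin[of "fourier_L1 (u n)" "\<lambda>\<xi>. fourier_L1 (u n) \<xi> - F \<xi>"] ft2 by simp
  qed
  have "(\<lambda>n. L2sq (fourier_L1 (u n))) \<longlonglongrightarrow> L2sq F"
    by (rule L2sq_tendsto) (use ft2 Ffin Flim in auto)
  moreover have "(\<lambda>n. L2sq (u n)) \<longlonglongrightarrow> L2sq f"
    by (rule L2sq_tendsto) (use u2 fin ulim in auto)
  ultimately have norm: "L2sq F = L2sq f"
    using Plancherel_L1_L2[OF u1 u2] by (simp add: LIMSEQ_unique)
  have "(\<integral>\<xi>. F \<xi> * \<psi> \<xi> \<partial>lborel) = (\<integral>x. f x * fourier_L1 \<psi> x \<partial>lborel)"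
    if \<psi>: "integrable lborel \<psi>" "L2sq \<psi> < top" for \<psi>
  proof -
    have [measurable]: "\<psi> \<in> borel_measurable borel" using \<psi> by (auto dest: borel_measurable_integrable)
    have "(\<lambda>n. \<integral>\<xi>. fourier_L1 (u n) \<xi> * \<psi> \<xi> \<partial>lborel) \<longlonglongrightarrow> (\<integral>\<xi>. F \<xi> * \<psi> \<xi> \<partial>lborel)"
      by (rule tendsto_integral_mult_L2) (use ft2 Ffin Flim \<psi> in auto)
    moreover have "(\<lambda>n. \<integral>x. u n x * fourier_L1 \<psi> x \<partial>lborel) \<longlonglongrightarrow> (\<integral>x. f x * fourier_L1 \<psi> x \<partial>lborel)"
      by (rule tendsto_integral_mult_L2) (use u2 fin ulim fourier_L1_L2[OF \<psi>] in auto)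
    ultimately show ?thesis
      by (simp add: fourier_L1_mult_formula[OF u1 \<psi>(1)] LIMSEQ_unique)
  qed
  then have "is_fourier f F" unfolding is_fourier_iff using fin Ffin by auto
  with norm that show ?thesis by blast
qed

text \<open>The conjugate of \<open>F\<close>, cut off to a ball, is integrable and square
  integrable; testing with it yields the squared norm of \<open>F\<close> on that ball.\<close>

lemma is_fourier_zero_imp:
  fixes f F :: "real^'d \<Rightarrow> complex"
  assumes "is_fourier f F" "AE x in lborel. f x = 0"
  shows "AE \<xi> in lborel. F \<xi> = 0"
proof -
  note [measurable] = is_fourierD(1,2)[OF assms(1)]
  have "AE \<xi> in lborel. indicator (ball 0 (real n)) \<xi> * F \<xi> = 0" for n
  proof -
    let ?\<psi> = "\<lambda>\<xi>. indicator (ball 0 (real n)) \<xi> * cnj (F \<xi>)"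
    have \<psi>: "integrable lborel ?\<psi>" "L2sq ?\<psi> < top"
      using is_fourierD(4)[OF assms(1)] L2sq_indicator_le[of _ "\<lambda>\<xi>. cnj (F \<xi>)"]
      by (auto intro!: integrable_indicator_mult_L2 simp: L2sq_cnj intro: le_less_trans)
    have [measurable]: "fourier_L1 ?\<psi> \<in> borel_measurable borel" by measurable
    have "(\<integral>\<xi>. F \<xi> * ?\<psi> \<xi> \<partial>lborel) = (\<integral>x. f x * fourier_L1 ?\<psi> x \<partial>lborel)"
      by (rule is_fourier_formula[OF assms(1) \<psi>])
    also have "\<dots> = (\<integral>x. 0 \<partial>(lborel :: (real^'d) measure))"
      by (rule integral_cong_AE) (use assms(2) in \<open>auto elim: eventually_mono\<close>)
    finally have 0: "(\<integral>\<xi>. F \<xi> * ?\<psi> \<xi> \<partial>lborel) = 0" by simp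
    have eq: "F \<xi> * ?\<psi> \<xi> = complex_of_real ((norm (indicator (ball 0 (real n)) \<xi> * F \<xi>))\<^sup>2)" for \<xi>
      by (auto simp: indicator_def complex_norm_square simp del: of_real_power)
    have fin: "L2sq (\<lambda>\<xi>. indicator (ball 0 (real n)) \<xi> * F \<xi>) < top"
      using is_fourierD(4)[OF assms(1)] L2sq_indicator_le[of _ F] by (auto intro: le_less_trans)
    have "(\<integral>\<xi>. (norm (indicator (ball 0 (real n)) \<xi> * F \<xi>))\<^sup>2 \<partial>lborel) = 0"
      using 0 unfolding eq integral_complex_of_real by (simp only: of_real_eq_0_iff)
    then have "enn2real (L2sq (\<lambda>\<xi>. indicator (ball 0 (real n)) \<xi> * F \<xi>)) = 0"
      unfolding L2sq_def by (subst (asm) integral_eq_nn_integral) auto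
    then have "L2sq (\<lambda>\<xi>. indicator (ball 0 (real n)) \<xi> * F \<xi>) = 0"
      using fin by (auto simp: enn2real_eq_0_iff)
    then show ?thesis by (subst (asm) L2sq_eq_0_iff) auto
  qed
  then have "AE \<xi> in lborel. \<forall>n. indicator (ball 0 (real n)) \<xi> * F \<xi> = 0"
    by (simp only: AE_all_countable simp_thms)
  then show ?thesis
  proof eventually_elim
    case (elim \<xi>)
    obtain N where "norm \<xi> < real N" using reals_Archimedean2 by blast
    with elim[rule_format, of N] show ?case by (simp add: indicator_def)
  qed
qed

lemma is_fourier_unique:
  assumes "is_fourier f F" "is_fourier f G"
  shows "AE \<xi> in lborel. F \<xi> = G \<xi>"
  using is_fourier_zero_imp[OF is_fourier_diff[OF assms]] by simp

text \<open>The transform built in \<open>is_fourier_exists\<close> is isometric, and any other one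
  agrees with it almost everywhere.\<close>

lemma is_fourier_Plancherel:
  assumes "is_fourier f F"
  shows "L2sq F = L2sq f"
proof -
  obtain G where G: "is_fourier f G" "L2sq G = L2sq f"
    using is_fourier_exists[of f] is_fourierD[OF assms] by auto
  with L2sq_cong_AE[OF is_fourier_unique[OF assms G(1)]] show ?thesis by simp
qed

lemma is_fourier_unique_inverse:
  assumes "is_fourier f F" "is_fourier g G" "AE \<xi> in lborel. F \<xi> = G \<xi>"
  shows "AE x in lborel. f x = g x"
proof -
  note [measurable] = is_fourierD(1,2)[OF assms(1)] is_fourierD(1,2)[OF assms(2)]
  have "L2sq (\<lambda>\<xi>. F \<xi> - G \<xi>) = 0" using assms(3) by (subst L2sq_eq_0_iff) (auto elim: eventually_mono)
  with is_fourier_Plancherel[OF is_fourier_diff[OF assms(1,2)]] have "L2sq (\<lambda>x. f x - g x) = 0" by simp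
  then show ?thesis by (subst (asm) L2sq_eq_0_iff) auto
qed

lemma L2sq_add_cmult_eq:
  fixes f g :: "'a::euclidean_space \<Rightarrow> complex"
  assumes [measurable]: "f \<in> borel_measurable borel" "g \<in> borel_measurable borel"
    and fin: "L2sq f < top" "L2sq g < top"
  shows "enn2real (L2sq (\<lambda>x. f x + c * g x)) =
    enn2real (L2sq f) + (cmod c)\<^sup>2 * enn2real (L2sq g) + 2 * Re (cnj c * (\<integral>x. f x * cnj (g x) \<partial>lborel))"
proof -
  have sq: "enn2real (L2sq u) = (\<integral>x. (cmod (u x))\<^sup>2 \<partial>lborel)" if "u \<in> borel_measurable borel" for u :: "'a \<Rightarrow> complex"
  proof -
    have [measurable]: "u \<in> borel_measurable borel" by fact
    show ?thesis unfolding L2sq_def by (subst integral_eq_nn_integral) auto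
  qed
  have int: "integrable lborel (\<lambda>x. (cmod (u x))\<^sup>2)" if "u \<in> borel_measurable borel" "L2sq u < top" for u :: "'a \<Rightarrow> complex"
    using that by (intro integrableI_bounded) (auto simp: L2sq_def)
  have fg: "integrable lborel (\<lambda>x. f x * cnj (g x))"
    by (rule integrable_mult_L2) (use fin in \<open>auto simp: L2sq_cnj\<close>)
  then have fg': "integrable lborel (\<lambda>x. cnj c * (f x * cnj (g x)))" by (rule integrable_mult_right)
  have "(cmod (a + c * b))\<^sup>2 = (cmod a)\<^sup>2 + (cmod c)\<^sup>2 * (cmod b)\<^sup>2 + 2 * Re (cnj c * (a * cnj b))" for a b
    unfolding cmod_power2 by (simp add: power2_eq_square algebra_simps)
  then have "(\<integral>x. (cmod (f x + c * g x))\<^sup>2 \<partial>lborel) =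
      (\<integral>x. (cmod (f x))\<^sup>2 + (cmod c)\<^sup>2 * (cmod (g x))\<^sup>2 + 2 * Re (cnj c * (f x * cnj (g x))) \<partial>lborel)"
    by simp
  also have "\<dots> = (\<integral>x. (cmod (f x))\<^sup>2 + (cmod c)\<^sup>2 * (cmod (g x))\<^sup>2 \<partial>lborel) + (\<integral>x. 2 * Re (cnj c * (f x * cnj (g x))) \<partial>lborel)"
    using int[of f] int[of g] fin integrable_Re[OF fg']
    by (intro Bochner_Integration.integral_add integrable_mult_right Bochner_Integration.integrable_add) auto
  also have "(\<integral>x. (cmod (f x))\<^sup>2 + (cmod c)\<^sup>2 * (cmod (g x))\<^sup>2 \<partial>lborel) = (\<integral>x. (cmod (f x))\<^sup>2 \<partial>lborel) + (\<integral>x. (cmod c)\<^sup>2 * (cmod (g x))\<^sup>2 \<partial>lborel)"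
    using int[of f] int[of g] fin by (intro Bochner_Integration.integral_add) auto
  also have "(\<integral>x. (cmod c)\<^sup>2 * (cmod (g x))\<^sup>2 \<partial>lborel) = (cmod c)\<^sup>2 * (\<integral>x. (cmod (g x))\<^sup>2 \<partial>lborel)"
    by simp
  also have "(\<integral>x. 2 * Re (cnj c * (f x * cnj (g x))) \<partial>lborel) = 2 * Re (\<integral>x. cnj c * (f x * cnj (g x)) \<partial>lborel)"
    using integral_Re[OF fg'] by (simp only: integral_mult_right_zero)
  also have "(\<integral>x. cnj c * (f x * cnj (g x)) \<partial>lborel) = cnj c * (\<integral>x. f x * cnj (g x) \<partial>lborel)"
    by (rule integral_mult_right_zero)
  finally show ?thesis by (simp add: sq)
qed

text \<open>Polarisation: Plancherel for \<open>f + c * g\<close> determines the real part of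
  \<open>cnj c\<close> times the pairing; \<open>c = 1\<close> and \<open>c = \<i>\<close> recover
  real and imaginary part.\<close>

lemma is_fourier_Parseval:
  assumes "is_fourier f F" "is_fourier g G"
  shows "(\<integral>\<xi>. F \<xi> * cnj (G \<xi>) \<partial>lborel) = (\<integral>x. f x * cnj (g x) \<partial>lborel)" (is "?L = ?R")
proof -
  note [measurable] = is_fourierD(1,2)[OF assms(1)] is_fourierD(1,2)[OF assms(2)]
  note fin = is_fourierD(3,4)[OF assms(1)] is_fourierD(3,4)[OF assms(2)]
  have "Re (cnj c * ?L) = Re (cnj c * ?R)" for c
  proof -
    have "enn2real (L2sq (\<lambda>\<xi>. F \<xi> + c * G \<xi>)) = enn2real (L2sq (\<lambda>x. f x + c * g x))"
      using is_fourier_Plancherel[OF is_fourier_add[OF assms(1) is_fourier_cmult[OF assms(2)]]] by simp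
    then show ?thesis
      using is_fourier_Plancherel[OF assms(1)] is_fourier_Plancherel[OF assms(2)] fin
      by (simp add: L2sq_add_cmult_eq)
  qed
  from this[of 1] this[of \<i>] show ?thesis by (simp add: complex_eq_iff)
qed

lemma fourier_L1_cnj: "fourier_L1 (\<lambda>x. cnj (\<psi> x)) (- \<xi>) = cnj (fourier_L1 \<psi> \<xi>)"
proof -
  have "cnj (ek x \<xi>) = ek x (- \<xi>)" for x by (simp add: ek_def exp_cnj)
  then show ?thesis unfolding fourier_L1_alt by (simp flip: Bochner_Integration.integral_cnj)
qed

text \<open>The reflected Fourier transform of \<open>F\<close> is an inverse. Conjugating the test
  function turns the required formula into Parseval, and \<open>fourier_L1_cnj\<close> accounts for
  the reflection.\<close>

lemma is_fourier_exists_inverse: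
  fixes F :: "real^'d \<Rightarrow> complex"
  assumes [measurable]: "F \<in> borel_measurable borel" and fin: "L2sq F < top"
  obtains f where "is_fourier f F"
proof -
  obtain H where H: "is_fourier F H" using is_fourier_exists[OF assms] by blast
  note [measurable] = is_fourierD(2)[OF H]
  have refl: "L2sq (\<lambda>x. H (- x)) = L2sq H"
    by (rule lborel_preserving.L2sq[OF lborel_preserving_uminus]) auto
  have "(\<integral>\<xi>. F \<xi> * \<psi> \<xi> \<partial>lborel) = (\<integral>x. H (- x) * fourier_L1 \<psi> x \<partial>lborel)"
    if \<psi>: "integrable lborel \<psi>" "L2sq \<psi> < top" for \<psi>
  proof -
    have [measurable]: "\<psi> \<in> borel_measurable borel" using \<psi> by (auto dest: borel_measurable_integrable)
    let ?c = "\<lambda>\<xi>. cnj (\<psi> \<xi>)"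
    have "is_fourier ?c (fourier_L1 ?c)"
      using \<psi> by (intro is_fourier_fourier_L1) (auto simp: L2sq_cnj)
    from is_fourier_Parseval[OF H this]
    have "(\<integral>\<xi>. F \<xi> * \<psi> \<xi> \<partial>lborel) = (\<integral>x. H x * cnj (fourier_L1 ?c x) \<partial>lborel)" by simp
    also have "\<dots> = (\<integral>x. H (- x) * cnj (fourier_L1 ?c (- x)) \<partial>lborel)"
      by (rule lborel_preserving.integral[OF lborel_preserving_uminus, symmetric]) measurable
    finally show ?thesis by (simp add: fourier_L1_cnj)
  qed
  then have "is_fourier (\<lambda>x. H (- x)) F"
    unfolding is_fourier_iff using fin is_fourierD[OF H] refl by auto
  then show ?thesis by (rule that)
qed

section \<open>Translations, dilations and rotations under the Fourier transform\<close>

lemma is_fourier_translate: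
  assumes "is_fourier f F"
  shows "is_fourier (\<lambda>x. f (x + y)) (\<lambda>\<xi>. ek (- y) \<xi> * F \<xi>)"
proof -
  note [measurable] = is_fourierD(1,2)[OF assms]
  have "(\<integral>\<xi>. ek (- y) \<xi> * F \<xi> * \<psi> \<xi> \<partial>lborel) = (\<integral>x. f (x + y) * fourier_L1 \<psi> x \<partial>lborel)"
    if \<psi>: "integrable lborel \<psi>" "L2sq \<psi> < top" for \<psi>
  proof -
    have [measurable]: "\<psi> \<in> borel_measurable borel" using \<psi> by (auto dest: borel_measurable_integrable)
    let ?\<phi> = "\<lambda>\<xi>. ek \<xi> (- y) * \<psi> \<xi>"
    have "L2sq ?\<phi> = L2sq \<psi>" by (simp add: L2sq_def norm_mult)
    then have "(\<integral>\<xi>. F \<xi> * ?\<phi> \<xi> \<partial>lborel) = (\<integral>x. f x * fourier_L1 ?\<phi> x \<partial>lborel)"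
      using \<psi> by (intro is_fourier_formula[OF assms] integrable_ek_mult) auto
    also have "\<dots> = (\<integral>x. f x * fourier_L1 \<psi> (x - y) \<partial>lborel)"
    proof -
      have e: "ek z x * (ek z (- y) * \<psi> z) = ek z (x - y) * \<psi> z" for x z
        using ek_add_left[of x "- y" z] by (simp add: ek_commute[of z])
      show ?thesis unfolding fourier_L1_alt e ..
    qed
    also have "\<dots> = (\<integral>x. f (x + y) * fourier_L1 \<psi> (x + y - y) \<partial>lborel)"
      by (rule lborel_preserving.integral[OF lborel_preserving_translate, symmetric]) measurable
    finally show ?thesis by (simp add: ek_commute mult_ac)
  qed
  moreover have "L2sq (\<lambda>x. f (x + y)) = L2sq f"
    by (rule lborel_preserving.L2sq[OF lborel_preserving_translate]) measurable
  moreover have "L2sq (\<lambda>\<xi>. ek (- y) \<xi> * F \<xi>) = L2sq F" by (simp add: L2sq_def norm_mult)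
  ultimately show ?thesis unfolding is_fourier_iff using is_fourierD[OF assms] by auto
qed

lemma is_fourier_scale:
  fixes f :: "real^'d \<Rightarrow> complex"
  assumes "is_fourier f F" and c: "c > 0"
  shows "is_fourier (\<lambda>x. f (c *\<^sub>R x)) (\<lambda>\<xi>. complex_of_real (c powr - real CARD('d)) * F ((1/c) *\<^sub>R \<xi>))"
proof -
  note [measurable] = is_fourierD(1,2)[OF assms(1)]
  let ?k = "complex_of_real (c powr - real CARD('d))"
  have "(\<integral>\<xi>. ?k * F ((1/c) *\<^sub>R \<xi>) * \<psi> \<xi> \<partial>lborel) = (\<integral>x. f (c *\<^sub>R x) * fourier_L1 \<psi> x \<partial>lborel)"
    if \<psi>: "integrable lborel \<psi>" "L2sq \<psi> < top" for \<psi>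
  proof -
    have [measurable]: "\<psi> \<in> borel_measurable borel" using \<psi> by (auto dest: borel_measurable_integrable)
    let ?\<phi> = "\<lambda>\<xi>. \<psi> (c *\<^sub>R \<xi>)"
    have "(\<integral>\<xi>. ?k * F ((1/c) *\<^sub>R \<xi>) * \<psi> \<xi> \<partial>lborel) = (c powr - real DIM(real^'d)) *\<^sub>R (\<integral>\<xi>. F ((1/c) *\<^sub>R \<xi>) * \<psi> \<xi> \<partial>lborel)"
      by (simp add: scaleR_conv_of_real mult.assoc)
    also have "\<dots> = (\<integral>\<xi>. F ((1/c) *\<^sub>R (c *\<^sub>R \<xi>)) * \<psi> (c *\<^sub>R \<xi>) \<partial>lborel)"
      using c by (intro integral_lborel_scale[symmetric]) measurable
    also have "\<dots> = (\<integral>\<xi>. F \<xi> * ?\<phi> \<xi> \<partial>lborel)" using c by simp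
    also have "\<dots> = (\<integral>x. f x * fourier_L1 ?\<phi> x \<partial>lborel)"
      using \<psi> c by (intro is_fourier_formula[OF assms(1)]) (auto simp: integrable_lborel_scale L2sq_scale ennreal_mult_less_top)
    also have "\<dots> = (\<integral>x. f x * (?k * fourier_L1 \<psi> ((1/c) *\<^sub>R x)) \<partial>lborel)"
    proof -
      have "fourier_L1 ?\<phi> x = ?k * fourier_L1 \<psi> ((1/c) *\<^sub>R x)" for x
      proof -
        have "fourier_L1 ?\<phi> x = (\<integral>z. ek (c *\<^sub>R z) ((1/c) *\<^sub>R x) * \<psi> (c *\<^sub>R z) \<partial>lborel)"
          using c by (simp add: fourier_L1_alt ek_def)
        also have "\<dots> = (c powr - real DIM(real^'d)) *\<^sub>R (\<integral>z. ek z ((1/c) *\<^sub>R x) * \<psi> z \<partial>lborel)"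
          using c by (intro integral_lborel_scale) measurable
        finally show ?thesis by (simp add: fourier_L1_alt scaleR_conv_of_real)
      qed
      then show ?thesis by simp
    qed
    also have "\<dots> = (c powr - real DIM(real^'d)) *\<^sub>R (\<integral>x. f x * fourier_L1 \<psi> ((1/c) *\<^sub>R x) \<partial>lborel)"
      by (simp add: scaleR_conv_of_real mult.left_commute[of "f _"])
    also have "\<dots> = (\<integral>x. f (c *\<^sub>R x) * fourier_L1 \<psi> ((1/c) *\<^sub>R (c *\<^sub>R x)) \<partial>lborel)"
      using c by (intro integral_lborel_scale[symmetric]) measurable
    finally show ?thesis using c by simp
  qed
  moreover have "L2sq (\<lambda>x. f (c *\<^sub>R x)) < top"
    using is_fourierD[OF assms(1)] c by (simp add: L2sq_scale ennreal_mult_less_top)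
  moreover have "L2sq (\<lambda>\<xi>. ?k * F ((1/c) *\<^sub>R \<xi>)) < top"
    using is_fourierD[OF assms(1)] L2sq_scale[of F "1/c"] c by (simp add: L2sq_cmult ennreal_mult_less_top)
  ultimately show ?thesis unfolding is_fourier_iff by auto
qed

lemma is_fourier_orthogonal:
  fixes f :: "real^'d \<Rightarrow> complex" and U :: "real^'d \<Rightarrow> real^'d"
  assumes "is_fourier f F" and U: "orthogonal_transformation U"
  shows "is_fourier (\<lambda>x. f (U x)) (\<lambda>\<xi>. F (U \<xi>))"
proof -
  note [measurable] = is_fourierD(1,2)[OF assms(1)] orthogonal_transformation_borel[OF U]
  interpret U: lborel_preserving U by (rule lborel_preserving_orthogonal[OF U])
  define V where "V = inv U"
  have V: "orthogonal_transformation V" using U unfolding V_def by (rule orthogonal_transformation_inv)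
  note [measurable] = orthogonal_transformation_borel[OF V]
  have UV: "U (V x) = x" "V (U x) = x" for x
    using U by (simp_all add: V_def orthogonal_transformation_surj surj_f_inv_f orthogonal_transformation_inj inv_f_f)
  have adj: "U x \<bullet> y = x \<bullet> V y" for x y
    using U UV(1)[of y] by (metis orthogonal_transformation_def)
  have "(\<integral>\<xi>. F (U \<xi>) * \<psi> \<xi> \<partial>lborel) = (\<integral>x. f (U x) * fourier_L1 \<psi> x \<partial>lborel)"
    if \<psi>: "integrable lborel \<psi>" "L2sq \<psi> < top" for \<psi>
  proof -
    interpret V: lborel_preserving V by (rule lborel_preserving_orthogonal[OF V])
    have [measurable]: "\<psi> \<in> borel_measurable borel" using \<psi> by (auto dest: borel_measurable_integrable)
    have "(\<integral>\<xi>. F (U \<xi>) * \<psi> \<xi> \<partial>lborel) = (\<integral>\<xi>. F \<xi> * \<psi> (V \<xi>) \<partial>lborel)"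
      using U.integral[of "\<lambda>\<xi>. F \<xi> * \<psi> (V \<xi>)"] by (simp add: UV)
    also have "\<dots> = (\<integral>x. f x * fourier_L1 (\<lambda>\<xi>. \<psi> (V \<xi>)) x \<partial>lborel)"
      using \<psi> by (intro is_fourier_formula[OF assms(1)]) (auto simp: V.integrable V.L2sq)
    also have "\<dots> = (\<integral>x. f x * fourier_L1 \<psi> (V x) \<partial>lborel)"
    proof -
      have "fourier_L1 (\<lambda>\<xi>. \<psi> (V \<xi>)) x = fourier_L1 \<psi> (V x)" for x
        using U.integral[of "\<lambda>z. ek z x * \<psi> (V z)"] by (simp add: fourier_L1_alt UV ek_def adj)
      then show ?thesis by simp
    qed
    also have "\<dots> = (\<integral>x. f (U x) * fourier_L1 \<psi> x \<partial>lborel)"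
      using U.integral[of "\<lambda>x. f x * fourier_L1 \<psi> (V x)"] by (simp add: UV)
    finally show ?thesis .
  qed
  then show ?thesis unfolding is_fourier_iff using is_fourierD[OF assms(1)] by (auto simp: U.L2sq)
qed

section \<open>Ball averages and compactness\<close>

text \<open>Takes a type token, since the volume depends only on the radius and on the dimension of
  the space.\<close>

definition bvol :: "'a::euclidean_space itself \<Rightarrow> real \<Rightarrow> real" where
  "bvol _ \<delta> = measure lborel (ball (0::'a) \<delta>)"

definition bavg :: "real \<Rightarrow> ('a::euclidean_space \<Rightarrow> complex) \<Rightarrow> 'a \<Rightarrow> complex" where
  "bavg \<delta> u x = complex_of_real (1 / bvol TYPE('a) \<delta>) * (\<integral>y. indicator (ball 0 \<delta>) y * u (x + y) \<partial>lborel)"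

lemma bvol_eq: "\<delta> \<ge> 0 \<Longrightarrow> bvol TYPE('a::euclidean_space) \<delta> = unit_ball_vol (real DIM('a)) * \<delta> ^ DIM('a)"
  by (simp add: bvol_def content_ball)

lemma bvol_pos: "\<delta> > 0 \<Longrightarrow> bvol TYPE('a::euclidean_space) \<delta> > 0"
  by (simp add: bvol_eq)

lemma emeasure_ball_bvol: "\<delta> \<ge> 0 \<Longrightarrow> emeasure lborel (ball (c::'a::euclidean_space) \<delta>) = ennreal (bvol TYPE('a) \<delta>)"
  by (simp add: bvol_eq emeasure_ball)

lemma L2sq_indicator_ball: "\<delta> \<ge> 0 \<Longrightarrow> L2sq (\<lambda>x::'a::euclidean_space. indicator (ball c \<delta>) x :: complex) = ennreal (bvol TYPE('a) \<delta>)"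
proof -
  assume "\<delta> \<ge> 0"
  have "L2sq (\<lambda>x::'a. indicator (ball c \<delta>) x :: complex) = (\<integral>\<^sup>+x. indicator (ball c \<delta>) x \<partial>(lborel :: 'a measure))"
    unfolding L2sq_def by (intro nn_integral_cong) (auto simp: indicator_def)
  with \<open>\<delta> \<ge> 0\<close> show ?thesis by (simp add: emeasure_ball_bvol)
qed

lemma bavg_measurable [measurable]:
  assumes [measurable]: "u \<in> borel_measurable borel"
  shows "bavg \<delta> u \<in> borel_measurable borel"
  unfolding bavg_def by measurable

lemma L2sq_shift:
  fixes u :: "'a::euclidean_space \<Rightarrow> 'b::{real_normed_vector,second_countable_topology}"
  assumes [measurable]: "u \<in> borel_measurable borel"
  shows "L2sq (\<lambda>y. u (x + y)) = L2sq u"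
  using lborel_preserving.L2sq[OF lborel_preserving_translate, of u x] by (simp add: add.commute)

text \<open>Jensen's inequality for the mean over a ball, obtained as Cauchy-Schwarz against the
  indicator.\<close>

lemma ball_mean_sq_le:
  fixes w :: "'a::euclidean_space \<Rightarrow> complex"
  assumes [measurable]: "w \<in> borel_measurable borel" and \<delta>: "\<delta> > 0"
  shows "ennreal ((cmod (complex_of_real (1 / bvol TYPE('a) \<delta>) * (\<integral>y. indicator (ball 0 \<delta>) y * w y \<partial>lborel)))\<^sup>2)
    \<le> ennreal (1 / bvol TYPE('a) \<delta>) * (\<integral>\<^sup>+y. indicator (ball 0 \<delta>) y * ennreal ((cmod (w y))\<^sup>2) \<partial>lborel)"
proof -
  let ?v = "bvol TYPE('a) \<delta>"
  have v: "?v > 0" by (rule bvol_pos[OF \<delta>])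
  \<comment> \<open>One copy of the indicator is the second factor in Cauchy-Schwarz, the other
    confines \<open>w\<close> to the ball.\<close>
  have eq: "indicator (ball 0 \<delta>) y * w y = indicator (ball 0 \<delta>) y * (indicator (ball 0 \<delta>) y * w y)" for y
    by (auto simp: indicator_def)
  have "ennreal ((cmod (\<integral>y. indicator (ball 0 \<delta>) y * w y \<partial>lborel))\<^sup>2)
      \<le> L2sq (\<lambda>y::'a. indicator (ball 0 \<delta>) y :: complex) * L2sq (\<lambda>y. indicator (ball 0 \<delta>) y * w y)"
    by (subst eq, rule Cauchy_Schwarz_complex) measurable
  also have "L2sq (\<lambda>y. indicator (ball 0 \<delta>) y * w y) = (\<integral>\<^sup>+y. indicator (ball 0 \<delta>) y * ennreal ((cmod (w y))\<^sup>2) \<partial>lborel)"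
    unfolding L2sq_def by (intro nn_integral_cong) (auto simp: indicator_def)
  finally have *: "ennreal ((cmod (\<integral>y. indicator (ball 0 \<delta>) y * w y \<partial>lborel))\<^sup>2)
      \<le> ennreal ?v * (\<integral>\<^sup>+y. indicator (ball 0 \<delta>) y * ennreal ((cmod (w y))\<^sup>2) \<partial>lborel)"
    using \<delta> by (simp add: L2sq_indicator_ball)
  have "ennreal ((cmod (complex_of_real (1 / ?v) * (\<integral>y. indicator (ball 0 \<delta>) y * w y \<partial>lborel)))\<^sup>2)
     = ennreal ((1 / ?v)\<^sup>2) * ennreal ((cmod (\<integral>y. indicator (ball 0 \<delta>) y * w y \<partial>lborel))\<^sup>2)"
    by (subst ennreal_mult[symmetric]) (auto simp: norm_mult power_mult_distrib norm_divide power_divide)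
  also have "\<dots> \<le> ennreal ((1 / ?v)\<^sup>2) * (ennreal ?v * (\<integral>\<^sup>+y. indicator (ball 0 \<delta>) y * ennreal ((cmod (w y))\<^sup>2) \<partial>lborel))"
    by (intro mult_left_mono *) simp
  also have "\<dots> = ennreal ((1 / ?v)\<^sup>2 * ?v) * (\<integral>\<^sup>+y. indicator (ball 0 \<delta>) y * ennreal ((cmod (w y))\<^sup>2) \<partial>lborel)"
    using v by (subst ennreal_mult) (auto simp: mult.assoc)
  also have "(1 / ?v)\<^sup>2 * ?v = 1 / ?v" using v by (simp add: power2_eq_square)
  finally show ?thesis .
qed

lemma ball_mean_sq_le_L2:
  fixes w :: "'a::euclidean_space \<Rightarrow> complex"
  assumes [measurable]: "w \<in> borel_measurable borel" and \<delta>: "\<delta> > 0"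
  shows "ennreal ((cmod (complex_of_real (1 / bvol TYPE('a) \<delta>) * (\<integral>y. indicator (ball 0 \<delta>) y * w y \<partial>lborel)))\<^sup>2)
    \<le> ennreal (1 / bvol TYPE('a) \<delta>) * L2sq w"
proof -
  have "(\<integral>\<^sup>+y. indicator (ball 0 \<delta>) y * ennreal ((cmod (w y))\<^sup>2) \<partial>lborel) \<le> L2sq w"
    unfolding L2sq_def by (intro nn_integral_mono) (auto simp: indicator_def)
  then show ?thesis
    by (intro order_trans[OF ball_mean_sq_le[OF assms]] mult_left_mono) auto
qed

lemma bavg_bound:
  fixes u :: "'a::euclidean_space \<Rightarrow> complex"
  assumes [measurable]: "u \<in> borel_measurable borel" and \<delta>: "\<delta> > 0"
  shows "ennreal ((cmod (bavg \<delta> u x))\<^sup>2) \<le> ennreal (1 / bvol TYPE('a) \<delta>) * L2sq u"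
  using ball_mean_sq_le_L2[of "\<lambda>y. u (x + y)" \<delta>] \<delta> by (simp add: bavg_def L2sq_shift)

text \<open>A difference of averages is the average of a difference of translates. Hence
  equicontinuity of a family in L^2 becomes equicontinuity of its averages, uniformly in the
  point.\<close>

lemma bavg_diff_bound:
  fixes u :: "'a::euclidean_space \<Rightarrow> complex"
  assumes [measurable]: "u \<in> borel_measurable borel" and fin: "L2sq u < top" and \<delta>: "\<delta> > 0"
  shows "ennreal ((cmod (bavg \<delta> u x - bavg \<delta> u y))\<^sup>2) \<le> ennreal (1 / bvol TYPE('a) \<delta>) * L2sq (\<lambda>z. u (z + (x - y)) - u z)"
proof -
  have i: "integrable lborel (\<lambda>z. indicator (ball 0 \<delta>) z * u (x + z))" for x
    by (rule integrable_indicator_mult_L2) (use fin in \<open>auto simp: L2sq_shift\<close>)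
  have "bavg \<delta> u x - bavg \<delta> u y = complex_of_real (1 / bvol TYPE('a) \<delta>) *
      (\<integral>z. indicator (ball 0 \<delta>) z * (u (x + z) - u (y + z)) \<partial>lborel)"
    unfolding bavg_def right_diff_distrib[symmetric]
    by (subst Bochner_Integration.integral_diff[OF i i, symmetric]) (simp add: right_diff_distrib)
  moreover have "L2sq (\<lambda>z. u (x + z) - u (y + z)) = L2sq (\<lambda>z. u (z + (x - y)) - u z)"
    using L2sq_shift[of "\<lambda>z. u (z + (x - y)) - u z" y] by (simp add: algebra_simps)
  ultimately show ?thesis
    using ball_mean_sq_le_L2[of "\<lambda>z. u (x + z) - u (y + z)" \<delta>] \<delta> by simp
qed

text \<open>\<open>u x - bavg \<delta> u x\<close> is the mean of \<open>u x - u (x + y)\<close>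
  over short shifts \<open>y\<close>; Jensen and Tonelli reduce its norm to those of the single
  shifts.\<close>

lemma bavg_approx:
  fixes u :: "'a::euclidean_space \<Rightarrow> complex"
  assumes [measurable]: "u \<in> borel_measurable borel" and fin: "L2sq u < top" and \<delta>: "\<delta> > 0"
    and e: "\<And>y. norm y < \<delta> \<Longrightarrow> L2sq (\<lambda>x. u (x + y) - u x) \<le> ennreal e"
  shows "L2sq (\<lambda>x. u x - bavg \<delta> u x) \<le> ennreal e"
proof -
  let ?v = "bvol TYPE('a) \<delta>"
  have v: "?v > 0" by (rule bvol_pos[OF \<delta>])
  have pt: "ennreal ((cmod (u x - bavg \<delta> u x))\<^sup>2)
      \<le> ennreal (1 / ?v) * (\<integral>\<^sup>+y. indicator (ball 0 \<delta>) y * ennreal ((cmod (u x - u (x + y)))\<^sup>2) \<partial>lborel)" for x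
  proof -
    have i: "integrable lborel (\<lambda>z. indicator (ball 0 \<delta>) z * u (x + z))"
      by (rule integrable_indicator_mult_L2) (use fin in \<open>auto simp: L2sq_shift\<close>)
    have ib: "integrable lborel (\<lambda>z::'a. indicator (ball 0 \<delta>) z :: real)"
      by (rule integrable_real_indicator) (use emeasure_lborel_ball_finite[of "0::'a" \<delta>] in auto)
    have ind: "(indicator (ball 0 \<delta>) z :: complex) = complex_of_real (indicator (ball 0 \<delta>) z)" for z :: 'a
      by (simp add: indicator_def)
    have i1: "integrable lborel (\<lambda>z::'a. indicator (ball 0 \<delta>) z :: complex)"
      unfolding ind using ib by (rule integrable_of_real)
    have i2: "integrable lborel (\<lambda>z::'a. indicator (ball 0 \<delta>) z * u x)"
      by (rule integrable_mult_left[OF i1])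
    have "(\<integral>z. (indicator (ball 0 \<delta>) z :: complex) \<partial>(lborel::'a measure)) = complex_of_real ?v"
      unfolding ind integral_complex_of_real by (simp add: bvol_def)
    then have "u x = complex_of_real (1 / ?v) * (\<integral>z. indicator (ball 0 \<delta>) z * u x \<partial>(lborel::'a measure))"
      using v by simp
    then have "u x - bavg \<delta> u x = complex_of_real (1 / ?v) * (\<integral>y. indicator (ball 0 \<delta>) y * (u x - u (x + y)) \<partial>lborel)"
      unfolding bavg_def right_diff_distrib by (subst Bochner_Integration.integral_diff[OF i2 i]) (simp add: right_diff_distrib)
    then show ?thesis using ball_mean_sq_le[of "\<lambda>y. u x - u (x + y)" \<delta>] \<delta> by simp
  qed
  have "L2sq (\<lambda>x. u x - bavg \<delta> u x) \<le>
      (\<integral>\<^sup>+x. ennreal (1 / ?v) * (\<integral>\<^sup>+y. indicator (ball 0 \<delta>) y * ennreal ((cmod (u x - u (x + y)))\<^sup>2) \<partial>lborel) \<partial>lborel)"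
    unfolding L2sq_def by (intro nn_integral_mono pt)
  also have "\<dots> = ennreal (1 / ?v) * (\<integral>\<^sup>+x. (\<integral>\<^sup>+y. indicator (ball 0 \<delta>) y * ennreal ((cmod (u x - u (x + y)))\<^sup>2) \<partial>lborel) \<partial>lborel)"
    by (rule nn_integral_cmult) measurable
  also have "(\<integral>\<^sup>+x. (\<integral>\<^sup>+y. indicator (ball 0 \<delta>) y * ennreal ((cmod (u x - u (x + y)))\<^sup>2) \<partial>lborel) \<partial>lborel)
      = (\<integral>\<^sup>+y. (\<integral>\<^sup>+x. indicator (ball 0 \<delta>) y * ennreal ((cmod (u x - u (x + y)))\<^sup>2) \<partial>lborel) \<partial>lborel)"
    by (rule lborel_pair.Fubini') measurable
  also have "\<dots> = (\<integral>\<^sup>+y. indicator (ball 0 \<delta>) y * L2sq (\<lambda>x. u (x + y) - u x) \<partial>lborel)"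
    by (intro nn_integral_cong) (simp add: nn_integral_cmult L2sq_def norm_minus_commute)
  also have "\<dots> \<le> (\<integral>\<^sup>+(y::'a). indicator (ball 0 \<delta>) y * ennreal e \<partial>lborel)"
    by (intro nn_integral_mono) (use e in \<open>auto simp: indicator_def\<close>)
  also have "\<dots> = ennreal ?v * ennreal e"
    using \<delta> by (simp add: nn_integral_multc emeasure_ball_bvol)
  also have "ennreal (1 / ?v) * (ennreal ?v * ennreal e) = ennreal e"
    using v by (simp add: mult.assoc[symmetric] ennreal_mult[symmetric])
  finally show ?thesis by (simp add: mult_left_mono)
qed

lemma L2sq_split_le:
  fixes h :: "'a::euclidean_space \<Rightarrow> complex"
  assumes [measurable]: "h \<in> borel_measurable borel" "A \<in> sets borel"
  shows "L2sq h \<le> 2 * L2sq (\<lambda>x. indicator A x * h x) + 2 * L2sq (\<lambda>x. indicator (- A) x * h x)"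
proof -
  have "L2sq h = L2sq (\<lambda>x. indicator A x * h x + indicator (- A) x * h x)"
    by (intro arg_cong[of _ _ L2sq]) (auto simp: indicator_def)
  also have "\<dots> \<le> 2 * L2sq (\<lambda>x. indicator A x * h x) + 2 * L2sq (\<lambda>x. indicator (- A) x * h x)"
    by (rule L2sq_add_le2) measurable
  finally show ?thesis .
qed

text \<open>Arzela-Ascoli pattern: convergence on a dense set spreads to every point by
  equicontinuity. The bound \<open>?v * (e/4)\<^sup>2\<close> is what \<open>bavg_diff_bound\<close>
  turns into \<open>e/4\<close>.\<close>

lemma bavg_convergent:
  fixes u :: "nat \<Rightarrow> 'a::euclidean_space \<Rightarrow> complex"
  assumes [measurable]: "\<And>n. u n \<in> borel_measurable borel" and fin: "\<And>n. L2sq (u n) < top"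
    and equi: "\<And>e::real. e > 0 \<Longrightarrow> \<exists>d>0. \<forall>n z. norm z < d \<longrightarrow> L2sq (\<lambda>x. u n (x + z) - u n x) \<le> ennreal e"
    and D: "\<And>X::'a set. open X \<Longrightarrow> X \<noteq> {} \<Longrightarrow> \<exists>q\<in>D. q \<in> X"
    and conv: "\<And>q. q \<in> D \<Longrightarrow> convergent (\<lambda>n. bavg \<delta> (u n) q)" and \<delta>: "\<delta> > 0"
  shows "convergent (\<lambda>n. bavg \<delta> (u n) x)"
proof -
  let ?v = "bvol TYPE('a) \<delta>"
  have v: "?v > 0" by (rule bvol_pos[OF \<delta>])
  have "Cauchy (\<lambda>n. bavg \<delta> (u n) x)"
  proof (rule metric_CauchyI)
    fix e :: real assume e: "0 < e"
    obtain d where d: "d > 0" "\<And>n z. norm z < d \<Longrightarrow> L2sq (\<lambda>x. u n (x + z) - u n x) \<le> ennreal (?v * (e/4)\<^sup>2)"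
      using equi[of "?v * (e/4)\<^sup>2"] v e by auto
    obtain q where q: "q \<in> D" "q \<in> ball x d" using D[of "ball x d"] d(1) by auto
    have close: "cmod (bavg \<delta> (u n) x - bavg \<delta> (u n) q) \<le> e/4" for n
    proof -
      have "ennreal ((cmod (bavg \<delta> (u n) x - bavg \<delta> (u n) q))\<^sup>2) \<le> ennreal (1 / ?v) * L2sq (\<lambda>z. u n (z + (x - q)) - u n z)"
        using fin \<delta> by (intro bavg_diff_bound) auto
      also have "\<dots> \<le> ennreal (1 / ?v) * ennreal (?v * (e/4)\<^sup>2)"
        using q by (intro mult_left_mono d(2)) (auto simp: dist_norm)
      also have "\<dots> = ennreal ((e/4)\<^sup>2)"
        using v by (subst ennreal_mult[symmetric]) auto
      finally have "(cmod (bavg \<delta> (u n) x - bavg \<delta> (u n) q))\<^sup>2 \<le> (e/4)\<^sup>2" by simp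
      then show ?thesis by (rule power2_le_imp_le) (use e in simp)
    qed
    have "Cauchy (\<lambda>n. bavg \<delta> (u n) q)" using conv[OF q(1)] by (rule convergent_Cauchy)
    then obtain N where N: "\<And>m n. m \<ge> N \<Longrightarrow> n \<ge> N \<Longrightarrow> dist (bavg \<delta> (u m) q) (bavg \<delta> (u n) q) < e/4"
      using metric_CauchyD[of _ "e/4"] e by (metis divide_pos_pos zero_less_numeral)
    have "dist (bavg \<delta> (u m) x) (bavg \<delta> (u n) x) < e" if "m \<ge> N" "n \<ge> N" for m n
    proof -
      have "dist (bavg \<delta> (u m) x) (bavg \<delta> (u n) x) \<le>
         dist (bavg \<delta> (u m) x) (bavg \<delta> (u m) q) + dist (bavg \<delta> (u m) q) (bavg \<delta> (u n) q) + dist (bavg \<delta> (u n) q) (bavg \<delta> (u n) x)"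
        by (meson add_mono_thms_linordered_semiring(3) dist_triangle order_trans)
      then show ?thesis
        using close[of m] close[of n] N[OF that] e by (simp add: dist_norm norm_minus_commute)
    qed
    then show "\<exists>N. \<forall>m\<ge>N. \<forall>n\<ge>N. dist (bavg \<delta> (u m) x) (bavg \<delta> (u n) x) < e" by blast
  qed
  then show ?thesis by (rule Cauchy_convergent)
qed

text \<open>Averages of an L^2 bounded family are uniformly bounded by \<open>K\<close>, so on a
  bounded set pointwise convergence is dominated.\<close>

lemma bavg_local_limit:
  fixes u :: "nat \<Rightarrow> 'a::euclidean_space \<Rightarrow> complex"
  assumes [measurable]: "\<And>n. u n \<in> borel_measurable borel" and B: "\<And>n. L2sq (u n) \<le> ennreal B" "B \<ge> 0" and \<delta>: "\<delta> > 0"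
    and lim: "\<And>x. (\<lambda>n. bavg \<delta> (u n) x) \<longlonglongrightarrow> h x" and [measurable]: "h \<in> borel_measurable borel"
  shows "(\<lambda>n. L2sq (\<lambda>x. indicator (ball 0 R) x * (bavg \<delta> (u n) x - h x))) \<longlonglongrightarrow> 0"
proof -
  let ?v = "bvol TYPE('a) \<delta>"
  have v: "?v > 0" by (rule bvol_pos[OF \<delta>])
  define K where "K = sqrt (B / ?v)"
  have K0: "K \<ge> 0" using B v by (simp add: K_def)
  have K: "cmod (bavg \<delta> (u n) x) \<le> K" for n x
  proof -
    have "ennreal ((cmod (bavg \<delta> (u n) x))\<^sup>2) \<le> ennreal (1 / ?v) * ennreal B"
      by (intro order_trans[OF bavg_bound] mult_left_mono B) (use \<delta> in auto)
    also have "\<dots> = ennreal (B / ?v)" using v B by (subst ennreal_mult[symmetric]) auto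
    finally have "(cmod (bavg \<delta> (u n) x))\<^sup>2 \<le> B / ?v" using v B by (simp add: ennreal_le_iff)
    then show ?thesis unfolding K_def by (rule real_le_rsqrt)
  qed
  have hK: "cmod (h x) \<le> K" for x
    using K by (intro LIMSEQ_le_const2[OF tendsto_norm[OF lim]]) auto
  have bd: "cmod (bavg \<delta> (u n) x - h x) \<le> 2 * K" for n x
    using norm_triangle_ineq4[of "bavg \<delta> (u n) x" "h x"] K[of n x] hK[of x] by linarith
  have "(\<lambda>n. \<integral>\<^sup>+x. ennreal ((cmod (indicator (ball 0 R) x * (bavg \<delta> (u n) x - h x)))\<^sup>2) \<partial>lborel) \<longlonglongrightarrow> (\<integral>\<^sup>+(x::'a). 0 \<partial>lborel)"
  proof (rule nn_integral_dominated_convergence[where w="\<lambda>x. ennreal ((2 * K)\<^sup>2) * indicator (ball 0 R) x"])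
    show "(\<integral>\<^sup>+(x::'a). ennreal ((2 * K)\<^sup>2) * indicator (ball 0 R) x \<partial>lborel) < \<infinity>"
      using emeasure_lborel_ball_finite[of "0::'a" R] by (simp add: nn_integral_cmult ennreal_mult_less_top)
    show "AE x in lborel. (\<lambda>n. ennreal ((cmod (indicator (ball 0 R) x * (bavg \<delta> (u n) x - h x)))\<^sup>2)) \<longlonglongrightarrow> 0"
    proof (rule AE_I2)
      fix x :: 'a
      have "(\<lambda>n. (cmod (indicator (ball 0 R) x * (bavg \<delta> (u n) x - h x)))\<^sup>2) \<longlonglongrightarrow> (cmod (indicator (ball 0 R) x * (h x - h x)))\<^sup>2"
        by (intro tendsto_intros lim)
      then show "(\<lambda>n. ennreal ((cmod (indicator (ball 0 R) x * (bavg \<delta> (u n) x - h x)))\<^sup>2)) \<longlonglongrightarrow> 0"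
        using tendsto_ennrealI by fastforce
    qed
    show "AE x in lborel. ennreal ((cmod (indicator (ball 0 R) x * (bavg \<delta> (u n) x - h x)))\<^sup>2) \<le> ennreal ((2 * K)\<^sup>2) * indicator (ball 0 R) x" for n
    proof (rule AE_I2)
      fix x :: 'a
      have "(cmod (bavg \<delta> (u n) x - h x))\<^sup>2 \<le> (2 * K)\<^sup>2" by (intro power_mono bd) simp
      then show "ennreal ((cmod (indicator (ball 0 R) x * (bavg \<delta> (u n) x - h x)))\<^sup>2) \<le> ennreal ((2 * K)\<^sup>2) * indicator (ball 0 R) x"
        by (simp add: indicator_def)
    qed
  qed measurable
  then show ?thesis by (simp add: L2sq_def)
qed

lemma mult_two_ennreal: "e \<ge> 0 \<Longrightarrow> 2 * ennreal e = ennreal (2 * e)"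
  by (simp add: ennreal_mult)

text \<open>A variant of the Kolmogorov--Riesz criterion: tightness is only required of the ball averages.\<close>
theorem L2_compactness:
  fixes u :: "nat \<Rightarrow> 'a::euclidean_space \<Rightarrow> complex"
  assumes [measurable]: "\<And>n. u n \<in> borel_measurable borel" and B: "\<And>n. L2sq (u n) \<le> ennreal B" "B \<ge> 0"
    and equi: "\<And>e::real. e > 0 \<Longrightarrow> \<exists>d>0. \<forall>n z. norm z < d \<longrightarrow> L2sq (\<lambda>x. u n (x + z) - u n x) \<le> ennreal e"
    and tight: "\<And>\<delta> e::real. 0 < \<delta> \<Longrightarrow> \<delta> \<le> 1 \<Longrightarrow> e > 0 \<Longrightarrow>
       \<exists>R. \<forall>n. L2sq (\<lambda>x. indicator (- ball 0 R) x * bavg \<delta> (u n) x) \<le> ennreal e"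
  obtains s :: "nat \<Rightarrow> nat" where "strict_mono s" "\<And>e::real. e > 0 \<Longrightarrow> \<exists>N. \<forall>m\<ge>N. \<forall>n\<ge>N. L2sq (\<lambda>x. u (s m) x - u (s n) x) \<le> ennreal e"
proof -
  have fin: "L2sq (u n) < top" for n using B(1)[of n] by (rule le_less_trans) simp
  define \<delta> where "\<delta> k = 1 / real (Suc k)" for k
  have \<delta>: "\<delta> k > 0" "\<delta> k \<le> 1" for k by (auto simp: \<delta>_def)
  obtain D :: "'a set" where D: "countable D" "\<And>X. open X \<Longrightarrow> X \<noteq> {} \<Longrightarrow> \<exists>d\<in>D. d \<in> X"
    using countable_dense_exists by blast
  let ?v = "\<lambda>k. bvol TYPE('a) (\<delta> k)"
  have v: "?v k > 0" for k by (rule bvol_pos[OF \<delta>(1)])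
  \<comment> \<open>The bound on averages degenerates as the ball shrinks; the factor
    \<open>sqrt (?v (fst p))\<close> restores one bound \<open>sqrt B\<close> for all radii, so that
    a single diagonal extraction over pairs of a radius and a dense point works.\<close>
  define f where "f n p = complex_of_real (sqrt (?v (fst p))) * bavg (\<delta> (fst p)) (u n) (snd p)" for n p
  have bd: "norm (f n p) \<le> sqrt B" for n p
  proof -
    obtain k q where p: "p = (k, q)" by (cases p)
    have "ennreal ((cmod (bavg (\<delta> k) (u n) q))\<^sup>2) \<le> ennreal (1 / ?v k) * ennreal B"
      by (intro order_trans[OF bavg_bound] mult_left_mono B) (use \<delta> in auto)
    also have "\<dots> = ennreal (B / ?v k)" using v[of k] B by (subst ennreal_mult[symmetric]) auto
    finally have "(cmod (bavg (\<delta> k) (u n) q))\<^sup>2 \<le> B / ?v k" using v[of k] B by (simp add: ennreal_le_iff)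
    then have "(norm (f n p))\<^sup>2 \<le> B"
      using v[of k] by (simp add: f_def p norm_mult power_mult_distrib field_simps)
    then show ?thesis by (rule real_le_rsqrt)
  qed
  have cD: "countable ((UNIV :: nat set) \<times> D)" using D(1) by simp
  obtain s where s: "strict_mono s" "\<And>p. p \<in> UNIV \<times> D \<Longrightarrow> \<exists>l. (\<lambda>n. f (s n) p) \<longlonglongrightarrow> l"
    using function_convergent_subsequence[OF cD, of f "sqrt B", OF bd] by metis
  have convD: "convergent (\<lambda>n. bavg (\<delta> k) (u (s n)) q)" if q: "q \<in> D" for k q
  proof -
    obtain l where "(\<lambda>n. f (s n) (k, q)) \<longlonglongrightarrow> l" using s(2)[of "(k, q)"] q by auto
    then have "(\<lambda>n. complex_of_real (1 / sqrt (?v k)) * f (s n) (k, q)) \<longlonglongrightarrow> complex_of_real (1 / sqrt (?v k)) * l"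
      by (intro tendsto_mult tendsto_const)
    moreover have "complex_of_real (1 / sqrt (?v k)) * f (s n) (k, q) = bavg (\<delta> k) (u (s n)) q" for n
      using v[of k] by (simp add: f_def)
    ultimately show ?thesis by (auto simp: convergent_def)
  qed
  have conv: "convergent (\<lambda>n. bavg (\<delta> k) (u (s n)) x)" for k x
  proof (rule bavg_convergent[where D=D])
    show "\<exists>d>0. \<forall>n z. norm z < d \<longrightarrow> L2sq (\<lambda>x. u (s n) (x + z) - u (s n) x) \<le> ennreal e" if "e > 0" for e :: real
      using equi[OF that] by blast
  qed (use fin D convD \<delta> in auto)
  have "\<exists>N. \<forall>m\<ge>N. \<forall>n\<ge>N. L2sq (\<lambda>x. u (s m) x - u (s n) x) \<le> ennreal e" if e: "e > 0" for e :: real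
  proof -
    \<comment> \<open>The triangle inequalities below each lose a factor 2; the losses add up to
      \<open>70 * a\<close>, which is below \<open>e\<close>.\<close>
    define a where "a = e / 100"
    have a: "a > 0" using e by (simp add: a_def)
    obtain d where d: "d > 0" "\<And>n z. norm z < d \<Longrightarrow> L2sq (\<lambda>x. u n (x + z) - u n x) \<le> ennreal a"
      using equi[OF a] by auto
    obtain k where k: "\<delta> k < d" using d(1) nat_approx_posE unfolding \<delta>_def by blast
    define h where "h n = bavg (\<delta> k) (u (s n))" for n
    have [measurable]: "h n \<in> borel_measurable borel" for n unfolding h_def by measurable
    have uh: "L2sq (\<lambda>x. u (s n) x - h n x) \<le> ennreal a" for n
      unfolding h_def using fin \<delta> k by (intro bavg_approx) (auto intro!: d(2))
    obtain R where R: "\<And>n. L2sq (\<lambda>x. indicator (- ball 0 R) x * h n x) \<le> ennreal a"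
      using tight[OF \<delta> a, of k] unfolding h_def by blast
    define H where "H x = lim (\<lambda>n. h n x)" for x
    have [measurable]: "H \<in> borel_measurable borel" unfolding H_def by measurable
    have "(\<lambda>n. h n x) \<longlonglongrightarrow> H x" for x
      using conv[of k x] by (simp add: H_def h_def convergent_LIMSEQ_iff)
    then have "(\<lambda>n. L2sq (\<lambda>x. indicator (ball 0 R) x * (h n x - H x))) \<longlonglongrightarrow> 0"
      unfolding h_def using B \<delta> by (intro bavg_local_limit[where B=B]) auto
    then have "\<forall>\<^sub>F n in sequentially. L2sq (\<lambda>x. indicator (ball 0 R) x * (h n x - H x)) < ennreal a"
      using a by (intro order_tendstoD) auto
    then obtain N where N: "\<And>n. n \<ge> N \<Longrightarrow> L2sq (\<lambda>x. indicator (ball 0 R) x * (h n x - H x)) \<le> ennreal a"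
      by (auto simp: eventually_sequentially dest: less_imp_le)
    have "L2sq (\<lambda>x. u (s m) x - u (s n) x) \<le> ennreal e" if mn: "m \<ge> N" "n \<ge> N" for m n
    proof -
      have 1: "L2sq (\<lambda>x. indicator (ball 0 R) x * (h m x - h n x)) \<le> ennreal (4 * a)"
      proof -
        have "L2sq (\<lambda>x. indicator (ball 0 R) x * (h m x - h n x))
            = L2sq (\<lambda>x. indicator (ball 0 R) x * (h m x - H x) - indicator (ball 0 R) x * (h n x - H x))"
          by (simp add: algebra_simps)
        also have "\<dots> \<le> 2 * L2sq (\<lambda>x. indicator (ball 0 R) x * (h m x - H x)) + 2 * L2sq (\<lambda>x. indicator (ball 0 R) x * (h n x - H x))"
          by (rule L2sq_diff_le) measurable
        also have "\<dots> \<le> 2 * ennreal a + 2 * ennreal a" using N mn by (intro add_mono mult_left_mono) auto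
        also have "\<dots> = ennreal (4 * a)" using a by (simp add: mult_two_ennreal ennreal_plus[symmetric] del: ennreal_plus)
        finally show ?thesis .
      qed
      have 2: "L2sq (\<lambda>x. indicator (- ball 0 R) x * (h m x - h n x)) \<le> ennreal (4 * a)"
      proof -
        have "L2sq (\<lambda>x. indicator (- ball 0 R) x * (h m x - h n x))
            = L2sq (\<lambda>x. indicator (- ball 0 R) x * h m x - indicator (- ball 0 R) x * h n x)"
          by (simp add: algebra_simps)
        also have "\<dots> \<le> 2 * L2sq (\<lambda>x. indicator (- ball 0 R) x * h m x) + 2 * L2sq (\<lambda>x. indicator (- ball 0 R) x * h n x)"
          by (rule L2sq_diff_le) measurable
        also have "\<dots> \<le> 2 * ennreal a + 2 * ennreal a" using R by (intro add_mono mult_left_mono) auto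
        also have "\<dots> = ennreal (4 * a)" using a by (simp add: mult_two_ennreal ennreal_plus[symmetric] del: ennreal_plus)
        finally show ?thesis .
      qed
      have "L2sq (\<lambda>x. h m x - h n x) \<le> 2 * ennreal (4 * a) + 2 * ennreal (4 * a)"
        by (rule order_trans[OF L2sq_split_le[of _ "ball 0 R"]]) (use 1 2 in \<open>auto intro!: add_mono mult_left_mono\<close>)
      also have "\<dots> = ennreal (16 * a)" using a by (simp add: mult_two_ennreal ennreal_plus[symmetric] del: ennreal_plus)
      finally have hh: "L2sq (\<lambda>x. h m x - h n x) \<le> ennreal (16 * a)" .
      have "L2sq (\<lambda>x. h m x - u (s n) x) \<le> 2 * L2sq (\<lambda>x. h m x - h n x) + 2 * L2sq (\<lambda>x. h n x - u (s n) x)"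
        by (rule L2sq_diff_triangle) auto
      also have "\<dots> \<le> 2 * ennreal (16 * a) + 2 * ennreal a"
        using hh uh[of n] by (intro add_mono mult_left_mono) (auto simp: L2sq_minus_commute[of "h n"])
      also have "\<dots> = ennreal (34 * a)" using a by (simp add: mult_two_ennreal ennreal_plus[symmetric] del: ennreal_plus)
      finally have hu: "L2sq (\<lambda>x. h m x - u (s n) x) \<le> ennreal (34 * a)" .
      have "L2sq (\<lambda>x. u (s m) x - u (s n) x) \<le> 2 * L2sq (\<lambda>x. u (s m) x - h m x) + 2 * L2sq (\<lambda>x. h m x - u (s n) x)"
        by (rule L2sq_diff_triangle) auto
      also have "\<dots> \<le> 2 * ennreal a + 2 * ennreal (34 * a)"
        using uh[of m] hu by (intro add_mono mult_left_mono) auto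
      also have "\<dots> = ennreal (70 * a)" using a by (simp add: mult_two_ennreal ennreal_plus[symmetric] del: ennreal_plus)
      also have "\<dots> \<le> ennreal e" using e by (intro ennreal_leI) (simp add: a_def)
      finally show ?thesis .
    qed
    then show ?thesis by blast
  qed
  note cau = this
  show ?thesis by (rule that[OF s(1)], rule cau)
qed

section \<open>Decay of ball averages of radial functions\<close>

text \<open>The ball is written through \<open>dist\<close>, which makes the integrand jointly
  measurable in \<open>x\<close> and \<open>y\<close>, as Tonelli requires.\<close>

definition mass :: "('a::euclidean_space \<Rightarrow> complex) \<Rightarrow> 'a \<Rightarrow> real \<Rightarrow> ennreal" where
  "mass u x \<rho> = (\<integral>\<^sup>+y. indicator {..<\<rho>} (dist x y) * ennreal (cmod (u y)) \<partial>lborel)"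

lemma mass_measurable [measurable]:
  assumes [measurable]: "u \<in> borel_measurable borel"
  shows "(\<lambda>x. mass u x \<rho>) \<in> borel_measurable borel"
  unfolding mass_def by measurable

lemma mass_mono: "dist x x' + \<rho> \<le> \<rho>' \<Longrightarrow> mass u x \<rho> \<le> mass u x' \<rho>'"
  unfolding mass_def
proof (intro nn_integral_mono mult_right_mono)
  fix y assume "dist x x' + \<rho> \<le> \<rho>'"
  then show "(indicator {..<\<rho>} (dist x y) :: ennreal) \<le> indicator {..<\<rho>'} (dist x' y)"
    using dist_triangle3[of x' y x] by (auto simp: indicator_def dist_commute)
qed simp

lemma mass_orthogonal:
  fixes u :: "'a::euclidean_space \<Rightarrow> complex"
  assumes [measurable]: "u \<in> borel_measurable borel" and U: "orthogonal_transformation U"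
    and inv: "AE y in lborel. u (U y) = u y"
  shows "mass u (U x) \<rho> = mass u x \<rho>"
proof -
  interpret U: lborel_preserving U by (rule lborel_preserving_orthogonal[OF U])
  have d: "dist (U x) (U y) = dist x y" for y
    using U by (simp add: dist_norm linear_diff[OF orthogonal_transformation_linear[OF U], symmetric] orthogonal_transformation)
  have "mass u (U x) \<rho> = (\<integral>\<^sup>+y. indicator {..<\<rho>} (dist (U x) (U y)) * ennreal (cmod (u (U y))) \<partial>lborel)"
    unfolding mass_def by (rule U.nn_integral[symmetric]) measurable
  also have "\<dots> = mass u x \<rho>"
    unfolding mass_def d by (rule nn_integral_cong_AE) (use inv in \<open>auto elim: eventually_mono\<close>)
  finally show ?thesis .
qed

text \<open>Tonelli: a point \<open>y\<close> contributes only for centres in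
  \<open>ball y \<rho>\<close>, a set of fixed volume, and lies within \<open>R + \<rho>\<close> of
  the origin.\<close>

lemma nn_integral_mass_le:
  fixes u :: "'a::euclidean_space \<Rightarrow> complex"
  assumes [measurable]: "u \<in> borel_measurable borel" "A \<in> sets borel" and A: "A \<subseteq> ball 0 R" and \<rho>: "\<rho> \<ge> 0"
  shows "(\<integral>\<^sup>+x. indicator A x * mass u x \<rho> \<partial>lborel) \<le> ennreal (bvol TYPE('a) \<rho>) * mass u 0 (R + \<rho>)"
proof -
  have "(\<integral>\<^sup>+x. indicator A x * mass u x \<rho> \<partial>lborel)
      = (\<integral>\<^sup>+x. (\<integral>\<^sup>+y. indicator A x * (indicator {..<\<rho>} (dist x y) * ennreal (cmod (u y))) \<partial>lborel) \<partial>lborel)"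
    unfolding mass_def by (subst nn_integral_cmult) auto
  also have "\<dots> = (\<integral>\<^sup>+y. (\<integral>\<^sup>+x. indicator A x * (indicator {..<\<rho>} (dist x y) * ennreal (cmod (u y))) \<partial>lborel) \<partial>lborel)"
    by (rule lborel_pair.Fubini') measurable
  also have "\<dots> \<le> (\<integral>\<^sup>+y. (\<integral>\<^sup>+x. indicator (ball y \<rho>) x * (indicator {..<R + \<rho>} (dist 0 y) * ennreal (cmod (u y))) \<partial>lborel) \<partial>lborel)"
  proof (intro nn_integral_mono)
    fix x y :: 'a
    have "dist 0 y < R + \<rho>" if "x \<in> A" "dist x y < \<rho>"
      using that A dist_triangle[of 0 y x] by (auto simp: subset_eq)
    then show "indicator A x * (indicator {..<\<rho>} (dist x y) * ennreal (cmod (u y)))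
        \<le> indicator (ball y \<rho>) x * (indicator {..<R + \<rho>} (dist 0 y) * ennreal (cmod (u y)))"
      by (auto simp: indicator_def dist_commute)
  qed
  also have "\<dots> = (\<integral>\<^sup>+y. ennreal (bvol TYPE('a) \<rho>) * (indicator {..<R + \<rho>} (dist 0 y) * ennreal (cmod (u y))) \<partial>lborel)"
    using \<rho> by (intro nn_integral_cong) (simp add: nn_integral_multc emeasure_ball_bvol)
  also have "\<dots> = ennreal (bvol TYPE('a) \<rho>) * mass u 0 (R + \<rho>)"
    unfolding mass_def by (rule nn_integral_cmult) measurable
  finally show ?thesis .
qed

text \<open>With d the dimension, this is \<open>R ^ (d - 1) + R ^ d \<le> (R + 1) ^ d\<close>. It
  supplies the surface factor by which the mass of a unit ball is divided.\<close>

lemma shell_volume: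
  assumes "R > 0"
  shows "ennreal (bvol TYPE('a) 1 * R ^ (DIM('a) - 1)) \<le> emeasure lborel (ball 0 (R + 1) - cball (0::'a::euclidean_space) R)"
proof -
  let ?d = "DIM('a)"
  have "emeasure lborel (ball 0 (R + 1) - cball (0::'a) R) = emeasure lborel (ball (0::'a) (R + 1)) - emeasure lborel (cball (0::'a) R)"
    using assms by (intro emeasure_Diff) (auto simp: emeasure_cball)
  also have "\<dots> = ennreal (bvol TYPE('a) 1 * (R + 1) ^ ?d - bvol TYPE('a) 1 * R ^ ?d)"
    using assms by (simp add: emeasure_ball emeasure_cball bvol_eq ennreal_minus)
  finally have eq: "emeasure lborel (ball 0 (R + 1) - cball (0::'a) R) = \<dots>" .
  have "R ^ (?d - 1) + R ^ ?d \<le> (R + 1) ^ ?d"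
  proof -
    have "R ^ (?d - 1) + R ^ ?d = (R + 1) * R ^ (?d - 1)"
      by (simp add: power_eq_if[of R ?d] algebra_simps)
    also have "\<dots> \<le> (R + 1) * (R + 1) ^ (?d - 1)"
      using assms by (intro mult_left_mono power_mono) auto
    also have "\<dots> = (R + 1) ^ ?d" by (simp add: power_eq_if[of "R + 1" ?d])
    finally show ?thesis .
  qed
  then have "bvol TYPE('a) 1 * (R ^ (?d - 1) + R ^ ?d) \<le> bvol TYPE('a) 1 * (R + 1) ^ ?d"
    by (intro mult_left_mono) (auto simp: bvol_eq)
  then show ?thesis unfolding eq by (intro ennreal_leI) (simp add: algebra_simps)
qed

text \<open>By rotation invariance all unit balls centred on the sphere of radius \<open>R\<close> carry the same mass, and there is
  room for about \<open>R^(d-1)\<close> disjoint ones; the packing argument is replaced by averaging over a shell.\<close>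
lemma mass_unit_ball_radial:
  fixes u :: "real^'d \<Rightarrow> complex"
  assumes [measurable]: "u \<in> borel_measurable borel"
    and inv: "\<And>U. orthogonal_transformation U \<Longrightarrow> AE y in lborel. u (U y) = u y"
    and x: "x \<noteq> 0"
  shows "mass u x 1 * ennreal (bvol TYPE(real^'d) 1 * norm x ^ (CARD('d) - 1)) \<le> ennreal (bvol TYPE(real^'d) 2) * mass u 0 (norm x + 3)"
proof -
  define R where "R = norm x"
  have R: "R > 0" using x by (simp add: R_def)
  let ?A = "ball 0 (R + 1) - cball 0 R :: (real^'d) set"
  \<comment> \<open>Rotate \<open>x\<close> onto the ray through \<open>z\<close>; it then lies at
    distance less than 1 from \<open>z\<close>, so radius 2 around \<open>z\<close> covers the
    rotated unit ball. The outer shell radius \<open>R + 1\<close> plus 2 gives the 3 in the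
    conclusion.\<close>
  have le: "mass u x 1 \<le> mass u z 2" if z: "z \<in> ?A" for z
  proof -
    have nz: "R < norm z" "norm z < R + 1" using z by auto
    then have z0: "z \<noteq> 0" using R by auto
    have "norm x = norm ((R / norm z) *\<^sub>R z)" using R z0 by (simp add: R_def)
    then obtain U where U: "orthogonal_transformation U" "U x = (R / norm z) *\<^sub>R z"
      using orthogonal_transformation_exists by blast
    have "dist (U x) z = norm z - R"
    proof -
      have "(R / norm z) *\<^sub>R z - z = (R / norm z - 1) *\<^sub>R z" by (simp add: algebra_simps)
      then have "dist (U x) z = \<bar>R / norm z - 1\<bar> * norm z" by (simp add: dist_norm U(2))
      also have "\<bar>R / norm z - 1\<bar> = 1 - R / norm z"
      proof -
        have "R / norm z < 1" using nz z0 by (simp add: divide_less_eq)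
        then show ?thesis by simp
      qed
      also have "(1 - R / norm z) * norm z = norm z - R" using z0 by (simp add: algebra_simps)
      finally show ?thesis .
    qed
    then have "mass u (U x) 1 \<le> mass u z 2" using nz by (intro mass_mono) simp
    then show ?thesis using mass_orthogonal[OF _ U(1) inv[OF U(1)]] by simp
  qed
  have "mass u x 1 * ennreal (bvol TYPE(real^'d) 1 * R ^ (DIM(real^'d) - 1)) \<le> mass u x 1 * emeasure lborel ?A"
    using R by (intro mult_left_mono shell_volume) auto
  also have "\<dots> = (\<integral>\<^sup>+z. indicator ?A z * mass u x 1 \<partial>lborel)"
    by (subst nn_integral_multc) (auto simp: mult.commute intro!: borel_measurable_indicator)
  also have "\<dots> \<le> (\<integral>\<^sup>+z. indicator ?A z * mass u z 2 \<partial>lborel)"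
    using le by (intro nn_integral_mono) (auto simp: indicator_def)
  also have "\<dots> \<le> ennreal (bvol TYPE(real^'d) 2) * mass u 0 (R + 1 + 2)"
    by (rule nn_integral_mass_le) auto
  finally show ?thesis by (simp add: R_def add.commute)
qed

lemma bavg_le_mass:
  fixes u :: "'a::euclidean_space \<Rightarrow> complex"
  assumes [measurable]: "u \<in> borel_measurable borel" and \<delta>: "0 < \<delta>" "\<delta> \<le> 1"
  shows "ennreal (cmod (bavg \<delta> u x)) \<le> ennreal (1 / bvol TYPE('a) \<delta>) * mass u x 1"
proof -
  have v: "bvol TYPE('a) \<delta> > 0" by (rule bvol_pos[OF \<delta>(1)])
  have "ennreal (cmod (\<integral>y. indicator (ball 0 \<delta>) y * u (x + y) \<partial>lborel)) \<le> (\<integral>\<^sup>+y. ennreal (cmod (indicator (ball 0 \<delta>) y * u (x + y))) \<partial>lborel)"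
    by (cases "integrable lborel (\<lambda>y. indicator (ball 0 \<delta>) y * u (x + y))")
       (auto simp: not_integrable_integral_eq intro: integral_norm_bound_ennreal)
  also have "\<dots> \<le> (\<integral>\<^sup>+y. indicator {..<1} (dist x (y + x)) * ennreal (cmod (u (y + x))) \<partial>lborel)"
    using \<delta> by (intro nn_integral_mono) (auto simp: indicator_def dist_norm add.commute)
  also have "\<dots> = mass u x 1"
    unfolding mass_def by (rule lborel_preserving.nn_integral[OF lborel_preserving_translate]) measurable
  finally have "ennreal (1 / bvol TYPE('a) \<delta>) * ennreal (cmod (\<integral>y. indicator (ball 0 \<delta>) y * u (x + y) \<partial>lborel))
     \<le> ennreal (1 / bvol TYPE('a) \<delta>) * mass u x 1" by (rule mult_left_mono) simp
  moreover have "ennreal (cmod (bavg \<delta> u x)) = ennreal (1 / bvol TYPE('a) \<delta>) * ennreal (cmod (\<integral>y. indicator (ball 0 \<delta>) y * u (x + y) \<partial>lborel))"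
    using v unfolding bavg_def by (subst ennreal_mult[symmetric]) (auto simp: norm_mult norm_divide)
  ultimately show ?thesis by simp
qed

text \<open>In the squared average one factor is bounded by the constant \<open>K\<close> from
  \<open>mass_unit_ball_radial\<close>; the other is kept and integrated over the shell by
  \<open>nn_integral_mass_le\<close>. The two contribute the powers a + 1 - d and a of
  \<rho>.\<close>

lemma bavg_shell_bound:
  fixes u :: "real^'d \<Rightarrow> complex"
  assumes [measurable]: "u \<in> borel_measurable borel"
    and inv: "\<And>U. orthogonal_transformation U \<Longrightarrow> AE y in lborel. u (U y) = u y"
    and M: "\<And>\<rho>. \<rho> \<ge> 1 \<Longrightarrow> mass u 0 \<rho> \<le> ennreal (A * \<rho> powr a)" and A: "A \<ge> 0" and a: "a \<ge> 0"
    and \<delta>: "0 < \<delta>" "\<delta> \<le> 1" and \<rho>: "\<rho> \<ge> 1"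
  shows "(\<integral>\<^sup>+x. indicator {\<rho>..<2 * \<rho>} (norm x) * ennreal ((cmod (bavg \<delta> u x))\<^sup>2) \<partial>lborel)
    \<le> ennreal ((1 / bvol TYPE(real^'d) \<delta>)\<^sup>2 * bvol TYPE(real^'d) 2 * 15 powr a * A\<^sup>2 * \<rho> powr (1 - real CARD('d) + 2 * a))"
proof -
  let ?v = "bvol TYPE(real^'d)"
  let ?d = "real CARD('d)"
  have v: "?v \<delta> > 0" "?v 1 > 0" "?v 2 > 0" using \<delta> by (auto intro: bvol_pos)
  \<comment> \<open>The 5 comes from \<open>norm x + 3 \<le> 5 * \<rho>\<close> on the shell, where
    \<open>\<rho> \<ge> 1\<close>. The integrated factor uses
    \<open>2 * \<rho> + 1 \<le> 3 * \<rho>\<close>; together they give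
    \<open>15 powr a\<close>.\<close>
  define K where "K = ?v 2 / ?v 1 * (A * (5 * \<rho>) powr a) * \<rho> powr (1 - ?d)"
  have K0: "K \<ge> 0" using v A by (auto simp: K_def)
  have mK: "mass u x 1 \<le> ennreal K" if x: "\<rho> \<le> norm x" "norm x < 2 * \<rho>" for x
  proof -
    have x0: "x \<noteq> 0" using x \<rho> by auto
    have p: "norm x ^ (CARD('d) - 1) = norm x powr (?d - 1)"
      using x0 by (simp add: powr_realpow[symmetric] of_nat_diff Suc_leI)
    have pp: "?v 1 * norm x powr (?d - 1) > 0" using v x0 by simp
    have "mass u x 1 * ennreal (?v 1 * norm x powr (?d - 1)) \<le> ennreal (?v 2) * mass u 0 (norm x + 3)"
      using mass_unit_ball_radial[OF assms(1) inv x0] unfolding p .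
    also have "\<dots> \<le> ennreal (?v 2) * ennreal (A * (norm x + 3) powr a)"
      by (intro mult_left_mono M) auto
    also have "\<dots> \<le> ennreal (?v 2) * ennreal (A * (5 * \<rho>) powr a)"
      using x \<rho> A a by (intro mult_left_mono ennreal_leI powr_mono2) auto
    also have "\<dots> = ennreal (?v 2 * (A * (5 * \<rho>) powr a))"
      using v A by (subst ennreal_mult[symmetric]) auto
    finally have "mass u x 1 * ennreal (?v 1 * norm x powr (?d - 1)) * ennreal (1 / (?v 1 * norm x powr (?d - 1)))
        \<le> ennreal (?v 2 * (A * (5 * \<rho>) powr a)) * ennreal (1 / (?v 1 * norm x powr (?d - 1)))"
      by (rule mult_right_mono) simp
    also have "mass u x 1 * ennreal (?v 1 * norm x powr (?d - 1)) * ennreal (1 / (?v 1 * norm x powr (?d - 1))) = mass u x 1"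
      using pp v x0 by (simp add: mult.assoc ennreal_mult[symmetric])
    also have "ennreal (?v 2 * (A * (5 * \<rho>) powr a)) * ennreal (1 / (?v 1 * norm x powr (?d - 1)))
        = ennreal (?v 2 / ?v 1 * (A * (5 * \<rho>) powr a) * norm x powr (1 - ?d))"
      using v A x0 by (subst ennreal_mult[symmetric]) (auto simp: powr_diff)
    also have "\<dots> \<le> ennreal K"
      unfolding K_def using v A x \<rho> by (intro ennreal_leI mult_left_mono powr_mono2') auto
    finally show ?thesis .
  qed
  have "(\<integral>\<^sup>+x. indicator {\<rho>..<2 * \<rho>} (norm x) * ennreal ((cmod (bavg \<delta> u x))\<^sup>2) \<partial>lborel)
      \<le> (\<integral>\<^sup>+x. ennreal ((1 / ?v \<delta>)\<^sup>2 * K) * (indicator {x. norm x \<in> {\<rho>..<2 * \<rho>}} x * mass u x 1) \<partial>lborel)"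
  proof (rule nn_integral_mono)
    fix x :: "real^'d"
    show "indicator {\<rho>..<2 * \<rho>} (norm x) * ennreal ((cmod (bavg \<delta> u x))\<^sup>2)
        \<le> ennreal ((1 / ?v \<delta>)\<^sup>2 * K) * (indicator {x. norm x \<in> {\<rho>..<2 * \<rho>}} x * mass u x 1)"
    proof (cases "norm x \<in> {\<rho>..<2 * \<rho>}")
      case True
      have "ennreal ((cmod (bavg \<delta> u x))\<^sup>2) = ennreal (cmod (bavg \<delta> u x)) * ennreal (cmod (bavg \<delta> u x))"
        by (simp add: ennreal_mult power2_eq_square)
      also have "\<dots> \<le> (ennreal (1 / ?v \<delta>) * ennreal K) * (ennreal (1 / ?v \<delta>) * mass u x 1)"
        using True mK[of x] bavg_le_mass[OF assms(1) \<delta>, of x]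
        by (intro mult_mono order_trans[OF bavg_le_mass[OF assms(1) \<delta>]] mult_left_mono) auto
      also have "\<dots> = ennreal ((1 / ?v \<delta>)\<^sup>2 * K) * mass u x 1"
      proof -
        have "ennreal ((1 / ?v \<delta>)\<^sup>2 * K) = ennreal (1 / ?v \<delta>) * ennreal (1 / ?v \<delta>) * ennreal K"
          using v K0 by (simp add: ennreal_mult[symmetric] power2_eq_square)
        then show ?thesis by (simp only: mult_ac)
      qed
      finally show ?thesis using True by simp
    qed (auto simp: indicator_def)
  qed
  also have "\<dots> = ennreal ((1 / ?v \<delta>)\<^sup>2 * K) * (\<integral>\<^sup>+x. indicator {x. norm x \<in> {\<rho>..<2 * \<rho>}} x * mass u x 1 \<partial>lborel)"
    by (rule nn_integral_cmult) measurable
  also have "\<dots> \<le> ennreal ((1 / ?v \<delta>)\<^sup>2 * K) * (ennreal (?v 1) * mass u 0 (2 * \<rho> + 1))"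
    by (intro mult_left_mono nn_integral_mass_le) auto
  also have "\<dots> \<le> ennreal ((1 / ?v \<delta>)\<^sup>2 * K) * (ennreal (?v 1) * ennreal (A * (3 * \<rho>) powr a))"
    using \<rho> A a by (intro mult_left_mono order_trans[OF M] ennreal_leI powr_mono2) auto
  also have "\<dots> = ennreal ((1 / ?v \<delta>)\<^sup>2 * K * (?v 1 * (A * (3 * \<rho>) powr a)))"
    using v A K0 by (simp add: ennreal_mult[symmetric])
  also have "(1 / ?v \<delta>)\<^sup>2 * K * (?v 1 * (A * (3 * \<rho>) powr a))
      = (1 / ?v \<delta>)\<^sup>2 * ?v 2 * 15 powr a * A\<^sup>2 * \<rho> powr (1 - ?d + 2 * a)"
  proof -
    have 1: "(5 * \<rho>) powr a * (3 * \<rho>) powr a = 15 powr a * (\<rho> powr a * \<rho> powr a)"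
      using \<rho> by (simp add: powr_mult[symmetric])
    have 2: "\<rho> powr a * \<rho> powr a * \<rho> powr (1 - ?d) = \<rho> powr (1 - ?d + 2 * a)"
      by (simp add: powr_add[symmetric] algebra_simps)
    have "(1 / ?v \<delta>)\<^sup>2 * K * (?v 1 * (A * (3 * \<rho>) powr a))
       = (1 / ?v \<delta>)\<^sup>2 * ?v 2 * A\<^sup>2 * ((5 * \<rho>) powr a * (3 * \<rho>) powr a) * \<rho> powr (1 - ?d)"
      using v by (simp add: K_def power2_eq_square)
    then show ?thesis unfolding 1 2[symmetric] by (simp only: mult_ac)
  qed
  finally show ?thesis .
qed

text \<open>Dyadic shells from \<open>R\<close> outwards; the shell bounds form a geometric series
  with ratio \<open>2 powr \<beta>\<close>. For a = d/2 - r one has \<beta> = 1 - 2 r, so the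
  hypothesis \<open>neg\<close> becomes r > 1/2.\<close>

lemma bavg_tail_bound:
  fixes u :: "real^'d \<Rightarrow> complex"
  assumes [measurable]: "u \<in> borel_measurable borel"
    and inv: "\<And>U. orthogonal_transformation U \<Longrightarrow> AE y in lborel. u (U y) = u y"
    and M: "\<And>\<rho>. \<rho> \<ge> 1 \<Longrightarrow> mass u 0 \<rho> \<le> ennreal (A * \<rho> powr a)" and A: "A \<ge> 0" and a: "a \<ge> 0"
    and \<delta>: "0 < \<delta>" "\<delta> \<le> 1" and R: "R \<ge> 1" and neg: "1 - real CARD('d) + 2 * a < 0"
  shows "L2sq (\<lambda>x. indicator (- ball 0 R) x * bavg \<delta> u x)
    \<le> ennreal ((1 / bvol TYPE(real^'d) \<delta>)\<^sup>2 * bvol TYPE(real^'d) 2 * 15 powr a * A\<^sup>2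
        / (1 - 2 powr (1 - real CARD('d) + 2 * a)) * R powr (1 - real CARD('d) + 2 * a))"
proof -
  let ?v = "bvol TYPE(real^'d)"
  define \<beta> where "\<beta> = 1 - real CARD('d) + 2 * a"
  define C where "C = (1 / ?v \<delta>)\<^sup>2 * ?v 2 * 15 powr a * A\<^sup>2"
  have C: "C \<ge> 0" using bvol_pos[of 2, where 'a="real^'d"] by (simp add: C_def)
  have \<beta>: "\<beta> < 0" using neg by (simp add: \<beta>_def)
  have q: "0 < 2 powr \<beta>" "2 powr \<beta> < 1" using \<beta> powr_less_mono[of \<beta> 0 2] by auto
  have pt: "ennreal ((cmod (indicator (- ball 0 R) x * bavg \<delta> u x))\<^sup>2)
     \<le> (\<Sum>j. indicator {2^j * R..<2 * (2^j * R)} (norm x) * ennreal ((cmod (bavg \<delta> u x))\<^sup>2))" for x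
  proof (cases "norm x < R")
    case True
    then show ?thesis by (simp add: indicator_def)
  next
    case False
    obtain n where "norm x / R < 2 ^ n" using real_arch_pow[of 2 "norm x / R"] by auto
    then have ex: "norm x < 2 ^ n * R" using R by (simp add: field_simps)
    \<comment> \<open>The least exponent is not 0 because \<open>norm x\<close> is at least
      \<open>R\<close>, so \<open>x\<close> lies in the shell with index
      \<open>m - 1\<close>.\<close>
    define m where "m = (LEAST n. norm x < 2 ^ n * R)"
    have m: "norm x < 2 ^ m * R" unfolding m_def by (rule LeastI[of _ n]) (rule ex)
    have "m \<noteq> 0" using m False by (cases m) auto
    then obtain j where j: "m = Suc j" by (cases m) auto
    have "\<not> norm x < 2 ^ j * R" using not_less_Least[of j "\<lambda>n. norm x < 2 ^ n * R"] j by (simp add: m_def)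
    then have "norm x \<in> {2^j * R..<2 * (2^j * R)}" using m j by auto
    then have "ennreal ((cmod (indicator (- ball 0 R) x * bavg \<delta> u x))\<^sup>2)
        = (\<Sum>i\<in>{j}. indicator {2^i * R..<2 * (2^i * R)} (norm x) * ennreal ((cmod (bavg \<delta> u x))\<^sup>2))"
      using False by (simp add: indicator_def)
    also have "\<dots> \<le> (\<Sum>i. indicator {2^i * R..<2 * (2^i * R)} (norm x) * ennreal ((cmod (bavg \<delta> u x))\<^sup>2))"
      by (rule sum_le_suminf) auto
    finally show ?thesis .
  qed
  have "L2sq (\<lambda>x. indicator (- ball 0 R) x * bavg \<delta> u x)
      \<le> (\<integral>\<^sup>+x. (\<Sum>j. indicator {2^j * R..<2 * (2^j * R)} (norm x) * ennreal ((cmod (bavg \<delta> u x))\<^sup>2)) \<partial>lborel)"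
    unfolding L2sq_def by (intro nn_integral_mono pt)
  also have "\<dots> = (\<Sum>j. \<integral>\<^sup>+x. indicator {2^j * R..<2 * (2^j * R)} (norm x) * ennreal ((cmod (bavg \<delta> u x))\<^sup>2) \<partial>lborel)"
    by (rule nn_integral_suminf) measurable
  also have "\<dots> \<le> (\<Sum>j. ennreal (C * R powr \<beta> * (2 powr \<beta>) ^ j))"
  proof (intro suminf_le allI)
    fix j
    have "2^j * R \<ge> 1 * 1" using R by (intro mult_mono) auto
    then have "(\<integral>\<^sup>+x. indicator {2^j * R..<2 * (2^j * R)} (norm x) * ennreal ((cmod (bavg \<delta> u x))\<^sup>2) \<partial>lborel)
        \<le> ennreal (C * (2^j * R) powr \<beta>)"
      unfolding C_def \<beta>_def by (intro bavg_shell_bound M A a \<delta> inv) auto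
    also have "(2^j * R) powr \<beta> = R powr \<beta> * (2 powr \<beta>) ^ j"
      using R by (simp add: powr_mult powr_realpow[symmetric] powr_powr powr_power mult.commute)
    finally show "(\<integral>\<^sup>+x. indicator {2^j * R..<2 * (2^j * R)} (norm x) * ennreal ((cmod (bavg \<delta> u x))\<^sup>2) \<partial>lborel)
        \<le> ennreal (C * R powr \<beta> * (2 powr \<beta>) ^ j)" by (simp add: mult.assoc)
  qed auto
  also have "\<dots> = ennreal (\<Sum>j. C * R powr \<beta> * (2 powr \<beta>) ^ j)"
    using C q by (intro suminf_ennreal2) (auto intro!: summable_mult summable_geometric)
  also have "(\<Sum>j. C * R powr \<beta> * (2 powr \<beta>) ^ j) = C * R powr \<beta> * (1 / (1 - 2 powr \<beta>))"
    using q by (subst suminf_mult) (auto intro!: summable_geometric simp: suminf_geometric)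
  finally show ?thesis by (simp add: C_def \<beta>_def)
qed

section \<open>Fourier multipliers and nonnegative functions\<close>

text \<open>As \<open>0 powr s = 0\<close> for every \<open>s\<close>, the result vanishes at the
  origin, even for \<open>s = 0\<close>. Composition is exact, but inversion holds only almost
  everywhere.\<close>

definition fmul :: "real \<Rightarrow> ('a::euclidean_space \<Rightarrow> complex) \<Rightarrow> 'a \<Rightarrow> complex" where
  "fmul s F \<xi> = complex_of_real (norm \<xi> powr s) * F \<xi>"

lemma fmul_measurable [measurable]:
  assumes [measurable]: "F \<in> borel_measurable borel"
  shows "fmul s F \<in> borel_measurable borel"
  unfolding fmul_def by measurable

lemma norm_fmul: "cmod (fmul s F \<xi>) = norm \<xi> powr s * cmod (F \<xi>)"
  by (simp add: fmul_def norm_mult)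

lemma fmul_fmul: "fmul s (fmul t F) = fmul (s + t) F"
  by (auto simp: fmul_def powr_add)

lemma AE_lborel_nonzero: "AE \<xi> in lborel. (\<xi> :: 'a::euclidean_space) \<noteq> 0"
  by (rule AE_lborel_singleton)

lemma fmul_inverse: "AE \<xi> in lborel. fmul (- s) (fmul s F) \<xi> = F \<xi>"
  using AE_lborel_nonzero by eventually_elim (simp add: fmul_fmul fmul_def)

lemma fmul_inverse': "AE \<xi> in lborel. fmul s (fmul (- s) F) \<xi> = F \<xi>"
  using AE_lborel_nonzero by eventually_elim (simp add: fmul_fmul fmul_def)

text \<open>The function \<open>t powr r * exp (- t)\<close> peaks at \<open>t = r\<close>. The
  bound is \<open>ln y \<le> y - 1\<close> at \<open>y = t / r\<close>, giving away a factor
  \<open>exp (- r)\<close>.\<close>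

lemma powr_le_exp:
  fixes r t :: real
  assumes "r > 0" "t \<ge> 0"
  shows "t powr r \<le> r powr r * exp t"
proof (cases "t = 0")
  case False
  then have t: "t > 0" using assms by simp
  have "ln (t / r) \<le> t / r - 1" using t assms by (intro ln_le_minus_one) auto
  then have "r * ln (t / r) \<le> r * (t / r - 1)" using assms by (intro mult_left_mono) auto
  then have "r * ln t \<le> r * ln r + t"
    using t assms by (simp add: ln_div right_diff_distrib)
  then have "exp (r * ln t) \<le> exp (r * ln r + t)" by simp
  then show ?thesis using t assms by (simp add: powr_def exp_add)
qed simp

text \<open>Of the two Gaussian factors in the square, one absorbs the power of
  \<open>norm \<xi>\<close>, using \<open>pi > 1\<close>, and the other is left to be
  integrated.\<close>

lemma powr_gauss_bound:
  fixes \<xi> :: "'a::euclidean_space"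
  assumes "r > 0" "\<rho> > 0"
  shows "(norm \<xi> powr r * gauss (\<rho>\<^sup>2) \<xi>)\<^sup>2 \<le> r powr r * \<rho> powr (- 2 * r) * gauss (\<rho>\<^sup>2) \<xi>"
proof -
  define t where "t = \<rho>\<^sup>2 * (norm \<xi>)\<^sup>2"
  have t: "t \<ge> 0" by (simp add: t_def)
  have "(norm \<xi> powr r)\<^sup>2 = \<rho> powr (- 2 * r) * t powr r"
  proof -
    have "t powr r = (\<rho> powr r * norm \<xi> powr r)\<^sup>2"
      using assms by (simp add: t_def powr_mult power2_eq_square)
    moreover have "\<rho> powr (- 2 * r) * (\<rho> powr r)\<^sup>2 = 1"
      using assms by (simp add: power2_eq_square powr_add[symmetric])
    ultimately show ?thesis by (simp add: power_mult_distrib mult.assoc[symmetric])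
  qed
  moreover have "t powr r * gauss (\<rho>\<^sup>2) \<xi> \<le> r powr r"
  proof -
    have "t powr r * gauss (\<rho>\<^sup>2) \<xi> \<le> r powr r * exp t * gauss (\<rho>\<^sup>2) \<xi>"
      using powr_le_exp[OF assms(1) t] by (intro mult_right_mono) (auto simp: gauss_def)
    also have "\<dots> = r powr r * exp (t - pi * t)"
      by (simp add: gauss_def t_def exp_diff exp_minus field_simps)
    also have "\<dots> \<le> r powr r * 1"
      using pi_gt3 t by (intro mult_left_mono) (auto simp: mult_right_mono[of 1 pi t, simplified] intro: mult_right_mono[of 1 pi t, simplified])
    finally show ?thesis by simp
  qed
  ultimately have "(norm \<xi> powr r)\<^sup>2 * gauss (\<rho>\<^sup>2) \<xi> \<le> \<rho> powr (- 2 * r) * r powr r"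
    by (simp add: mult.assoc mult_left_mono)
  then have "(norm \<xi> powr r)\<^sup>2 * gauss (\<rho>\<^sup>2) \<xi> * gauss (\<rho>\<^sup>2) \<xi> \<le> \<rho> powr (- 2 * r) * r powr r * gauss (\<rho>\<^sup>2) \<xi>"
    by (intro mult_right_mono less_imp_le[OF gauss_pos])
  then show ?thesis by (simp add: power_mult_distrib power2_eq_square mult_ac)
qed

lemma nn_integral_gauss:
  assumes "t > 0"
  shows "(\<integral>\<^sup>+x. ennreal (gauss t x) \<partial>(lborel :: 'a::euclidean_space measure)) = ennreal (t powr (- real DIM('a) / 2))"
  using integrable_gauss[OF assms, where 'a='a] integral_gauss[OF assms, where 'a='a]
  by (subst nn_integral_eq_integral) (auto intro!: AE_I2 less_imp_le[OF gauss_pos])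

lemma L2sq_gauss_fin:
  assumes "t > 0"
  shows "L2sq (\<lambda>x::'a::euclidean_space. complex_of_real (gauss t x)) < top"
proof -
  have "L2sq (\<lambda>x::'a. complex_of_real (gauss t x)) \<le> (\<integral>\<^sup>+x. ennreal (gauss t x) \<partial>(lborel :: 'a measure))"
    unfolding L2sq_def
  proof (intro nn_integral_mono ennreal_leI)
    fix x :: 'a
    have "gauss t x * gauss t x \<le> gauss t x * 1"
      using assms by (intro mult_left_mono gauss_le_1 less_imp_le[OF gauss_pos]) auto
    then show "(cmod (complex_of_real (gauss t x)))\<^sup>2 \<le> gauss t x" by (simp add: power2_eq_square)
  qed
  also have "\<dots> < top" by (simp add: nn_integral_gauss[OF assms])
  finally show ?thesis .
qed

lemma square_powr_half: "(\<rho>::real) > 0 \<Longrightarrow> (\<rho>\<^sup>2) powr (- x / 2) = \<rho> powr - x"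
proof -
  assume "\<rho> > 0"
  then have "\<rho>\<^sup>2 = \<rho> powr 2" by simp
  then show ?thesis by (simp only: powr_powr) simp
qed

lemma L2sq_fmul_gauss:
  assumes "r > 0" "\<rho> > 0"
  shows "L2sq (fmul r (\<lambda>\<xi>::real^'d. complex_of_real (gauss (\<rho>\<^sup>2) \<xi>))) \<le> ennreal (r powr r * \<rho> powr (- 2 * r - real CARD('d)))"
proof -
  have "L2sq (fmul r (\<lambda>\<xi>::real^'d. complex_of_real (gauss (\<rho>\<^sup>2) \<xi>)))
     \<le> (\<integral>\<^sup>+\<xi>. ennreal (r powr r * \<rho> powr (- 2 * r)) * ennreal (gauss (\<rho>\<^sup>2) \<xi>) \<partial>(lborel :: (real^'d) measure))"
    unfolding L2sq_def
  proof (intro nn_integral_mono)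
    fix \<xi> :: "real^'d"
    show "ennreal ((cmod (fmul r (\<lambda>\<xi>. complex_of_real (gauss (\<rho>\<^sup>2) \<xi>)) \<xi>))\<^sup>2) \<le> ennreal (r powr r * \<rho> powr (- 2 * r)) * ennreal (gauss (\<rho>\<^sup>2) \<xi>)"
      using powr_gauss_bound[OF assms, of \<xi>] less_imp_le[OF gauss_pos, of "\<rho>\<^sup>2" \<xi>]
      by (simp add: norm_fmul ennreal_mult[symmetric])
  qed
  also have "\<dots> = ennreal (r powr r * \<rho> powr (- 2 * r)) * ennreal ((\<rho>\<^sup>2) powr (- real CARD('d) / 2))"
    using assms by (subst nn_integral_cmult) (auto simp: nn_integral_gauss)
  also have "(\<rho>\<^sup>2) powr (- real CARD('d) / 2) = \<rho> powr (- real CARD('d))"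
    using assms by (simp only: square_powr_half)
  also have "ennreal (r powr r * \<rho> powr (- 2 * r)) * ennreal (\<rho> powr (- real CARD('d))) = ennreal (r powr r * \<rho> powr (- 2 * r - real CARD('d)))"
    by (subst ennreal_mult[symmetric]) (auto simp: powr_diff powr_minus field_simps)
  finally show ?thesis .
qed

lemma fourier_L1_gauss:
  fixes x :: "real^'d"
  assumes "t > 0"
  shows "fourier_L1 (\<lambda>\<xi>. complex_of_real (gauss t \<xi>)) x = complex_of_real (t powr (- real CARD('d) / 2) * gauss (1/t) x)"
  unfolding fourier_L1_alt using integral_ek_gauss[OF assms, of x] by simp

text \<open>Testing the Fourier transform against a Gaussian of width \<open>\<rho>\<close> bounds the mass in the ball of radius \<open>\<rho>\<close>;
  this is the only place where nonnegativity enters.\<close>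
lemma mass_bound:
  fixes g :: "real^'d \<Rightarrow> complex"
  assumes F: "is_fourier g (fmul r \<Phi>)" and [measurable]: "\<Phi> \<in> borel_measurable borel"
    and \<Phi>: "L2sq \<Phi> \<le> 1" and r: "r > 0" and \<rho>: "\<rho> > 0"
    and pos: "AE x in lborel. g x \<in> \<real> \<and> Re (g x) \<ge> 0"
  shows "mass g 0 \<rho> \<le> ennreal (exp pi * sqrt (r powr r) * \<rho> powr (real CARD('d) / 2 - r))"
proof -
  note [measurable] = is_fourierD(1)[OF F]
  let ?d = "real CARD('d)"
  let ?\<psi> = "\<lambda>\<xi>::real^'d. complex_of_real (gauss (\<rho>\<^sup>2) \<xi>)"
  let ?k = "\<rho> powr - ?d"
  have t: "\<rho>\<^sup>2 > 0" using \<rho> by simp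
  have k: "(\<rho>\<^sup>2) powr (- ?d / 2) = ?k" using \<rho> by (simp only: square_powr_half)
  have int\<psi>: "integrable lborel ?\<psi>" using integrable_gauss[OF t, where 'a="real^'d"] by (simp add: complex_of_real_integrable_eq)
  have F\<psi>: "fourier_L1 ?\<psi> x = complex_of_real (?k * gauss (1/\<rho>\<^sup>2) x)" for x
    using fourier_L1_gauss[OF t, of x] by (simp only: k)
  have form: "(\<integral>\<xi>. fmul r \<Phi> \<xi> * ?\<psi> \<xi> \<partial>lborel) = (\<integral>x. g x * complex_of_real (?k * gauss (1/\<rho>\<^sup>2) x) \<partial>lborel)"
    using is_fourier_formula[OF F int\<psi> L2sq_gauss_fin[OF t]] by (simp only: F\<psi>)
  let ?I = "\<integral>x. cmod (g x) * (?k * gauss (1/\<rho>\<^sup>2) x) \<partial>lborel"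
  \<comment> \<open>There is no cancellation: almost everywhere \<open>g x\<close> equals its
    modulus, so the pairing with the Gaussian controls an L^1 quantity.\<close>
  have "(\<integral>x. g x * complex_of_real (?k * gauss (1/\<rho>\<^sup>2) x) \<partial>lborel) = (\<integral>x. complex_of_real (cmod (g x) * (?k * gauss (1/\<rho>\<^sup>2) x)) \<partial>lborel)"
  proof (rule integral_cong_AE)
    show "AE x in lborel. g x * complex_of_real (?k * gauss (1/\<rho>\<^sup>2) x) = complex_of_real (cmod (g x) * (?k * gauss (1/\<rho>\<^sup>2) x))"
      using pos
    proof eventually_elim
      case (elim x)
      then obtain a where "g x = complex_of_real a" by (auto elim: Reals_cases)
      with elim show ?case by simp
    qed
  qed measurable
  also have "\<dots> = complex_of_real ?I" by (rule integral_complex_of_real)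
  finally have gI: "(\<integral>x. g x * complex_of_real (?k * gauss (1/\<rho>\<^sup>2) x) \<partial>lborel) = complex_of_real ?I" .
  have I0: "?I \<ge> 0" by (intro integral_nonneg_AE AE_I2 mult_nonneg_nonneg less_imp_le[OF gauss_pos]) auto
  \<comment> \<open>The weight \<open>norm \<xi> powr r\<close> is moved from \<open>\<Phi>\<close>
    to the Gaussian, so that only the norm of \<open>\<Phi>\<close> itself enters.\<close>
  have "ennreal ((cmod (\<integral>\<xi>. \<Phi> \<xi> * fmul r ?\<psi> \<xi> \<partial>lborel))\<^sup>2) \<le> L2sq \<Phi> * L2sq (fmul r ?\<psi>)"
    by (rule Cauchy_Schwarz_complex) measurable
  also have "\<dots> \<le> 1 * ennreal (r powr r * \<rho> powr (- 2 * r - ?d))"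
    by (intro mult_mono \<Phi> L2sq_fmul_gauss r \<rho>) auto
  also have "(\<lambda>\<xi>. \<Phi> \<xi> * fmul r ?\<psi> \<xi>) = (\<lambda>\<xi>. fmul r \<Phi> \<xi> * ?\<psi> \<xi>)" by (auto simp: fmul_def)
  finally have "?I\<^sup>2 \<le> r powr r * \<rho> powr (- 2 * r - ?d)"
    unfolding form gI using I0 by (simp add: ennreal_le_iff)
  then have "?I \<le> sqrt (r powr r * \<rho> powr (- 2 * r - ?d))" by (rule real_le_rsqrt)
  also have "\<dots> = sqrt (r powr r) * \<rho> powr (- r - ?d / 2)"
    using \<rho> by (simp add: real_sqrt_mult powr_half_sqrt[symmetric] powr_powr diff_divide_distrib)
  finally have I: "?I \<le> sqrt (r powr r) * \<rho> powr (- r - ?d / 2)" .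
  have intI: "integrable lborel (\<lambda>x. cmod (g x) * (?k * gauss (1/\<rho>\<^sup>2) x))"
  proof -
    have "integrable lborel (\<lambda>x. g x * complex_of_real (gauss (1/\<rho>\<^sup>2) x))"
      using is_fourierD(3)[OF F] L2sq_gauss_fin[of "1/\<rho>\<^sup>2", where 'a="real^'d"] t
      by (intro integrable_mult_L2) auto
    then have "integrable lborel (\<lambda>x. cmod (g x * complex_of_real (gauss (1/\<rho>\<^sup>2) x)))" by (rule integrable_norm)
    then have "integrable lborel (\<lambda>x. ?k * cmod (g x * complex_of_real (gauss (1/\<rho>\<^sup>2) x)))" by (rule integrable_mult_right)
    then show ?thesis by (simp add: norm_mult abs_of_pos[OF gauss_pos] mult_ac)
  qed
  have "mass g 0 \<rho> \<le> (\<integral>\<^sup>+x. ennreal (exp pi * \<rho> powr ?d) * ennreal (cmod (g x) * (?k * gauss (1/\<rho>\<^sup>2) x)) \<partial>lborel)"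
    unfolding mass_def
  proof (rule nn_integral_mono)
    fix x :: "real^'d"
    have kk: "\<rho> powr ?d * ?k = 1" using \<rho> by (simp add: powr_add[symmetric])
    show "indicator {..<\<rho>} (dist 0 x) * ennreal (cmod (g x)) \<le> ennreal (exp pi * \<rho> powr ?d) * ennreal (cmod (g x) * (?k * gauss (1/\<rho>\<^sup>2) x))"
    proof (cases "norm x < \<rho>")
      case True
      \<comment> \<open>On the ball \<open>gauss (1/\<rho>\<^sup>2)\<close> is at least
        \<open>exp (- pi)\<close>; this is the origin of the factor \<open>exp pi\<close>.\<close>
      have "(norm x)\<^sup>2 / \<rho>\<^sup>2 \<le> 1" using True \<rho> by (simp add: power_mono divide_le_eq)
      then have "1 \<le> exp (pi - pi * ((norm x)\<^sup>2 / \<rho>\<^sup>2))" using mult_left_mono[of "(norm x)\<^sup>2 / \<rho>\<^sup>2" 1 pi] by simp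
      also have "\<dots> = exp pi * gauss (1/\<rho>\<^sup>2) x" by (simp add: gauss_def exp_diff exp_minus field_simps)
      finally have "cmod (g x) * 1 \<le> cmod (g x) * (exp pi * gauss (1/\<rho>\<^sup>2) x)" by (rule mult_left_mono) simp
      also have "\<dots> = (\<rho> powr ?d * ?k) * (cmod (g x) * (exp pi * gauss (1/\<rho>\<^sup>2) x))" by (simp only: kk mult_1)
      also have "\<dots> = exp pi * \<rho> powr ?d * (cmod (g x) * (?k * gauss (1/\<rho>\<^sup>2) x))" by (simp only: mult_ac)
      finally show ?thesis using True less_imp_le[OF gauss_pos, of "1/\<rho>\<^sup>2" x] by (simp add: ennreal_mult[symmetric])
    qed simp
  qed
  also have "\<dots> = ennreal (exp pi * \<rho> powr ?d) * ennreal ?I"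
    by (subst nn_integral_cmult, simp, subst nn_integral_eq_integral[OF intI])
       (auto intro!: AE_I2 mult_nonneg_nonneg less_imp_le[OF gauss_pos])
  also have "\<dots> \<le> ennreal (exp pi * \<rho> powr ?d) * ennreal (sqrt (r powr r) * \<rho> powr (- r - ?d / 2))"
    by (intro mult_left_mono ennreal_leI I) auto
  also have "\<dots> = ennreal (exp pi * sqrt (r powr r) * (\<rho> powr ?d * \<rho> powr (- r - ?d / 2)))"
    by (subst ennreal_mult[symmetric]) (auto simp: mult_ac)
  also have "\<rho> powr ?d * \<rho> powr (- r - ?d / 2) = \<rho> powr (?d / 2 - r)"
    by (simp add: powr_add[symmetric])
  finally show ?thesis .
qed

lemma cmod_ek_minus_1: "cmod (ek x \<xi> - 1) \<le> 2 * pi * norm x * norm \<xi>"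
proof -
  have "ek x \<xi> = iexp (- 2 * pi * (x \<bullet> \<xi>))" by (simp add: ek_def mult_ac)
  then have "cmod (ek x \<xi> - 1) \<le> \<bar>- 2 * pi * (x \<bullet> \<xi>)\<bar>"
    using iexp_approx1[of "- 2 * pi * (x \<bullet> \<xi>)" 0] by simp
  also have "\<dots> = 2 * pi * \<bar>x \<bullet> \<xi>\<bar>" by (simp add: abs_mult)
  also have "\<dots> \<le> 2 * pi * (norm x * norm \<xi>)" by (intro mult_left_mono Cauchy_Schwarz_ineq2) auto
  finally show ?thesis by (simp add: mult.assoc)
qed

text \<open>Frequencies are split at \<open>K\<close>: below it \<open>ek (- z) \<xi> - 1\<close>
  has modulus at most \<open>2 * pi * norm z * K\<close>; above it the modulus is at most 2, and
  passing from \<open>G\<close> to \<open>fmul \<sigma> G\<close> gains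
  \<open>K powr - \<sigma>\<close>.\<close>

lemma L2sq_translate_diff_le:
  fixes g :: "real^'d \<Rightarrow> complex"
  assumes F: "is_fourier g G" and G: "L2sq G \<le> 1" "L2sq (fmul \<sigma> G) \<le> 1" and \<sigma>: "\<sigma> > 0" and K: "K > 0"
  shows "L2sq (\<lambda>x. g (x + z) - g x) \<le> ennreal ((2 * pi * norm z * K)\<^sup>2 + 4 * K powr (- 2 * \<sigma>))"
proof -
  note [measurable] = is_fourierD(1,2)[OF F]
  have "L2sq (\<lambda>x. g (x + z) - g x) = L2sq (\<lambda>\<xi>. ek (- z) \<xi> * G \<xi> - G \<xi>)"
    by (rule is_fourier_Plancherel[OF is_fourier_diff[OF is_fourier_translate[OF F] F], symmetric])
  also have "\<dots> \<le> (\<integral>\<^sup>+\<xi>. ennreal ((2 * pi * norm z * K)\<^sup>2) * ennreal ((cmod (G \<xi>))\<^sup>2)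
      + ennreal (4 * K powr (- 2 * \<sigma>)) * ennreal ((cmod (fmul \<sigma> G \<xi>))\<^sup>2) \<partial>lborel)"
    unfolding L2sq_def
  proof (rule nn_integral_mono)
    fix \<xi> :: "real^'d"
    have eq: "(cmod (ek (- z) \<xi> * G \<xi> - G \<xi>))\<^sup>2 = (cmod (ek (- z) \<xi> - 1))\<^sup>2 * (cmod (G \<xi>))\<^sup>2"
      by (simp add: norm_mult[symmetric] power_mult_distrib[symmetric] left_diff_distrib)
    have "(cmod (ek (- z) \<xi> * G \<xi> - G \<xi>))\<^sup>2 \<le> (2 * pi * norm z * K)\<^sup>2 * (cmod (G \<xi>))\<^sup>2 + 4 * K powr (- 2 * \<sigma>) * (cmod (fmul \<sigma> G \<xi>))\<^sup>2"
    proof (cases "norm \<xi> \<le> K")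
      case True
      have "cmod (ek (- z) \<xi> - 1) \<le> 2 * pi * norm z * K"
        by (rule order_trans[OF cmod_ek_minus_1]) (use mult_left_mono[OF True, of "2 * pi * norm z"] in simp)
      then have "(cmod (ek (- z) \<xi> - 1))\<^sup>2 * (cmod (G \<xi>))\<^sup>2 \<le> (2 * pi * norm z * K)\<^sup>2 * (cmod (G \<xi>))\<^sup>2"
        by (intro mult_right_mono power_mono) auto
      then show ?thesis unfolding eq by (simp add: add_increasing2)
    next
      case False
      have "cmod (ek (- z) \<xi> - 1) \<le> 2" using norm_triangle_ineq4[of "ek (- z) \<xi>" 1] by simp
      then have "(cmod (ek (- z) \<xi> - 1))\<^sup>2 \<le> 2\<^sup>2" by (intro power_mono) auto
      then have "(cmod (ek (- z) \<xi> - 1))\<^sup>2 * (cmod (G \<xi>))\<^sup>2 \<le> 4 * (cmod (G \<xi>))\<^sup>2"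
        by (intro mult_right_mono) auto
      also have "\<dots> \<le> 4 * ((K powr - \<sigma> * norm \<xi> powr \<sigma>)\<^sup>2 * (cmod (G \<xi>))\<^sup>2)"
      proof -
        have "K powr \<sigma> \<le> norm \<xi> powr \<sigma>" using False K \<sigma> by (intro powr_mono2) auto
        then have "1 \<le> K powr - \<sigma> * norm \<xi> powr \<sigma>" using K by (simp add: powr_minus field_simps)
        then have "1 \<le> (K powr - \<sigma> * norm \<xi> powr \<sigma>)\<^sup>2" by (simp add: one_le_power)
        then show ?thesis by (simp add: mult_right_mono[of 1 _ "(cmod (G \<xi>))\<^sup>2", simplified])
      qed
      also have "\<dots> = 4 * K powr (- 2 * \<sigma>) * (cmod (fmul \<sigma> G \<xi>))\<^sup>2"
      proof -
        have "(K powr - \<sigma>)\<^sup>2 = K powr (- 2 * \<sigma>)" by (simp add: power2_eq_square powr_add[symmetric])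
        then show ?thesis by (simp add: norm_fmul power_mult_distrib)
      qed
      finally show ?thesis unfolding eq by (simp add: add_increasing)
    qed
    then show "ennreal ((cmod (ek (- z) \<xi> * G \<xi> - G \<xi>))\<^sup>2) \<le> ennreal ((2 * pi * norm z * K)\<^sup>2) * ennreal ((cmod (G \<xi>))\<^sup>2)
      + ennreal (4 * K powr (- 2 * \<sigma>)) * ennreal ((cmod (fmul \<sigma> G \<xi>))\<^sup>2)"
      by (simp add: ennreal_mult[symmetric] ennreal_plus[symmetric] del: ennreal_plus)
  qed
  also have "\<dots> = ennreal ((2 * pi * norm z * K)\<^sup>2) * L2sq G + ennreal (4 * K powr (- 2 * \<sigma>)) * L2sq (fmul \<sigma> G)"
    unfolding L2sq_def by (subst nn_integral_add) (auto simp: nn_integral_cmult)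
  also have "\<dots> \<le> ennreal ((2 * pi * norm z * K)\<^sup>2) * 1 + ennreal (4 * K powr (- 2 * \<sigma>)) * 1"
    by (intro add_mono mult_left_mono G) auto
  also have "\<dots> = ennreal ((2 * pi * norm z * K)\<^sup>2 + 4 * K powr (- 2 * \<sigma>))"
    by (simp add: ennreal_plus[symmetric] del: ennreal_plus)
  finally show ?thesis .
qed

text \<open>First \<open>K\<close> is fixed to make the high frequencies small, then
  \<open>d\<close> is solved from \<open>2 * pi * d * K = sqrt (e/2)\<close>. Neither depends on
  \<open>g\<close>, which gives uniformity along a sequence.\<close>

lemma L2_equicontinuous:
  assumes \<sigma>: "\<sigma> > 0" and e: "(e::real) > 0"
  shows "\<exists>d>0. \<forall>(g :: real^'d \<Rightarrow> complex) G z. is_fourier g G \<longrightarrow> L2sq G \<le> 1 \<longrightarrow> L2sq (fmul \<sigma> G) \<le> 1 \<longrightarrow> norm z < d \<longrightarrow>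
    L2sq (\<lambda>x. g (x + z) - g x) \<le> ennreal e"
proof -
  have "((\<lambda>K::real. 4 * K powr (- 2 * \<sigma>)) \<longlongrightarrow> 4 * 0) at_top"
    using \<sigma> by (intro tendsto_mult tendsto_const tendsto_neg_powr filterlim_ident) auto
  then have "\<forall>\<^sub>F K::real in at_top. 4 * K powr (- 2 * \<sigma>) < e/2" using e by (intro order_tendstoD) auto
  then have "\<forall>\<^sub>F K::real in at_top. 4 * K powr (- 2 * \<sigma>) < e/2 \<and> K > 0"
    using eventually_gt_at_top[of "0::real"] by eventually_elim auto
  then obtain K where K: "4 * K powr (- 2 * \<sigma>) < e/2" "K > 0"
    using eventually_happens'[OF trivial_limit_at_top_linorder] by auto
  define d where "d = sqrt (e/2) / (2 * pi * K)"
  have d: "d > 0" using e K by (simp add: d_def)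
  show ?thesis
  proof (intro exI[of _ d] conjI d allI impI)
    fix g G :: "real^'d \<Rightarrow> complex" and z :: "real^'d"
    assume *: "is_fourier g G" "L2sq G \<le> 1" "L2sq (fmul \<sigma> G) \<le> 1" "norm z < d"
    have "2 * pi * norm z * K \<le> sqrt (e/2)" using *(4) K by (simp add: d_def field_simps)
    then have "(2 * pi * norm z * K)\<^sup>2 \<le> (sqrt (e/2))\<^sup>2" using K by (intro power_mono) auto
    then have "(2 * pi * norm z * K)\<^sup>2 \<le> e/2" using e by simp
    then have "(2 * pi * norm z * K)\<^sup>2 + 4 * K powr (- 2 * \<sigma>) \<le> e" using K by simp
    then show "L2sq (\<lambda>x. g (x + z) - g x) \<le> ennreal e"
      using L2sq_translate_diff_le[OF *(1-3) \<sigma> K(2), of z] by (meson ennreal_leI order_trans)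
  qed
qed

section \<open>Radial representatives\<close>

lemma bavg_orthogonal:
  fixes f :: "'a::euclidean_space \<Rightarrow> complex"
  assumes [measurable]: "f \<in> borel_measurable borel" and U: "orthogonal_transformation U"
    and inv: "AE y in lborel. f (U y) = f y"
  shows "bavg \<delta> f (U x) = bavg \<delta> f x"
proof -
  interpret U: lborel_preserving U by (rule lborel_preserving_orthogonal[OF U])
  have "(\<integral>y. indicator (ball 0 \<delta>) y * f (U x + y) \<partial>lborel) = (\<integral>y. indicator (ball 0 \<delta>) (U y) * f (U x + U y) \<partial>lborel)"
    by (rule U.integral[symmetric]) measurable
  also have "\<dots> = (\<integral>y. indicator (ball 0 \<delta>) y * f (U (y + x)) \<partial>lborel)"
    using U by (intro Bochner_Integration.integral_cong)
      (auto simp: indicator_def orthogonal_transformation linear_add[OF orthogonal_transformation_linear[OF U]] add.commute)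
  also have "\<dots> = (\<integral>y. indicator (ball 0 \<delta>) y * f (y + x) \<partial>lborel)"
    by (rule integral_cong_AE) (use lborel_preserving.AE[OF lborel_preserving_translate inv, of x] in \<open>auto elim: eventually_mono\<close>)
  finally show ?thesis by (simp add: bavg_def add.commute)
qed

text \<open>\<open>radial\<close> speaks of every point, whereas \<open>f\<close> is invariant only
  almost everywhere. Ball averages of \<open>f\<close> are exactly radial, and so is their pointwise
  \<open>lim\<close>, even where there is no convergence, because points of equal norm see the same
  sequence.\<close>

lemma radial_representative:
  fixes f :: "real^'d \<Rightarrow> complex"
  assumes [measurable]: "f \<in> borel_measurable borel" and fin: "L2sq f < top"
    and inv: "\<And>U. orthogonal_transformation U \<Longrightarrow> AE y in lborel. f (U y) = f y"
  obtains f' where "f' \<in> borel_measurable borel" "radial f'" "AE x in lborel. f x = f' x"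
proof -
  define h where "h n = bavg (1 / real (Suc n)) f" for n
  have [measurable]: "h n \<in> borel_measurable borel" for n unfolding h_def by measurable
  have hrad: "h n x = h n y" if xy: "norm x = norm y" for n x y
  proof -
    obtain U where "orthogonal_transformation U" "U x = y"
      using orthogonal_transformation_exists[OF xy] by blast
    then show ?thesis unfolding h_def using bavg_orthogonal[OF assms(1), of U _ x] inv[of U] by simp
  qed
  have approx: "\<exists>N. \<forall>n\<ge>N. L2sq (\<lambda>x. f x - h n x) \<le> ennreal e" if e: "e > 0" for e :: real
  proof -
    obtain d where d: "d > 0" "\<And>z. norm z < d \<Longrightarrow> L2sq (\<lambda>x. f (x + z) - f x) \<le> ennreal e"
      using translation_continuous_L2[OF assms(1) fin e] by auto
    obtain N where N: "1 / real (Suc N) < d" using d(1) nat_approx_posE by blast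
    have "L2sq (\<lambda>x. f x - h n x) \<le> ennreal e" if "n \<ge> N" for n
      unfolding h_def
    proof (rule bavg_approx[OF assms(1) fin])
      fix y :: "real^'d" assume y: "norm y < 1 / real (Suc n)"
      have "1 / real (Suc n) \<le> 1 / real (Suc N)" using that by (simp add: frac_le)
      then show "L2sq (\<lambda>x. f (x + y) - f x) \<le> ennreal e" using y N by (intro d(2)) simp
    qed simp
    then show ?thesis by blast
  qed
  have cau: "\<exists>N. \<forall>m\<ge>N. \<forall>n\<ge>N. L2sq (\<lambda>x. h m x - h n x) \<le> ennreal e" if e: "e > 0" for e :: real
  proof -
    obtain N where N: "\<And>n. n \<ge> N \<Longrightarrow> L2sq (\<lambda>x. f x - h n x) \<le> ennreal (e/4)" using approx[of "e/4"] e by auto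
    have "L2sq (\<lambda>x. h m x - h n x) \<le> ennreal e" if "m \<ge> N" "n \<ge> N" for m n
    proof -
      have "L2sq (\<lambda>x. h m x - h n x) \<le> 2 * L2sq (\<lambda>x. h m x - f x) + 2 * L2sq (\<lambda>x. f x - h n x)"
        by (rule L2sq_diff_triangle) auto
      also have "\<dots> \<le> 2 * ennreal (e/4) + 2 * ennreal (e/4)"
        using N that by (intro add_mono mult_left_mono) (auto simp: L2sq_minus_commute[of "h m"])
      also have "\<dots> = ennreal e" using e by (simp add: mult_two_ennreal ennreal_plus[symmetric] del: ennreal_plus)
      finally show ?thesis .
    qed
    then show ?thesis by blast
  qed
  obtain s where s: "(\<lambda>n. L2sq (\<lambda>x. h n x - lim (\<lambda>k. h (s k) x))) \<longlonglongrightarrow> 0"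
    using L2sq_complete[of h, OF _ cau] by auto
  define f' where "f' x = lim (\<lambda>k. h (s k) x)" for x
  have [measurable]: "f' \<in> borel_measurable borel" unfolding f'_def by measurable
  have rad: "radial f'"
    unfolding radial_def
  proof (intro allI impI)
    fix x y :: "real^'d" assume "norm x = norm y"
    then have "(\<lambda>k. h (s k) x) = (\<lambda>k. h (s k) y)" using hrad[of x y] by blast
    then show "f' x = f' y" by (simp add: f'_def)
  qed
  have ae: "AE x in lborel. f x = f' x"
  proof -
    have small: "L2sq (\<lambda>x. f x - f' x) \<le> ennreal e" if e: "e > 0" for e :: real
    proof -
      obtain N where N: "\<And>n. n \<ge> N \<Longrightarrow> L2sq (\<lambda>x. f x - h n x) \<le> ennreal (e/4)" using approx[of "e/4"] e by auto
      have "\<forall>\<^sub>F n in sequentially. L2sq (\<lambda>x. h n x - f' x) < ennreal (e/4)"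
        using s e unfolding f'_def by (intro order_tendstoD) auto
      then obtain N' where N': "\<And>n. n \<ge> N' \<Longrightarrow> L2sq (\<lambda>x. h n x - f' x) < ennreal (e/4)"
        by (auto simp: eventually_sequentially)
      let ?n = "max N N'"
      have "L2sq (\<lambda>x. f x - f' x) \<le> 2 * L2sq (\<lambda>x. f x - h ?n x) + 2 * L2sq (\<lambda>x. h ?n x - f' x)"
        by (rule L2sq_diff_triangle) auto
      also have "\<dots> \<le> 2 * ennreal (e/4) + 2 * ennreal (e/4)"
        using N[of ?n] N'[of ?n] by (intro add_mono mult_left_mono) auto
      also have "\<dots> = ennreal e" using e by (simp add: mult_two_ennreal ennreal_plus[symmetric] del: ennreal_plus)
      finally show ?thesis .
    qed
    have "L2sq (\<lambda>x. f x - f' x) \<le> 0"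
      by (rule ennreal_le_epsilon) (simp only: add_0 small)
    then have "L2sq (\<lambda>x. f x - f' x) = 0" by simp
    then show ?thesis by (subst (asm) L2sq_eq_0_iff) auto
  qed
  show ?thesis by (rule that[OF _ rad ae]) measurable
qed

text \<open>The transform commutes with \<open>U\<close>; uniqueness of the transform and of its
  inverse carries invariance across in both directions.\<close>

lemma is_fourier_rotation_invariant:
  fixes f :: "real^'d \<Rightarrow> complex"
  assumes "is_fourier f F" "orthogonal_transformation U"
  shows "(AE x in lborel. f (U x) = f x) \<longleftrightarrow> (AE \<xi> in lborel. F (U \<xi>) = F \<xi>)"
proof
  note FU = is_fourier_orthogonal[OF assms]
  note [measurable] = is_fourierD(1,2)[OF assms(1)]
  assume "AE x in lborel. f (U x) = f x"
  then have "is_fourier f (\<lambda>\<xi>. F (U \<xi>))"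
    using is_fourierD[OF FU] by (intro is_fourier_cong_AE[OF FU]) auto
  then show "AE \<xi> in lborel. F (U \<xi>) = F \<xi>" by (rule is_fourier_unique) (rule assms)
next
  assume "AE \<xi> in lborel. F (U \<xi>) = F \<xi>"
  then show "AE x in lborel. f (U x) = f x"
    by (rule is_fourier_unique_inverse[OF is_fourier_orthogonal[OF assms] assms(1)])
qed

section \<open>Strict interpolation\<close>

text \<open>With \<open>w\<close> the weighted mean of \<open>x\<close> and 1, apply
  \<open>ln y \<le> y - 1\<close> at \<open>x / w\<close> and \<open>1 / w\<close>; the weighted
  right sides cancel. The second inequality is strict since \<open>w \<noteq> 1\<close>.\<close>

lemma weighted_AM_GM_strict:
  fixes x \<theta> :: real
  assumes \<theta>: "0 < \<theta>" "\<theta> < 1" and x: "x \<ge> 0" "x \<noteq> 1"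
  shows "x powr \<theta> < 1 - \<theta> + \<theta> * x"
proof (cases "x = 0")
  case False
  then have x0: "x > 0" using x by simp
  define w where "w = 1 - \<theta> + \<theta> * x"
  have w: "w > 0" using \<theta> x0 by (simp add: w_def add_pos_pos)
  have w1: "w \<noteq> 1" using \<theta> x by (simp add: w_def algebra_simps)
  have "\<theta> * ln (x / w) \<le> \<theta> * (x / w - 1)"
    using \<theta> x0 w by (intro mult_left_mono ln_le_minus_one) auto
  moreover have "(1 - \<theta>) * ln (1 / w) < (1 - \<theta>) * (1 / w - 1)"
  proof -
    have "ln (1 / w) \<le> 1 / w - 1" using w by (intro ln_le_minus_one) auto
    moreover have "ln (1 / w) \<noteq> 1 / w - 1" using ln_eq_minus_one[of "1 / w"] w w1 by auto
    ultimately show ?thesis using \<theta> by simp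
  qed
  moreover have "\<theta> * (x / w - 1) + (1 - \<theta>) * (1 / w - 1) = 0"
  proof -
    have "\<theta> * (x / w - 1) + (1 - \<theta>) * (1 / w - 1) = (1 - \<theta> + \<theta> * x) / w - 1"
      by (simp add: field_simps add_divide_distrib diff_divide_distrib)
    also have "\<dots> = 0" using w by (simp add: w_def)
    finally show ?thesis .
  qed
  ultimately have "\<theta> * ln (x / w) + (1 - \<theta>) * ln (1 / w) < 0" by linarith
  then have "\<theta> * ln x < ln w" using x0 w by (simp add: ln_div algebra_simps)
  then have "exp (\<theta> * ln x) < w" using w by (metis exp_less_cancel_iff exp_ln)
  then show ?thesis using x0 by (simp add: powr_def w_def)
qed (use \<theta> in simp)

lemma L2sq_fmul: "L2sq (fmul s F) = (\<integral>\<^sup>+\<xi>. ennreal (norm \<xi> powr (2 * s) * (cmod (F \<xi>))\<^sup>2) \<partial>lborel)"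
  unfolding L2sq_def norm_fmul power_mult_distrib by (simp add: power2_eq_square powr_add[symmetric])

lemma fmul_eq_0_iff: "(AE \<xi> in lborel. fmul s F \<xi> = 0) \<longleftrightarrow> (AE \<xi> in lborel. F \<xi> = 0)"
proof
  assume "AE \<xi> in lborel. fmul s F \<xi> = 0"
  with AE_lborel_nonzero show "AE \<xi> in lborel. F \<xi> = 0" by eventually_elim (auto simp: fmul_def)
next
  assume "AE \<xi> in lborel. F \<xi> = 0"
  then show "AE \<xi> in lborel. fmul s F \<xi> = 0" by eventually_elim (auto simp: fmul_def)
qed

text \<open>A pointwise majorant takes the place of Hoelder's inequality:
  \<open>norm \<xi> powr (2 * r)\<close> lies below a combination of 1 and
  \<open>norm \<xi> powr (2 * S)\<close> that touches it only on the sphere of radius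
  \<open>c\<close>. As a sphere is a null set, strictness survives integration.\<close>

lemma L2sq_interpolation_strict:
  fixes \<Phi> :: "'a::euclidean_space \<Rightarrow> complex"
  assumes [measurable]: "\<Phi> \<in> borel_measurable borel" and nz: "\<not> (AE \<xi> in lborel. \<Phi> \<xi> = 0)"
    and r: "0 < r" "r < S" and a: "L2sq \<Phi> = ennreal a" "a \<ge> 0" and b: "L2sq (fmul S \<Phi>) = ennreal b" "b \<ge> 0"
  shows "a > 0" "b > 0" "L2sq (fmul r \<Phi>) < ennreal (a powr (1 - r/S) * b powr (r/S))" "L2sq (fmul r \<Phi>) > 0"
proof -
  have "L2sq \<Phi> \<noteq> 0" using nz by (subst L2sq_eq_0_iff) auto
  then show a0: "a > 0" using a by (cases "a = 0") auto
  have "L2sq (fmul S \<Phi>) \<noteq> 0" using nz by (subst L2sq_eq_0_iff) (auto simp: fmul_eq_0_iff)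
  then show b0: "b > 0" using b by (cases "b = 0") auto
  have "L2sq (fmul r \<Phi>) \<noteq> 0" using nz by (subst L2sq_eq_0_iff) (auto simp: fmul_eq_0_iff)
  then show "L2sq (fmul r \<Phi>) > 0" by (simp add: zero_less_iff_neq_zero)
  define \<theta> where "\<theta> = r / S"
  have \<theta>: "0 < \<theta>" "\<theta> < 1" using r by (auto simp: \<theta>_def)
  \<comment> \<open>The radius of contact is tuned to \<open>a\<close> and \<open>b\<close>: with
    this \<open>c\<close> the integral of the majorant \<open>P\<close> is exactly the interpolation
    bound.\<close>
  define c where "c = (b / a) powr (1 / (2 * S))"
  have c: "c > 0" using a0 b0 by (simp add: c_def)
  have cS: "c powr (2 * S) = b / a" using a0 b0 r by (simp add: c_def powr_powr)
  have cr: "c powr (2 * r) = (b / a) powr \<theta>" using r by (simp add: c_def powr_powr \<theta>_def)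
  have Y: "norm \<xi> powr (2 * r) < c powr (2 * r) * (1 - \<theta>) + c powr (2 * r) * \<theta> / c powr (2 * S) * norm \<xi> powr (2 * S)"
    if "norm \<xi> \<noteq> c" for \<xi> :: 'a
  proof -
    define x where "x = (norm \<xi> / c) powr (2 * S)"
    have x: "x = norm \<xi> powr (2 * S) / c powr (2 * S)" using c by (simp add: x_def powr_divide)
    have "x \<noteq> 1"
    proof
      assume x1: "x = 1"
      then have "norm \<xi> \<noteq> 0" by (auto simp: x_def)
      then have "2 * S * ln (norm \<xi> / c) = 0" using x1 c by (simp add: x_def powr_def)
      then have "norm \<xi> / c = 1" using r c \<open>norm \<xi> \<noteq> 0\<close> by (simp add: ln_eq_zero_iff)
      then show False using that c by simp
    qed
    then have "x powr \<theta> < 1 - \<theta> + \<theta> * x" using \<theta> by (intro weighted_AM_GM_strict) (auto simp: x_def)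
    moreover have "x powr \<theta> = norm \<xi> powr (2 * r) / c powr (2 * r)"
      using c r by (simp add: x_def powr_powr \<theta>_def powr_divide)
    ultimately have "norm \<xi> powr (2 * r) < c powr (2 * r) * (1 - \<theta> + \<theta> * x)"
      using c by (simp add: divide_less_eq mult.commute)
    then show ?thesis by (simp add: x algebra_simps)
  qed
  define P where "P \<xi> = c powr (2 * r) * (1 - \<theta>) * (cmod (\<Phi> \<xi>))\<^sup>2 +
      c powr (2 * r) * \<theta> / c powr (2 * S) * (norm \<xi> powr (2 * S) * (cmod (\<Phi> \<xi>))\<^sup>2)" for \<xi>
  have [measurable]: "P \<in> borel_measurable borel" unfolding P_def by measurable
  have P0: "P \<xi> \<ge> 0" for \<xi> using \<theta> by (simp add: P_def)
  have Peq: "P \<xi> = (c powr (2 * r) * (1 - \<theta>) + c powr (2 * r) * \<theta> / c powr (2 * S) * norm \<xi> powr (2 * S)) * (cmod (\<Phi> \<xi>))\<^sup>2" for \<xi>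
    by (simp add: P_def algebra_simps)
  have lt: "norm \<xi> powr (2 * r) * (cmod (\<Phi> \<xi>))\<^sup>2 < P \<xi>" if "norm \<xi> \<noteq> c" "\<Phi> \<xi> \<noteq> 0" for \<xi>
    unfolding Peq using Y[OF that(1)] that(2) by (intro mult_strict_right_mono) auto
  have "(sphere 0 c :: 'a set) \<in> null_sets lborel"
    using negligible_sphere[of "0::'a" c] by (auto simp: null_sets_completion_iff negligible_iff_null_sets)
  then have sph: "AE \<xi> in lborel. norm (\<xi>::'a) \<noteq> c"
    by (rule AE_I') auto
  have intP: "(\<integral>\<^sup>+\<xi>. ennreal (P \<xi>) \<partial>lborel) = ennreal (a powr (1 - r/S) * b powr (r/S))"
  proof -
    have "(\<integral>\<^sup>+\<xi>. ennreal (P \<xi>) \<partial>lborel) = (\<integral>\<^sup>+\<xi>. ennreal (c powr (2 * r) * (1 - \<theta>)) * ennreal ((cmod (\<Phi> \<xi>))\<^sup>2)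
        + ennreal (c powr (2 * r) * \<theta> / c powr (2 * S)) * ennreal (norm \<xi> powr (2 * S) * (cmod (\<Phi> \<xi>))\<^sup>2) \<partial>lborel)"
      using \<theta> by (intro nn_integral_cong) (simp add: P_def ennreal_mult[symmetric] ennreal_plus[symmetric] del: ennreal_plus)
    also have "\<dots> = ennreal (c powr (2 * r) * (1 - \<theta>)) * L2sq \<Phi> + ennreal (c powr (2 * r) * \<theta> / c powr (2 * S)) * L2sq (fmul S \<Phi>)"
      unfolding L2sq_fmul unfolding L2sq_def by (subst nn_integral_add) (auto simp: nn_integral_cmult)
    also have "\<dots> = ennreal (c powr (2 * r) * (1 - \<theta>) * a + c powr (2 * r) * \<theta> / c powr (2 * S) * b)"
      using \<theta> a0 b0 unfolding a(1) b(1) by (simp add: ennreal_mult[symmetric] ennreal_plus[symmetric] del: ennreal_plus)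
    also have "c powr (2 * r) * (1 - \<theta>) * a + c powr (2 * r) * \<theta> / c powr (2 * S) * b = c powr (2 * r) * a"
      unfolding cS using a0 b0 by (simp add: field_simps)
    also have "c powr (2 * r) * a = a powr (1 - r/S) * b powr (r/S)"
      unfolding cr \<theta>_def using a0 b0 by (simp add: powr_divide powr_diff)
    finally show ?thesis .
  qed
  have le: "AE \<xi> in lborel. ennreal (norm \<xi> powr (2 * r) * (cmod (\<Phi> \<xi>))\<^sup>2) \<le> ennreal (P \<xi>)"
    using sph
  proof eventually_elim
    case (elim \<xi>)
    then show ?case using lt[of \<xi>] P0[of \<xi>] by (cases "\<Phi> \<xi> = 0") (auto intro!: ennreal_leI)
  qed
  show "L2sq (fmul r \<Phi>) < ennreal (a powr (1 - r/S) * b powr (r/S))"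
    unfolding L2sq_fmul intP[symmetric]
  proof (rule nn_integral_less)
    have "(\<integral>\<^sup>+\<xi>. ennreal (norm \<xi> powr (2 * r) * (cmod (\<Phi> \<xi>))\<^sup>2) \<partial>lborel) \<le> (\<integral>\<^sup>+\<xi>. ennreal (P \<xi>) \<partial>lborel)"
      by (rule nn_integral_mono_AE[OF le])
    then show "(\<integral>\<^sup>+\<xi>. ennreal (norm \<xi> powr (2 * r) * (cmod (\<Phi> \<xi>))\<^sup>2) \<partial>lborel) \<noteq> \<infinity>"
      unfolding intP by (auto simp: top_unique)
    show "\<not> (AE \<xi> in lborel. ennreal (P \<xi>) \<le> ennreal (norm \<xi> powr (2 * r) * (cmod (\<Phi> \<xi>))\<^sup>2))"
    proof
      assume "AE \<xi> in lborel. ennreal (P \<xi>) \<le> ennreal (norm \<xi> powr (2 * r) * (cmod (\<Phi> \<xi>))\<^sup>2)"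
      with sph have "AE \<xi> in lborel. \<Phi> \<xi> = 0"
      proof eventually_elim
        case (elim \<xi>)
        then show ?case using lt[of \<xi>] by (auto simp: ennreal_le_iff)
      qed
      with nz show False ..
    qed
  qed (use le in auto)
qed

section \<open>Admissible triples\<close>

text \<open>\<open>\<phi>\<close> together with its Fourier transform \<open>\<Phi>\<close> and \<open>g = D^r \<phi>\<close>.\<close>
definition admissible :: "real \<Rightarrow> real \<Rightarrow> (real^'d \<Rightarrow> complex) \<Rightarrow> (real^'d \<Rightarrow> complex) \<Rightarrow> (real^'d \<Rightarrow> complex) \<Rightarrow> bool" where
  "admissible r S \<phi> \<Phi> g \<longleftrightarrow> is_fourier \<phi> \<Phi> \<and> radial \<phi> \<and> L2sq (fmul S \<Phi>) < top \<and> is_fourier g (fmul r \<Phi>) \<and>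
     (AE x in lborel. g x \<in> \<real> \<and> Re (g x) \<ge> 0)"

lemma Dfrac_iff: "Dfrac s f g \<longleftrightarrow> (\<exists>F. is_fourier f F \<and> is_fourier g (fmul s F))"
  by (simp add: Dfrac_def fmul_def[abs_def])

lemma L2sq_fmul_cong_AE: "AE \<xi> in lborel. F \<xi> = G \<xi> \<Longrightarrow> L2sq (fmul s F) = L2sq (fmul s G)"
  by (rule L2sq_cong_AE) (auto simp: fmul_def elim: eventually_mono)

text \<open>\<open>Dnorm\<close> measures a chosen fractional derivative. One exists by inversion,
  and the choice is immaterial: transforms agree up to null sets, and Plancherel reads off the
  norm.\<close>

lemma Dnorm_eq:
  fixes f :: "real^'d \<Rightarrow> complex"
  assumes F: "is_fourier f F" and fin: "L2sq (fmul s F) < top"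
  shows "Dnorm s f = sqrt (enn2real (L2sq (fmul s F)))"
proof -
  note [measurable] = is_fourierD(2)[OF F]
  obtain g where "is_fourier g (fmul s F)" using is_fourier_exists_inverse[of "fmul s F"] fin by auto
  then have "Dfrac s f g" using F by (auto simp: Dfrac_iff)
  then have "Dfrac s f (SOME g. Dfrac s f g)" by (rule someI[where P="\<lambda>g. Dfrac s f g"])
  then obtain F' where F': "is_fourier f F'" "is_fourier (SOME g. Dfrac s f g) (fmul s F')" by (auto simp: Dfrac_iff)
  have "L2sq (SOME g. Dfrac s f g) = L2sq (fmul s F')" by (rule is_fourier_Plancherel[OF F'(2), symmetric])
  also have "\<dots> = L2sq (fmul s F)" by (rule L2sq_fmul_cong_AE[OF is_fourier_unique[OF F'(1) F]])
  finally show ?thesis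
    unfolding Dnorm_def using L2norm_eq[OF is_fourierD(1)[OF F'(2)]] by simp
qed

lemma L2norm_fourier:
  assumes "is_fourier f F"
  shows "L2norm f = sqrt (enn2real (L2sq F))"
  using L2norm_eq[OF is_fourierD(1)[OF assms]] is_fourier_Plancherel[OF assms] by simp

text \<open>\<open>sobolev\<close> and \<open>Dfrac\<close> each provide their own transform, and
  uniqueness identifies the two. The inhomogeneous weight dominates
  \<open>norm \<xi> powr S\<close>; conversely its square is at most \<open>2 powr S\<close> times
  the sum of 1 and the square of \<open>norm \<xi> powr S\<close>.\<close>

lemma H_rad_plus_iff:
  fixes \<phi> :: "real^'d \<Rightarrow> complex"
  assumes S: "S > 0"
  shows "H_rad_plus S r \<phi> \<longleftrightarrow> (\<exists>\<Phi> g. admissible r S \<phi> \<Phi> g)"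
proof
  assume H: "H_rad_plus S r \<phi>"
  obtain F where F: "is_fourier \<phi> F" "sq_int (\<lambda>\<xi>. complex_of_real ((1 + (norm \<xi>)\<^sup>2) powr (S/2)) * F \<xi>)"
    using H by (auto simp: H_rad_plus_def sobolev_def)
  obtain g \<Phi> where g: "is_fourier \<phi> \<Phi>" "is_fourier g (fmul r \<Phi>)" "AE x in lborel. g x \<in> \<real> \<and> Re (g x) \<ge> 0"
    using H by (auto simp: H_rad_plus_def Dfrac_iff)
  have "L2sq (fmul S \<Phi>) = L2sq (fmul S F)" by (rule L2sq_fmul_cong_AE[OF is_fourier_unique[OF g(1) F(1)]])
  also have "\<dots> \<le> L2sq (\<lambda>\<xi>. complex_of_real ((1 + (norm \<xi>)\<^sup>2) powr (S/2)) * F \<xi>)"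
  proof (rule L2sq_mono_AE, rule AE_I2)
    fix \<xi> :: "real^'d"
    have "norm \<xi> powr S = ((norm \<xi>)\<^sup>2) powr (S/2)"
      by (cases "\<xi> = 0") (simp_all add: powr_powr flip: powr_numeral)
    also have "\<dots> \<le> (1 + (norm \<xi>)\<^sup>2) powr (S/2)" using S by (intro powr_mono2) auto
    finally show "cmod (fmul S F \<xi>) \<le> cmod (complex_of_real ((1 + (norm \<xi>)\<^sup>2) powr (S/2)) * F \<xi>)"
      by (simp add: norm_fmul norm_mult mult_right_mono)
  qed
  also have "\<dots> < top" using F(2) by (simp add: sq_int_iff)
  finally show "\<exists>\<Phi> g. admissible r S \<phi> \<Phi> g" using g H by (auto simp: admissible_def H_rad_plus_def)
next
  assume "\<exists>\<Phi> g. admissible r S \<phi> \<Phi> g"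
  then obtain \<Phi> g where *: "is_fourier \<phi> \<Phi>" "radial \<phi>" "L2sq (fmul S \<Phi>) < top" "is_fourier g (fmul r \<Phi>)"
     "AE x in lborel. g x \<in> \<real> \<and> Re (g x) \<ge> 0" by (auto simp: admissible_def)
  note [measurable] = is_fourierD(2)[OF *(1)]
  have "L2sq (\<lambda>\<xi>. complex_of_real ((1 + (norm \<xi>)\<^sup>2) powr (S/2)) * \<Phi> \<xi>)
      \<le> (\<integral>\<^sup>+\<xi>. ennreal (2 powr S) * (ennreal ((cmod (\<Phi> \<xi>))\<^sup>2) + ennreal ((cmod (fmul S \<Phi> \<xi>))\<^sup>2)) \<partial>lborel)"
    unfolding L2sq_def
  proof (rule nn_integral_mono)
    fix \<xi> :: "real^'d"
    define t where "t = norm \<xi>"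
    have t: "t \<ge> 0" by (simp add: t_def)
    have "((1 + t\<^sup>2) powr (S/2))\<^sup>2 = (1 + t\<^sup>2) powr S" by (simp add: power2_eq_square powr_add[symmetric])
    also have "\<dots> \<le> 2 powr S * (1 + (t powr S)\<^sup>2)"
    proof (cases "t \<le> 1")
      case True
      then have "t\<^sup>2 \<le> 1" using t by (simp add: power_le_one)
      then have "(1 + t\<^sup>2) powr S \<le> 2 powr S" using S by (intro powr_mono2) auto
      also have "\<dots> \<le> 2 powr S * (1 + (t powr S)\<^sup>2)" by simp
      finally show ?thesis .
    next
      case False
      then have "1 \<le> t\<^sup>2" by (simp add: one_le_power)
      then have "(1 + t\<^sup>2) powr S \<le> (2 * t\<^sup>2) powr S" using S by (intro powr_mono2) auto
      also have "\<dots> = 2 powr S * (t powr S)\<^sup>2" using False by (simp add: powr_mult power2_eq_square)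
      also have "\<dots> \<le> 2 powr S * (1 + (t powr S)\<^sup>2)" by simp
      finally show ?thesis .
    qed
    finally have "((1 + t\<^sup>2) powr (S/2))\<^sup>2 * (cmod (\<Phi> \<xi>))\<^sup>2 \<le> 2 powr S * (1 + (t powr S)\<^sup>2) * (cmod (\<Phi> \<xi>))\<^sup>2"
      by (rule mult_right_mono) simp
    then show "ennreal ((cmod (complex_of_real ((1 + (norm \<xi>)\<^sup>2) powr (S/2)) * \<Phi> \<xi>))\<^sup>2)
        \<le> ennreal (2 powr S) * (ennreal ((cmod (\<Phi> \<xi>))\<^sup>2) + ennreal ((cmod (fmul S \<Phi> \<xi>))\<^sup>2))"
      by (simp add: norm_fmul norm_mult power_mult_distrib t_def algebra_simps ennreal_mult[symmetric] ennreal_plus[symmetric] del: ennreal_plus)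
  qed
  also have "\<dots> = ennreal (2 powr S) * (L2sq \<Phi> + L2sq (fmul S \<Phi>))"
    unfolding L2sq_def by (simp add: nn_integral_cmult nn_integral_add)
  also have "\<dots> < top" using *(3) is_fourierD(4)[OF *(1)] by (simp add: ennreal_mult_less_top)
  finally have "sobolev S \<phi>"
    unfolding sobolev_def sq_int_iff using *(1) by (intro exI[of _ \<Phi>]) auto
  then show "H_rad_plus S r \<phi>" using * by (auto simp: H_rad_plus_def Dfrac_iff)
qed

lemma GN_ratio_eq:
  assumes "admissible r S \<phi> \<Phi> g"
  shows "GN_ratio r S \<phi> = sqrt (enn2real (L2sq (fmul r \<Phi>))) /
    (sqrt (enn2real (L2sq \<Phi>)) powr (1 - r/S) * sqrt (enn2real (L2sq (fmul S \<Phi>))) powr (r/S))"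
proof -
  have F: "is_fourier \<phi> \<Phi>" "L2sq (fmul S \<Phi>) < top" "is_fourier g (fmul r \<Phi>)" using assms by (auto simp: admissible_def)
  show ?thesis unfolding GN_ratio_def
    using Dnorm_eq[OF F(1) is_fourierD(4)[OF F(3)]] Dnorm_eq[OF F(1,2)] L2norm_fourier[OF F(1)] by simp
qed

lemma is_fourier_AE_zero_iff:
  assumes "is_fourier f F"
  shows "(AE x in lborel. f x = 0) \<longleftrightarrow> (AE \<xi> in lborel. F \<xi> = 0)"
  using is_fourier_Plancherel[OF assms] is_fourierD[OF assms] L2sq_eq_0_iff[of f] L2sq_eq_0_iff[of F] by simp

text \<open>For a single function the interpolation inequality is strict. This bounds the supremum
  only by 1; strictness for the supremum will come from a maximiser.\<close>

lemma GN_ratio_bounds: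
  assumes adm: "admissible r S \<phi> \<Phi> g" and r: "0 < r" "r < S" and nz: "\<not> (AE x in lborel. \<phi> x = 0)"
  shows "0 < GN_ratio r S \<phi>" "GN_ratio r S \<phi> < 1"
proof -
  have F: "is_fourier \<phi> \<Phi>" "L2sq (fmul S \<Phi>) < top" "is_fourier g (fmul r \<Phi>)" using adm by (auto simp: admissible_def)
  note [measurable] = is_fourierD(2)[OF F(1)]
  have nz': "\<not> (AE \<xi> in lborel. \<Phi> \<xi> = 0)" using nz is_fourier_AE_zero_iff[OF F(1)] by simp
  obtain a where a: "L2sq \<Phi> = ennreal a" "a \<ge> 0" using is_fourierD(4)[OF F(1)] by (cases "L2sq \<Phi>") auto
  obtain b where b: "L2sq (fmul S \<Phi>) = ennreal b" "b \<ge> 0" using F(2) by (cases "L2sq (fmul S \<Phi>)") auto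
  obtain m where m: "L2sq (fmul r \<Phi>) = ennreal m" "m \<ge> 0" using is_fourierD(4)[OF F(3)] by (cases "L2sq (fmul r \<Phi>)") auto
  note I = L2sq_interpolation_strict[OF _ nz' r a b]
  have ab: "a > 0" "b > 0" "m > 0" "m < a powr (1 - r/S) * b powr (r/S)"
    using I m by (auto simp: ennreal_less_iff)
  have R: "GN_ratio r S \<phi> = sqrt m / (sqrt a powr (1 - r/S) * sqrt b powr (r/S))"
    using a b m by (simp add: GN_ratio_eq[OF adm])
  show "0 < GN_ratio r S \<phi>" unfolding R using ab by simp
  have "sqrt m < sqrt (a powr (1 - r/S) * b powr (r/S))" using ab by simp
  also have "\<dots> = sqrt a powr (1 - r/S) * sqrt b powr (r/S)"
    using ab by (simp add: real_sqrt_mult powr_half_sqrt[symmetric] powr_powr mult.commute)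
  finally show "GN_ratio r S \<phi> < 1" unfolding R using ab by (simp add: divide_less_eq)
qed

section \<open>Dilations\<close>

lemma L2sq_fmul_0: "L2sq (fmul 0 F) = L2sq F"
proof (rule L2sq_cong_AE)
  show "AE \<xi> in lborel. fmul 0 F \<xi> = F \<xi>"
    using AE_lborel_nonzero by eventually_elim (simp add: fmul_def)
qed

text \<open>The multiplier and the amplitude contribute \<open>2 * (s - d)\<close> to the exponent
  of \<open>c\<close>, the change of variables contributes d.\<close>

lemma L2sq_fmul_dilate:
  fixes \<Phi> :: "real^'d \<Rightarrow> complex"
  assumes [measurable]: "\<Phi> \<in> borel_measurable borel" and c: "c > 0" and k: "k > 0"
  shows "L2sq (fmul s (\<lambda>\<xi>. complex_of_real k * (complex_of_real (c powr - real CARD('d)) * \<Phi> ((1/c) *\<^sub>R \<xi>))))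
    = ennreal (k\<^sup>2 * c powr (2 * s - real CARD('d))) * L2sq (fmul s \<Phi>)"
proof -
  let ?d = "real CARD('d)"
  have "fmul s (\<lambda>\<xi>. complex_of_real k * (complex_of_real (c powr - ?d) * \<Phi> ((1/c) *\<^sub>R \<xi>)))
      = (\<lambda>\<xi>. complex_of_real (k * c powr (s - ?d)) * fmul s \<Phi> ((1/c) *\<^sub>R \<xi>))"
  proof
    fix \<xi> :: "real^'d"
    have "c powr - ?d * norm \<xi> powr s = c powr (s - ?d) * norm ((1/c) *\<^sub>R \<xi>) powr s"
      using c by (simp add: powr_divide powr_diff powr_minus field_simps)
    then have "complex_of_real (c powr - ?d) * complex_of_real (norm \<xi> powr s)
       = complex_of_real (c powr (s - ?d)) * complex_of_real (norm ((1/c) *\<^sub>R \<xi>) powr s)"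
      by (metis of_real_mult)
    then show "fmul s (\<lambda>\<xi>. complex_of_real k * (complex_of_real (c powr - ?d) * \<Phi> ((1/c) *\<^sub>R \<xi>))) \<xi>
       = complex_of_real (k * c powr (s - ?d)) * fmul s \<Phi> ((1/c) *\<^sub>R \<xi>)"
      by (simp add: fmul_def mult_ac)
  qed
  then have "L2sq (fmul s (\<lambda>\<xi>. complex_of_real k * (complex_of_real (c powr - ?d) * \<Phi> ((1/c) *\<^sub>R \<xi>))))
      = ennreal ((k * c powr (s - ?d))\<^sup>2) * L2sq (\<lambda>\<xi>. fmul s \<Phi> ((1/c) *\<^sub>R \<xi>))"
    using k by (simp add: L2sq_cmult norm_mult)
  also have "L2sq (\<lambda>\<xi>. fmul s \<Phi> ((1/c) *\<^sub>R \<xi>)) = ennreal ((1/c) powr - real DIM(real^'d)) * L2sq (fmul s \<Phi>)"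
    using c by (intro L2sq_scale) auto
  also have "ennreal ((k * c powr (s - ?d))\<^sup>2) * (ennreal ((1/c) powr - real DIM(real^'d)) * L2sq (fmul s \<Phi>))
      = ennreal ((k * c powr (s - ?d))\<^sup>2 * (1/c) powr - ?d) * L2sq (fmul s \<Phi>)"
    by (subst ennreal_mult) (auto simp: mult.assoc)
  also have "(k * c powr (s - ?d))\<^sup>2 * (1/c) powr - ?d = k\<^sup>2 * c powr (2 * s - ?d)"
  proof -
    have "(1/c) powr - ?d = c powr ?d" using c by (simp add: powr_divide powr_minus)
    moreover have "(c powr (s - ?d))\<^sup>2 * c powr ?d = c powr (2 * s - ?d)"
      by (simp add: power2_eq_square powr_add[symmetric])
    ultimately show ?thesis by (simp add: power_mult_distrib)
  qed
  finally show ?thesis .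
qed

lemma admissible_dilate:
  fixes \<phi> :: "real^'d \<Rightarrow> complex"
  assumes adm: "admissible r S \<phi> \<Phi> g" and c: "c > 0" and k: "k > 0"
  shows "admissible r S (\<lambda>x. complex_of_real k * \<phi> (c *\<^sub>R x))
    (\<lambda>\<xi>. complex_of_real k * (complex_of_real (c powr - real CARD('d)) * \<Phi> ((1/c) *\<^sub>R \<xi>)))
    (\<lambda>x. complex_of_real (k * c powr r) * g (c *\<^sub>R x))"
proof -
  let ?d = "real CARD('d)"
  have F: "is_fourier \<phi> \<Phi>" "L2sq (fmul S \<Phi>) < top" "is_fourier g (fmul r \<Phi>)" "radial \<phi>"
     "AE x in lborel. g x \<in> \<real> \<and> Re (g x) \<ge> 0" using adm by (auto simp: admissible_def)
  note [measurable] = is_fourierD(2)[OF F(1)]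
  have 1: "is_fourier (\<lambda>x. complex_of_real k * \<phi> (c *\<^sub>R x)) (\<lambda>\<xi>. complex_of_real k * (complex_of_real (c powr - ?d) * \<Phi> ((1/c) *\<^sub>R \<xi>)))"
    by (rule is_fourier_cmult[OF is_fourier_scale[OF F(1) c]])
  have 2: "radial (\<lambda>x. complex_of_real k * \<phi> (c *\<^sub>R x))"
    unfolding radial_def
  proof (intro allI impI)
    fix x y :: "real^'d" assume "norm x = norm y"
    then have "norm (c *\<^sub>R x) = norm (c *\<^sub>R y)" by simp
    then have "\<phi> (c *\<^sub>R x) = \<phi> (c *\<^sub>R y)" using F(4) unfolding radial_def by blast
    then show "complex_of_real k * \<phi> (c *\<^sub>R x) = complex_of_real k * \<phi> (c *\<^sub>R y)" by simp
  qed
  have 3: "L2sq (fmul S (\<lambda>\<xi>. complex_of_real k * (complex_of_real (c powr - ?d) * \<Phi> ((1/c) *\<^sub>R \<xi>)))) < top"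
    using F(2) by (subst L2sq_fmul_dilate[OF _ c k]) (auto simp: ennreal_mult_less_top)
  have eq: "(\<lambda>\<xi>. complex_of_real (k * c powr r) * (complex_of_real (c powr - ?d) * fmul r \<Phi> ((1/c) *\<^sub>R \<xi>)))
      = fmul r (\<lambda>\<xi>. complex_of_real k * (complex_of_real (c powr - ?d) * \<Phi> ((1/c) *\<^sub>R \<xi>)))"
  proof
    fix \<xi> :: "real^'d"
    have "c powr r * norm ((1/c) *\<^sub>R \<xi>) powr r = norm \<xi> powr r" using c by (simp add: powr_divide)
    then have "complex_of_real (c powr r) * complex_of_real (norm ((1/c) *\<^sub>R \<xi>) powr r) = complex_of_real (norm \<xi> powr r)"
      by (metis of_real_mult)
    note e = this[symmetric]
    show "complex_of_real (k * c powr r) * (complex_of_real (c powr - ?d) * fmul r \<Phi> ((1/c) *\<^sub>R \<xi>))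
      = fmul r (\<lambda>\<xi>. complex_of_real k * (complex_of_real (c powr - ?d) * \<Phi> ((1/c) *\<^sub>R \<xi>))) \<xi>"
      unfolding fmul_def e by (simp only: of_real_mult mult_ac)
  qed
  have 4: "is_fourier (\<lambda>x. complex_of_real (k * c powr r) * g (c *\<^sub>R x))
     (fmul r (\<lambda>\<xi>. complex_of_real k * (complex_of_real (c powr - ?d) * \<Phi> ((1/c) *\<^sub>R \<xi>))))"
    using is_fourier_cmult[OF is_fourier_scale[OF F(3) c], of "complex_of_real (k * c powr r)"] unfolding eq .
  have 5: "AE x in lborel. complex_of_real (k * c powr r) * g (c *\<^sub>R x) \<in> \<real> \<and> Re (complex_of_real (k * c powr r) * g (c *\<^sub>R x)) \<ge> 0"
    using AE_lborel_scale[OF c F(5)]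
  proof eventually_elim
    case (elim x)
    then obtain t where "g (c *\<^sub>R x) = complex_of_real t" by (auto elim: Reals_cases)
    with elim k show ?case by (simp del: of_real_mult add: of_real_mult[symmetric])
  qed
  show ?thesis unfolding admissible_def using 1 2 3 4 5 by blast
qed

lemma admissible_normalise:
  fixes \<phi> :: "real^'d \<Rightarrow> complex"
  assumes adm: "admissible r S \<phi> \<Phi> g" and r: "0 < r" "r < S" and nz: "\<not> (AE x in lborel. \<phi> x = 0)"
  obtains \<phi>' \<Phi>' g' :: "real^'d \<Rightarrow> complex" where "admissible r S \<phi>' \<Phi>' g'" "L2sq \<Phi>' = 1" "L2sq (fmul S \<Phi>') = 1"
    "L2sq (fmul r \<Phi>') = ennreal ((GN_ratio r S \<phi>)\<^sup>2)"
proof -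
  let ?d = "real CARD('d)"
  have F: "is_fourier \<phi> \<Phi>" "L2sq (fmul S \<Phi>) < top" "is_fourier g (fmul r \<Phi>)" using adm by (auto simp: admissible_def)
  note [measurable] = is_fourierD(2)[OF F(1)]
  have nz': "\<not> (AE \<xi> in lborel. \<Phi> \<xi> = 0)" using nz is_fourier_AE_zero_iff[OF F(1)] by simp
  obtain a where a: "L2sq \<Phi> = ennreal a" "a \<ge> 0" using is_fourierD(4)[OF F(1)] by (cases "L2sq \<Phi>") auto
  obtain b where b: "L2sq (fmul S \<Phi>) = ennreal b" "b \<ge> 0" using F(2) by (cases "L2sq (fmul S \<Phi>)") auto
  obtain m where m: "L2sq (fmul r \<Phi>) = ennreal m" "m \<ge> 0" using is_fourierD(4)[OF F(3)] by (cases "L2sq (fmul r \<Phi>)") auto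
  have ab: "a > 0" "b > 0" using L2sq_interpolation_strict(1,2)[OF _ nz' r a b] by auto
  \<comment> \<open>Two parameters for two equations: \<open>k\<^sup>2 * c powr - ?d * a = 1\<close>
    and \<open>k\<^sup>2 * c powr (2 * S - ?d) * b = 1\<close>, whence
    \<open>c powr (2 * S) = a / b\<close>.\<close>
  define c where "c = (a / b) powr (1 / (2 * S))"
  have c: "c > 0" using ab by (simp add: c_def)
  define k where "k = sqrt (c powr ?d / a)"
  have k: "k > 0" "k\<^sup>2 = c powr ?d / a" using ab c by (auto simp: k_def)
  let ?\<Phi> = "\<lambda>\<xi>. complex_of_real k * (complex_of_real (c powr - ?d) * \<Phi> ((1/c) *\<^sub>R \<xi>))"
  have fac: "k\<^sup>2 * c powr (2 * s - ?d) = c powr (2 * s) / a" for s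
    unfolding k(2) using c by (simp add: powr_diff)
  have N: "L2sq (fmul s ?\<Phi>) = ennreal (c powr (2 * s) / a) * L2sq (fmul s \<Phi>)" for s
    using L2sq_fmul_dilate[OF _ c k(1), of \<Phi> s] by (simp add: fac)
  have 1: "L2sq ?\<Phi> = 1"
    using N[of 0] ab c unfolding L2sq_fmul_0 a by (simp add: ennreal_mult[symmetric])
  have cS: "c powr (2 * S) = a / b" using ab r by (simp add: c_def powr_powr)
  have 2: "L2sq (fmul S ?\<Phi>) = 1"
    using N[of S] ab unfolding b cS by (simp add: ennreal_mult[symmetric])
  have cr: "c powr (2 * r) = (a / b) powr (r / S)" using r by (simp add: c_def powr_powr)
  have "GN_ratio r S \<phi> = sqrt m / (sqrt a powr (1 - r/S) * sqrt b powr (r/S))"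
    using a b m by (simp add: GN_ratio_eq[OF adm])
  also have "\<dots> = sqrt m / sqrt (a powr (1 - r/S) * b powr (r/S))"
    using ab by (simp add: real_sqrt_mult powr_half_sqrt[symmetric] powr_powr mult.commute)
  finally have "(GN_ratio r S \<phi>)\<^sup>2 = m / (a powr (1 - r/S) * b powr (r/S))"
    using m by (simp add: power_divide)
  also have "\<dots> = c powr (2 * r) / a * m"
    unfolding cr using ab by (simp add: powr_divide powr_diff mult.commute)
  finally have 3: "L2sq (fmul r ?\<Phi>) = ennreal ((GN_ratio r S \<phi>)\<^sup>2)"
    using N[of r] ab m by (simp add: ennreal_mult[symmetric])
  show ?thesis by (rule that[OF admissible_dilate[OF adm c k(1)] 1 2 3])
qed

section \<open>The class contains nonzero functions\<close>

text \<open>The singularity is dominated by a sum over balls of radius \<open>(1/2)^j\<close> with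
  weights \<open>2 powr (p * real (Suc j))\<close>; with the volumes this is geometric with ratio
  \<open>q\<close>, below 1 because \<open>p\<close> is less than the dimension.\<close>

lemma nn_integral_norm_powr_ball:
  assumes p: "p > 0" "p < real DIM('a)"
  shows "(\<integral>\<^sup>+x. indicator (ball 0 1) x * ennreal (norm x powr - p) \<partial>(lborel :: 'a::euclidean_space measure)) < top"
proof -
  let ?d = "DIM('a)"
  let ?v = "bvol TYPE('a) 1"
  have v: "?v > 0" by (rule bvol_pos) simp
  define q where "q = 2 powr (p - real ?d)"
  have q: "0 < q" "q < 1" using p powr_less_mono[of "p - real ?d" 0 2] by (auto simp: q_def)
  have half: "(1/2 :: real) ^ n = 2 powr - real n" for n
    by (simp add: powr_minus powr_realpow power_one_over inverse_eq_divide)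
  have pt: "indicator (ball 0 1) x * ennreal (norm x powr - p)
      \<le> (\<Sum>j. ennreal (2 powr (p * real (Suc j))) * indicator (ball 0 ((1/2)^j)) x)" for x :: 'a
  proof (cases "x \<noteq> 0 \<and> norm x < 1")
    case True
    obtain n where ex: "(1/2) ^ n < norm x" using real_arch_pow_inv[of "norm x" "1/2"] True by auto
    define m where "m = (LEAST n. (1/2) ^ n < norm x)"
    have m: "(1/2) ^ m < norm x" unfolding m_def by (rule LeastI[of _ n]) (rule ex)
    have "m \<noteq> 0" using m True by (cases m) auto
    then obtain j where j: "m = Suc j" by (cases m) auto
    have le: "norm x \<le> (1/2) ^ j" using not_less_Least[of j "\<lambda>n. (1/2) ^ n < norm x"] j by (simp add: m_def)
    show ?thesis
    proof (cases "norm x < (1/2) ^ j")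
      case lt: True
      have "norm x powr - p \<le> ((1/2) ^ Suc j) powr - p"
        using m j p by (intro powr_mono2') auto
      also have "((1/2) ^ Suc j :: real) = 2 powr (- real (Suc j))"
        by (rule half)
      also have "(2 powr (- real (Suc j))) powr - p = 2 powr (p * real (Suc j))"
        by (simp add: powr_powr algebra_simps)
      finally have "indicator (ball 0 1) x * ennreal (norm x powr - p)
          \<le> (\<Sum>i\<in>{j}. ennreal (2 powr (p * real (Suc i))) * indicator (ball 0 ((1/2)^i)) x)"
        using True lt by (simp add: ennreal_leI)
      also have "\<dots> \<le> (\<Sum>i. ennreal (2 powr (p * real (Suc i))) * indicator (ball 0 ((1/2)^i)) x)"
        by (rule sum_le_suminf) auto
      finally show ?thesis .
    next
      case eq: False
      \<comment> \<open>The open ball of index \<open>j\<close> misses a point on its boundary; the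
        index \<open>i\<close> with \<open>j = Suc i\<close> covers it and has exactly the weight
        \<open>norm x powr - p\<close>.\<close>
      then have xe: "norm x = (1/2) ^ j" using le by simp
      have "j \<noteq> 0" using xe True by (cases j) auto
      then obtain i where i: "j = Suc i" by (cases j) auto
      have lt: "norm x < (1/2) ^ i" using xe i True by (simp add: field_simps)
      have "((1/2) ^ Suc i :: real) = 2 powr (- real (Suc i))"
        by (rule half)
      moreover have "(2 powr (- real (Suc i))) powr - p = 2 powr (p * real (Suc i))"
        by (simp add: powr_powr algebra_simps)
      ultimately have "norm x powr - p = 2 powr (p * real (Suc i))" using xe i by simp
      then have "indicator (ball 0 1) x * ennreal (norm x powr - p)
          \<le> (\<Sum>i\<in>{i}. ennreal (2 powr (p * real (Suc i))) * indicator (ball 0 ((1/2)^i)) x)"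
        using True lt by simp
      also have "\<dots> \<le> (\<Sum>i. ennreal (2 powr (p * real (Suc i))) * indicator (ball 0 ((1/2)^i)) x)"
        by (rule sum_le_suminf) auto
      finally show ?thesis .
    qed
  next
    case False
    then have "indicator (ball 0 1) x * ennreal (norm x powr - p) = 0" by (auto simp: indicator_def)
    then show ?thesis by (simp only: zero_le)
  qed
  have "(\<integral>\<^sup>+x. indicator (ball 0 1) x * ennreal (norm x powr - p) \<partial>(lborel :: 'a measure))
      \<le> (\<integral>\<^sup>+x. (\<Sum>j. ennreal (2 powr (p * real (Suc j))) * indicator (ball 0 ((1/2)^j)) x) \<partial>(lborel :: 'a measure))"
    by (intro nn_integral_mono pt)
  also have "\<dots> = (\<Sum>j. \<integral>\<^sup>+x. ennreal (2 powr (p * real (Suc j))) * indicator (ball 0 ((1/2)^j)) x \<partial>(lborel :: 'a measure))"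
    by (rule nn_integral_suminf) measurable
  also have "\<dots> = (\<Sum>j. ennreal (?v * 2 powr p * q ^ j))"
  proof (intro arg_cong[of _ _ suminf] ext)
    fix j :: nat
    have "(\<integral>\<^sup>+x. ennreal (2 powr (p * real (Suc j))) * indicator (ball 0 ((1/2)^j)) x \<partial>(lborel :: 'a measure))
        = ennreal (2 powr (p * real (Suc j))) * ennreal (?v * ((1/2)^j)^?d)"
      by (subst nn_integral_cmult) (auto simp: emeasure_ball bvol_eq)
    also have "\<dots> = ennreal (2 powr (p * real (Suc j)) * (?v * ((1/2)^j)^?d))"
      using v by (subst ennreal_mult) auto
    also have "2 powr (p * real (Suc j)) * (?v * ((1/2)^j)^?d) = ?v * 2 powr p * q ^ j"
    proof -
      have "((1/2)^j)^?d = (2 powr - real ?d) ^ j"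
        by (simp add: powr_minus powr_realpow power_one_over inverse_eq_divide power_mult[symmetric] mult.commute)
      moreover have "2 powr (p * real (Suc j)) = 2 powr p * (2 powr p) ^ j"
        by (simp add: powr_power powr_add[symmetric] algebra_simps)
      moreover have "q ^ j = (2 powr p) ^ j * (2 powr - real ?d) ^ j"
        by (simp add: q_def power_mult_distrib[symmetric] powr_add[symmetric])
      ultimately show ?thesis by simp
    qed
    finally show "(\<integral>\<^sup>+x. ennreal (2 powr (p * real (Suc j))) * indicator (ball 0 ((1/2)^j)) x \<partial>(lborel :: 'a measure))
        = ennreal (?v * 2 powr p * q ^ j)" .
  qed
  also have "\<dots> = ennreal (\<Sum>j. ?v * 2 powr p * q ^ j)"
    using v q by (intro suminf_ennreal2) (auto intro!: summable_mult summable_geometric)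
  also have "\<dots> < top" by simp
  finally show ?thesis .
qed

text \<open>Inside the unit ball the singularity is integrable because \<open>2 * r\<close> is less
  than the dimension; outside, the power is at most 1 and one Gaussian factor suffices.\<close>

lemma L2sq_fmul_neg_gauss:
  assumes r: "0 < r" "r < real CARD('d) / 2"
  shows "L2sq (fmul (- r) (\<lambda>\<xi>::real^'d. complex_of_real (gauss 1 \<xi>))) < top"
proof -
  have "L2sq (fmul (- r) (\<lambda>\<xi>::real^'d. complex_of_real (gauss 1 \<xi>)))
      \<le> (\<integral>\<^sup>+\<xi>. indicator (ball 0 1) \<xi> * ennreal (norm \<xi> powr - (2 * r)) + ennreal (gauss 1 \<xi>) \<partial>(lborel :: (real^'d) measure))"
    unfolding L2sq_fmul
  proof (rule nn_integral_mono)
    fix \<xi> :: "real^'d"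
    have g: "gauss 1 \<xi> > 0" "gauss 1 \<xi> \<le> 1" by (auto simp: gauss_pos gauss_le_1)
    then have g2: "(gauss 1 \<xi>)\<^sup>2 \<le> gauss 1 \<xi>" "(gauss 1 \<xi>)\<^sup>2 \<le> 1"
      by (auto simp: power2_eq_square mult_left_le mult_le_one)
    show "ennreal (norm \<xi> powr (2 * - r) * (cmod (complex_of_real (gauss 1 \<xi>)))\<^sup>2)
        \<le> indicator (ball 0 1) \<xi> * ennreal (norm \<xi> powr - (2 * r)) + ennreal (gauss 1 \<xi>)"
    proof (cases "norm \<xi> < 1")
      case True
      have "norm \<xi> powr - (2 * r) * (gauss 1 \<xi>)\<^sup>2 \<le> norm \<xi> powr - (2 * r) * 1"
        using g2 by (intro mult_left_mono) auto
      then have "ennreal (norm \<xi> powr - (2 * r) * (gauss 1 \<xi>)\<^sup>2) \<le> ennreal (norm \<xi> powr - (2 * r))"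
        by (intro ennreal_leI) simp
      then show ?thesis using True by (simp add: add_increasing2)
    next
      case False
      have "norm \<xi> powr - (2 * r) \<le> 1 powr - (2 * r)" using False r by (intro powr_mono2') auto
      then have "norm \<xi> powr - (2 * r) * (gauss 1 \<xi>)\<^sup>2 \<le> 1 * gauss 1 \<xi>"
        using g2 by (intro mult_mono) auto
      then show ?thesis using False by (simp add: ennreal_leI)
    qed
  qed
  also have "\<dots> = (\<integral>\<^sup>+\<xi>. indicator (ball 0 1) \<xi> * ennreal (norm \<xi> powr - (2 * r)) \<partial>(lborel :: (real^'d) measure))
      + (\<integral>\<^sup>+\<xi>. ennreal (gauss 1 \<xi>) \<partial>(lborel :: (real^'d) measure))"
    by (rule nn_integral_add) measurable
  also have "\<dots> < top"
    using nn_integral_norm_powr_ball[of "2 * r", where 'a="real^'d"] r by (simp add: nn_integral_gauss)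
  finally show ?thesis .
qed

text \<open>The witness has D^r \<phi> equal to \<open>gauss 1\<close>, which is positive and its
  own transform, so \<open>\<Phi>\<close> is this Gaussian divided by
  \<open>norm \<xi> powr r\<close>. That \<open>\<Phi>\<close> lies in L^2 is where r < d/2
  enters.\<close>

lemma admissible_exists:
  assumes r: "0 < r" "r < real CARD('d) / 2" "r < S"
  obtains \<phi> \<Phi> g :: "real^'d \<Rightarrow> complex" where "admissible r S \<phi> \<Phi> g" "\<not> (AE x in lborel. \<phi> x = 0)"
proof -
  define \<gamma> where "\<gamma> x = complex_of_real (gauss 1 x)" for x :: "real^'d"
  have [measurable]: "\<gamma> \<in> borel_measurable borel" unfolding \<gamma>_def by measurable
  define \<Phi> where "\<Phi> = fmul (- r) \<gamma>"
  have [measurable]: "\<Phi> \<in> borel_measurable borel" unfolding \<Phi>_def by measurable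
  have fin: "L2sq \<Phi> < top" unfolding \<Phi>_def \<gamma>_def by (rule L2sq_fmul_neg_gauss[OF r(1,2)])
  have finS: "L2sq (fmul S \<Phi>) < top"
  proof -
    have "L2sq (fmul S \<Phi>) = L2sq (fmul (S - r) (\<lambda>x::real^'d. complex_of_real (gauss (1\<^sup>2) x)))"
      by (simp add: \<Phi>_def fmul_fmul \<gamma>_def[abs_def])
    also have "\<dots> \<le> ennreal ((S - r) powr (S - r) * 1 powr (- 2 * (S - r) - real CARD('d)))"
      by (rule L2sq_fmul_gauss) (use r in auto)
    also have "\<dots> < top" by simp
    finally show ?thesis .
  qed
  have "is_fourier \<gamma> (fourier_L1 \<gamma>)"
    using integrable_gauss[of 1, where 'a="real^'d"] L2sq_gauss_fin[of 1, where 'a="real^'d"]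
    unfolding \<gamma>_def by (intro is_fourier_fourier_L1) (auto simp: complex_of_real_integrable_eq)
  moreover have "fourier_L1 \<gamma> = \<gamma>"
    using fourier_L1_gauss[of 1] unfolding \<gamma>_def by auto
  ultimately have \<gamma>: "is_fourier \<gamma> \<gamma>" by simp
  have "AE \<xi> in lborel. \<gamma> \<xi> = fmul r \<Phi> \<xi>"
    using fmul_inverse'[of r \<gamma>] unfolding \<Phi>_def by eventually_elim simp
  then have g: "is_fourier \<gamma> (fmul r \<Phi>)" by (intro is_fourier_cong_AE[OF \<gamma>]) simp_all
  obtain \<phi>\<^sub>0 where \<phi>\<^sub>0: "is_fourier \<phi>\<^sub>0 \<Phi>" using is_fourier_exists_inverse[of \<Phi>] fin by auto
  have inv: "AE x in lborel. \<phi>\<^sub>0 (U x) = \<phi>\<^sub>0 x" if U: "orthogonal_transformation U" for U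
    unfolding is_fourier_rotation_invariant[OF \<phi>\<^sub>0 U]
    using U by (auto simp: \<Phi>_def \<gamma>_def fmul_def gauss_def orthogonal_transformation)
  obtain \<phi> where \<phi>: "\<phi> \<in> borel_measurable borel" "radial \<phi>" "AE x in lborel. \<phi>\<^sub>0 x = \<phi> x"
    using radial_representative[OF is_fourierD(1,3)[OF \<phi>\<^sub>0] inv] by blast
  have F: "is_fourier \<phi> \<Phi>" using \<phi> by (intro is_fourier_cong_AE[OF \<phi>\<^sub>0]) auto
  have pos: "AE x in lborel. \<gamma> x \<in> \<real> \<and> Re (\<gamma> x) \<ge> 0"
    by (rule AE_I2) (auto simp: \<gamma>_def less_imp_le[OF gauss_pos])
  have "admissible r S \<phi> \<Phi> \<gamma>" unfolding admissible_def using F \<phi>(2) finS g pos by blast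
  moreover have "\<not> (AE x in lborel. \<phi> x = 0)"
  proof
    assume "AE x in lborel. \<phi> x = 0"
    then have "AE \<xi> in lborel. \<gamma> \<xi> = 0"
      using is_fourier_AE_zero_iff[OF F] by (simp add: \<Phi>_def fmul_eq_0_iff)
    then have "AE \<xi> in (lborel :: (real^'d) measure). False"
      by eventually_elim (simp add: \<gamma>_def gauss_def)
    then show False by (simp add: eventually_False ae_filter_eq_bot_iff)
  qed
  ultimately show ?thesis by (rule that)
qed

section \<open>Limits of normalised sequences\<close>

lemma L2sq_Fatou:
  fixes f :: "nat \<Rightarrow> 'a::euclidean_space \<Rightarrow> complex"
  assumes [measurable]: "\<And>n. f n \<in> borel_measurable borel"
    and lim: "AE x in lborel. (\<lambda>n. f n x) \<longlonglongrightarrow> F x" and c: "\<And>n. L2sq (f n) \<le> c"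
  shows "L2sq F \<le> c"
proof -
  have "L2sq F = (\<integral>\<^sup>+x. liminf (\<lambda>n. ennreal ((cmod (f n x))\<^sup>2)) \<partial>lborel)"
    unfolding L2sq_def
  proof (rule nn_integral_cong_AE)
    show "AE x in lborel. ennreal ((cmod (F x))\<^sup>2) = liminf (\<lambda>n. ennreal ((cmod (f n x))\<^sup>2))"
      using lim
    proof eventually_elim
      case (elim x)
      have "(\<lambda>n. ennreal ((cmod (f n x))\<^sup>2)) \<longlonglongrightarrow> ennreal ((cmod (F x))\<^sup>2)"
        by (intro tendsto_ennrealI tendsto_intros elim)
      from lim_imp_Liminf[OF _ this] show ?case by simp
    qed
  qed
  also have "\<dots> \<le> liminf (\<lambda>n. L2sq (f n))"
    unfolding L2sq_def by (rule nn_integral_liminf) auto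
  also have "\<dots> \<le> c" by (rule Liminf_le) (use c in auto)
  finally show ?thesis .
qed

lemma admissible_invariant:
  assumes adm: "admissible r S \<phi> \<Phi> g" and U: "orthogonal_transformation U"
  shows "AE \<xi> in lborel. \<Phi> (U \<xi>) = \<Phi> \<xi>" "AE x in lborel. g (U x) = g x"
proof -
  have F: "is_fourier \<phi> \<Phi>" "is_fourier g (fmul r \<Phi>)" "radial \<phi>" using adm by (auto simp: admissible_def)
  have nU: "norm (U x) = norm x" for x using U by (simp add: orthogonal_transformation)
  have "\<phi> (U x) = \<phi> x" for x using F(3) nU[of x] unfolding radial_def by blast
  then show *: "AE \<xi> in lborel. \<Phi> (U \<xi>) = \<Phi> \<xi>"
    unfolding is_fourier_rotation_invariant[OF F(1) U, symmetric] by simp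
  show "AE x in lborel. g (U x) = g x"
    unfolding is_fourier_rotation_invariant[OF F(2) U]
    using * by eventually_elim (simp add: fmul_def nU)
qed

lemma powr_neg_small:
  fixes C e \<beta> :: real
  assumes "\<beta> < 0" "e > 0"
  shows "\<exists>R\<ge>1. C * R powr \<beta> \<le> e"
proof -
  have "((\<lambda>R. C * R powr \<beta>) \<longlongrightarrow> C * 0) at_top"
    using assms by (intro tendsto_mult tendsto_const tendsto_neg_powr filterlim_ident) auto
  then have "\<forall>\<^sub>F R in at_top. C * R powr \<beta> < e" using assms by (intro order_tendstoD) auto
  then have "\<forall>\<^sub>F R in at_top. C * R powr \<beta> < e \<and> R \<ge> 1"
    using eventually_ge_at_top[of "1::real"] by eventually_elim auto
  then show ?thesis using eventually_happens'[OF trivial_limit_at_top_linorder] by (auto intro: less_imp_le)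
qed

text \<open>Equicontinuity comes from \<open>S - r\<close> further derivatives of \<open>g\<close>,
  as \<open>fmul (S - r) (fmul r \<Phi>)\<close> is \<open>fmul S \<Phi>\<close>. Tightness of the
  averages comes from the mass bound, where \<open>L2sq \<Phi> = 1\<close> is used, and from
  rotation invariance.\<close>

lemma normalised_compact:
  fixes \<phi> \<Phi> g :: "nat \<Rightarrow> real^'d \<Rightarrow> complex"
  assumes r: "1/2 < r" "r < real CARD('d) / 2" "r < S"
    and adm: "\<And>n. admissible r S (\<phi> n) (\<Phi> n) (g n)"
    and N: "\<And>n. L2sq (\<Phi> n) = 1" "\<And>n. L2sq (fmul S (\<Phi> n)) = 1" "\<And>n. L2sq (fmul r (\<Phi> n)) \<le> 1"
  shows "\<exists>s :: nat \<Rightarrow> nat. strict_mono s \<and>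
    (\<forall>e::real. e > 0 \<longrightarrow> (\<exists>N. \<forall>m\<ge>N. \<forall>n\<ge>N. L2sq (\<lambda>x. g (s m) x - g (s n) x) \<le> ennreal e))"
proof -
  have F: "is_fourier (\<phi> n) (\<Phi> n)" "is_fourier (g n) (fmul r (\<Phi> n))"
     "AE x in lborel. g n x \<in> \<real> \<and> Re (g n x) \<ge> 0" for n using adm[of n] by (auto simp: admissible_def)
  note [measurable] = is_fourierD(2)[OF F(1)] is_fourierD(1)[OF F(2)]
  \<comment> \<open>The growth exponent of the mass; it turns
    \<open>1 - real CARD('d) + 2 * a\<close> into \<open>1 - 2 * r\<close>.\<close>
  define a where "a = real CARD('d) / 2 - r"
  define A where "A = exp pi * sqrt (r powr r)"
  have a: "a \<ge> 0" "1 - real CARD('d) + 2 * a < 0" using r by (auto simp: a_def)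
  have A: "A \<ge> 0" by (simp add: A_def)
  have M: "mass (g n) 0 \<rho> \<le> ennreal (A * \<rho> powr a)" if "\<rho> \<ge> 1" for n \<rho>
    unfolding A_def a_def using r that F N(1) by (intro mass_bound[OF F(2)]) auto
  show ?thesis
  proof (rule L2_compactness[of g 1])
    show "L2sq (g n) \<le> ennreal 1" for n
      using is_fourier_Plancherel[OF F(2)[of n]] N(3)[of n] by simp
    show "\<exists>d>0. \<forall>n z. norm z < d \<longrightarrow> L2sq (\<lambda>x. g n (x + z) - g n x) \<le> ennreal e" if e: "e > 0" for e :: real
    proof -
      obtain d where d: "d > 0" "\<And>(h :: real^'d \<Rightarrow> complex) G z. is_fourier h G \<Longrightarrow> L2sq G \<le> 1 \<Longrightarrow>
          L2sq (fmul (S - r) G) \<le> 1 \<Longrightarrow> norm z < d \<Longrightarrow> L2sq (\<lambda>x. h (x + z) - h x) \<le> ennreal e"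
        using L2_equicontinuous[of "S - r" e, where 'd='d] r e by auto
      have "L2sq (\<lambda>x. g n (x + z) - g n x) \<le> ennreal e" if "norm z < d" for n z
        using that N(2,3)[of n] by (intro d(2)[OF F(2)]) (auto simp: fmul_fmul)
      with d(1) show ?thesis by blast
    qed
    show "\<exists>R. \<forall>n. L2sq (\<lambda>x. indicator (- ball 0 R) x * bavg \<delta> (g n) x) \<le> ennreal e"
      if \<delta>: "0 < \<delta>" "\<delta> \<le> 1" and e: "e > 0" for \<delta> e :: real
    proof -
      let ?C = "(1 / bvol TYPE(real^'d) \<delta>)\<^sup>2 * bvol TYPE(real^'d) 2 * 15 powr a * A\<^sup>2 / (1 - 2 powr (1 - real CARD('d) + 2 * a))"
      obtain R where R: "R \<ge> 1" "?C * R powr (1 - real CARD('d) + 2 * a) \<le> e"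
        using powr_neg_small[OF a(2) e, of ?C] by blast
      have tail: "L2sq (\<lambda>x. indicator (- ball 0 R) x * bavg \<delta> (g n) x) \<le> ennreal (?C * R powr (1 - real CARD('d) + 2 * a))" for n
        by (rule bavg_tail_bound[OF _ admissible_invariant(2)[OF adm] M A a(1) \<delta> R(1) a(2)]) auto
      show ?thesis by (intro exI[of _ R] allI) (rule order_trans[OF tail ennreal_leI[OF R(2)]])
    qed
  qed auto
qed

text \<open>Convergence is strong only for \<open>g\<close> and its transform.
  \<open>\<Phi>'\<close>, obtained by dividing by \<open>norm \<xi> powr r\<close>, is an almost
  everywhere limit, so Fatou controls its norms by inequalities, while the norm of
  \<open>fmul r \<Phi>'\<close> is the exact limit \<open>q\<close>.\<close>

lemma normalised_limit:
  fixes \<phi> \<Phi> g :: "nat \<Rightarrow> real^'d \<Rightarrow> complex"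
  assumes r: "1/2 < r" "r < real CARD('d) / 2" "r < S"
    and adm: "\<And>n. admissible r S (\<phi> n) (\<Phi> n) (g n)"
    and N: "\<And>n. L2sq (\<Phi> n) = 1" "\<And>n. L2sq (fmul S (\<Phi> n)) = 1" "\<And>n. L2sq (fmul r (\<Phi> n)) \<le> 1"
    and q: "(\<lambda>n. L2sq (fmul r (\<Phi> n))) \<longlonglongrightarrow> q"
  obtains \<phi>' \<Phi>' g' :: "real^'d \<Rightarrow> complex" where "admissible r S \<phi>' \<Phi>' g'" "L2sq \<Phi>' \<le> 1" "L2sq (fmul S \<Phi>') \<le> 1" "L2sq (fmul r \<Phi>') = q"
proof -
  have F: "is_fourier (\<phi> n) (\<Phi> n)" "is_fourier (g n) (fmul r (\<Phi> n))"
     "AE x in lborel. g n x \<in> \<real> \<and> Re (g n x) \<ge> 0" for n using adm[of n] by (auto simp: admissible_def)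
  note [measurable] = is_fourierD(2)[OF F(1)] is_fourierD(1)[OF F(2)]
  obtain s :: "nat \<Rightarrow> nat" where s: "strict_mono s"
    "\<And>e::real. e > 0 \<Longrightarrow> \<exists>N. \<forall>m\<ge>N. \<forall>n\<ge>N. L2sq (\<lambda>x. g (s m) x - g (s n) x) \<le> ennreal e"
    using normalised_compact[of r S \<phi> \<Phi> g, OF r adm N] by blast
  define G where "G n = fmul r (\<Phi> (s n))" for n
  have [measurable]: "G n \<in> borel_measurable borel" for n unfolding G_def by measurable
  have FG: "is_fourier (g (s n)) (G n)" for n unfolding G_def by (rule F(2))
  have dG: "L2sq (\<lambda>\<xi>. G m \<xi> - G n \<xi>) = L2sq (\<lambda>x. g (s m) x - g (s n) x)" for m n
    by (rule is_fourier_Plancherel[OF is_fourier_diff[OF FG FG]])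
  obtain w where w: "strict_mono w" "AE \<xi> in lborel. (\<lambda>k. G (w k) \<xi>) \<longlonglongrightarrow> lim (\<lambda>k. G (w k) \<xi>)"
    "(\<lambda>n. L2sq (\<lambda>\<xi>. G n \<xi> - lim (\<lambda>k. G (w k) \<xi>))) \<longlonglongrightarrow> 0"
    by (rule L2sq_complete[of G]) (use s(2) in \<open>auto simp: dG\<close>)
  define H where "H \<xi> = lim (\<lambda>k. G (w k) \<xi>)" for \<xi>
  have [measurable]: "H \<in> borel_measurable borel" unfolding H_def by measurable
  note w = w[folded H_def]
  \<comment> \<open>The subsequences \<open>w\<close> and \<open>v\<close> are unrelated. This is
    harmless: the full sequences converge in norm, and the multiplication formula passes to the
    limit along them.\<close>
  obtain v where v: "strict_mono v" "AE x in lborel. (\<lambda>k. g (s (v k)) x) \<longlonglongrightarrow> lim (\<lambda>k. g (s (v k)) x)"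
    "(\<lambda>n. L2sq (\<lambda>x. g (s n) x - lim (\<lambda>k. g (s (v k)) x))) \<longlonglongrightarrow> 0"
    by (rule L2sq_complete[of "\<lambda>n. g (s n)"]) (use s(2) in auto)
  define g' where "g' x = lim (\<lambda>k. g (s (v k)) x)" for x
  have [measurable]: "g' \<in> borel_measurable borel" unfolding g'_def by measurable
  note v = v[folded g'_def]
  have Gfin: "L2sq (G n) \<le> 1" for n using N(3) by (simp add: G_def)
  have Hfin: "L2sq H \<le> 1" by (rule L2sq_Fatou[OF _ w(2)]) (use Gfin in auto)
  have gfin: "L2sq (g (s n)) \<le> 1" for n using Gfin[of n] is_fourier_Plancherel[OF FG[of n]] by simp
  have g'fin: "L2sq g' \<le> 1" by (rule L2sq_Fatou[OF _ v(2)]) (use gfin in auto)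
  have fin: "L2sq u < top" if "L2sq u \<le> 1" for u :: "real^'d \<Rightarrow> complex" using that by (rule le_less_trans) simp
  have FH: "is_fourier g' H"
    unfolding is_fourier_iff
  proof (intro conjI allI impI; (elim conjE)?)
    fix \<psi> :: "real^'d \<Rightarrow> complex" assume \<psi>: "integrable lborel \<psi>" "L2sq \<psi> < top"
    have [measurable]: "\<psi> \<in> borel_measurable borel" using \<psi> by (auto dest: borel_measurable_integrable)
    have "(\<lambda>n. \<integral>\<xi>. G n \<xi> * \<psi> \<xi> \<partial>lborel) \<longlonglongrightarrow> (\<integral>\<xi>. H \<xi> * \<psi> \<xi> \<partial>lborel)"
      by (rule tendsto_integral_mult_L2) (use fin[OF Gfin] fin[OF Hfin] \<psi> w in auto)
    moreover have "(\<lambda>n. \<integral>x. g (s n) x * fourier_L1 \<psi> x \<partial>lborel) \<longlonglongrightarrow> (\<integral>x. g' x * fourier_L1 \<psi> x \<partial>lborel)"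
      by (rule tendsto_integral_mult_L2) (use fin[OF gfin] fin[OF g'fin] fourier_L1_L2[OF \<psi>] v in auto)
    ultimately show "(\<integral>\<xi>. H \<xi> * \<psi> \<xi> \<partial>lborel) = (\<integral>x. g' x * fourier_L1 \<psi> x \<partial>lborel)"
      by (simp add: is_fourier_formula[OF FG \<psi>] LIMSEQ_unique)
  qed (use fin[OF Hfin] fin[OF g'fin] in auto)
  have "(\<lambda>n. L2sq (G n)) \<longlonglongrightarrow> L2sq H"
    by (rule L2sq_tendsto) (use fin[OF Gfin] fin[OF Hfin] w in auto)
  moreover have "(\<lambda>n. L2sq (G n)) \<longlonglongrightarrow> q"
    using LIMSEQ_subseq_LIMSEQ[OF q s(1)] by (simp add: G_def o_def)
  ultimately have Hq: "L2sq H = q" by (rule LIMSEQ_unique)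
  define \<Phi>' where "\<Phi>' = fmul (- r) H"
  have [measurable]: "\<Phi>' \<in> borel_measurable borel" unfolding \<Phi>'_def by measurable
  define \<Psi> where "\<Psi> k = \<Phi> (s (w k))" for k
  have [measurable]: "\<Psi> k \<in> borel_measurable borel" for k unfolding \<Psi>_def by measurable
  have \<Psi>lim: "AE \<xi> in lborel. (\<lambda>k. \<Psi> k \<xi>) \<longlonglongrightarrow> \<Phi>' \<xi>"
    using w(2) AE_lborel_nonzero
  proof eventually_elim
    case (elim \<xi>)
    have "(\<lambda>k. fmul (- r) (G (w k)) \<xi>) \<longlonglongrightarrow> fmul (- r) H \<xi>"
      unfolding fmul_def by (intro tendsto_mult tendsto_const elim(1))
    moreover have "fmul (- r) (G (w k)) \<xi> = \<Psi> k \<xi>" for k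
      using elim(2) by (simp add: G_def fmul_fmul \<Psi>_def fmul_def)
    ultimately show ?case by (simp add: \<Phi>'_def)
  qed
  have n1: "L2sq \<Phi>' \<le> 1" by (rule L2sq_Fatou[OF _ \<Psi>lim]) (auto simp: \<Psi>_def N)
  have n2: "L2sq (fmul S \<Phi>') \<le> 1"
  proof (rule L2sq_Fatou[where f="\<lambda>k. fmul S (\<Psi> k)"])
    show "AE \<xi> in lborel. (\<lambda>k. fmul S (\<Psi> k) \<xi>) \<longlonglongrightarrow> fmul S \<Phi>' \<xi>"
      using \<Psi>lim unfolding fmul_def by eventually_elim (intro tendsto_mult tendsto_const)
  qed (auto simp: \<Psi>_def N)
  have ae: "AE \<xi> in lborel. H \<xi> = fmul r \<Phi>' \<xi>"
    using fmul_inverse'[of r H] unfolding \<Phi>'_def by eventually_elim simp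
  have Fg': "is_fourier g' (fmul r \<Phi>')" by (rule is_fourier_cong_AE[OF FH]) (use ae in auto)
  have n3: "L2sq (fmul r \<Phi>') = q" using L2sq_cong_AE[OF ae] Hq by simp
  have pos: "AE x in lborel. g' x \<in> \<real> \<and> Re (g' x) \<ge> 0"
  proof -
    have "AE x in lborel. \<forall>n. g n x \<in> \<real> \<and> Re (g n x) \<ge> 0" using F(3) by (simp only: AE_all_countable simp_thms)
    with v(2) show ?thesis
    proof eventually_elim
      case (elim x)
      have "g' x \<in> \<real>" by (rule closed_sequentially[OF closed_complex_Reals _ elim(1)]) (use elim(2) in auto)
      moreover have "Re (g' x) \<ge> 0"
        by (rule LIMSEQ_le_const[OF tendsto_Re[OF elim(1)]]) (use elim(2) in auto)
      ultimately show ?case ..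
    qed
  qed
  \<comment> \<open>Invariance is obtained almost everywhere for each \<open>U\<close> separately,
    which is the form that \<open>radial_representative\<close> asks for.\<close>
  have inv\<Phi>: "AE \<xi> in lborel. \<Phi>' (U \<xi>) = \<Phi>' \<xi>" if U: "orthogonal_transformation U" for U
  proof -
    interpret U: lborel_preserving U by (rule lborel_preserving_orthogonal[OF U])
    have "AE \<xi> in lborel. \<forall>k. \<Psi> k (U \<xi>) = \<Psi> k \<xi>"
      unfolding \<Psi>_def AE_all_countable using admissible_invariant(1)[OF adm U] by blast
    with \<Psi>lim U.AE[OF \<Psi>lim] show ?thesis
    proof eventually_elim
      case (elim \<xi>)
      then show ?case using LIMSEQ_unique by simp
    qed
  qed
  obtain \<phi>\<^sub>0 where \<phi>\<^sub>0: "is_fourier \<phi>\<^sub>0 \<Phi>'" using is_fourier_exists_inverse[of \<Phi>'] fin[OF n1] by auto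
  have inv: "AE x in lborel. \<phi>\<^sub>0 (U x) = \<phi>\<^sub>0 x" if U: "orthogonal_transformation U" for U
    unfolding is_fourier_rotation_invariant[OF \<phi>\<^sub>0 U] by (rule inv\<Phi>[OF U])
  obtain \<phi>' where \<phi>': "\<phi>' \<in> borel_measurable borel" "radial \<phi>'" "AE x in lborel. \<phi>\<^sub>0 x = \<phi>' x"
    using radial_representative[OF is_fourierD(1,3)[OF \<phi>\<^sub>0] inv] by blast
  have F': "is_fourier \<phi>' \<Phi>'" using \<phi>' by (intro is_fourier_cong_AE[OF \<phi>\<^sub>0]) auto
  have "admissible r S \<phi>' \<Phi>' g'" unfolding admissible_def using F' \<phi>'(2) fin[OF n2] Fg' pos by blast
  from this n1 n2 n3 show ?thesis by (rule that)
qed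

section \<open>Existence of a maximiser and strictness of the constant\<close>

lemma powr_le_1: "0 \<le> (x::real) \<Longrightarrow> x \<le> 1 \<Longrightarrow> 0 \<le> y \<Longrightarrow> x powr y \<le> 1"
  using powr_mono2[of y x 1] by simp

theorem theorem1p3:
  fixes r S C :: real
  assumes "CARD('d::finite) \<ge> 2"
    and "1/2 < r" and "r < real CARD('d) / 2" and "r < S - 1/2"
    and "C = Sup {GN_ratio r S \<phi> | \<phi> :: real^'d \<Rightarrow> complex.
                   H_rad_plus S r \<phi> \<and> \<not> (AE x in lborel. \<phi> x = 0)}"
  shows "(\<forall>\<phi> :: real^'d \<Rightarrow> complex. H_rad_plus S r \<phi> \<longrightarrow>
            Dnorm r \<phi> \<le> C * (L2norm \<phi> powr (1 - r/S) * Dnorm S \<phi> powr (r/S)))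
       \<and> (\<exists>\<phi> :: real^'d \<Rightarrow> complex. H_rad_plus S r \<phi> \<and> \<not> (AE x in lborel. \<phi> x = 0)
            \<and> GN_ratio r S \<phi> = C)
       \<and> C < 1"
proof -
  define X where "X = {GN_ratio r S \<phi> | \<phi> :: real^'d \<Rightarrow> complex. H_rad_plus S r \<phi> \<and> \<not> (AE x in lborel. \<phi> x = 0)}"
  have C: "C = Sup X" using assms(5) by (simp add: X_def)
  have r: "0 < r" "r < S" "S > 0" and r': "1/2 < r" "r < real CARD('d) / 2" "r < S" using assms by auto
  note Hiff = H_rad_plus_iff[OF r(3)]
  have Xin: "GN_ratio r S \<phi> \<in> X" if "admissible r S \<phi> \<Phi> g" "\<not> (AE x in lborel. \<phi> x = 0)" for \<phi> \<Phi> g :: "real^'d \<Rightarrow> complex"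
    using that unfolding X_def Hiff by blast
  have Xbd: "x < 1" "0 < x" if "x \<in> X" for x
    using that GN_ratio_bounds[OF _ r(1,2)] unfolding X_def Hiff by blast+
  have bdd: "bdd_above X" using Xbd(1) by (intro bdd_aboveI[of _ 1]) (auto intro: less_imp_le)
  have ne: "X \<noteq> {}"
    using admissible_exists[OF r(1) assms(3) r(2)] Xin by (metis empty_iff)
  then have C0: "C > 0" using Xbd(2) cSup_upper[OF _ bdd] unfolding C by (meson ex_in_conv less_le_trans)
  have C1: "C \<le> 1" unfolding C using ne Xbd(1) by (intro cSup_least) (auto intro: less_imp_le)
  have "\<exists>\<phi> \<Phi> g :: real^'d \<Rightarrow> complex. admissible r S \<phi> \<Phi> g \<and> L2sq \<Phi> = 1 \<and> L2sq (fmul S \<Phi>) = 1 \<and>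
      (\<exists>x. C - 1 / real (Suc n) < x \<and> 0 < x \<and> x \<le> C \<and> L2sq (fmul r \<Phi>) = ennreal (x\<^sup>2))" for n
  proof -
    have "C - 1 / real (Suc n) < Sup X" unfolding C by simp
    then obtain x where x: "x \<in> X" "C - 1 / real (Suc n) < x" using less_cSupD[OF ne] by blast
    have "x \<le> C" unfolding C by (rule cSup_upper[OF x(1) bdd])
    moreover obtain \<phi> \<Phi> g :: "real^'d \<Rightarrow> complex" where "admissible r S \<phi> \<Phi> g" "\<not> (AE x in lborel. \<phi> x = 0)" "x = GN_ratio r S \<phi>"
      using x(1) unfolding X_def Hiff by blast
    moreover from this obtain \<phi>' \<Phi>' g' :: "real^'d \<Rightarrow> complex" where "admissible r S \<phi>' \<Phi>' g'" "L2sq \<Phi>' = 1" "L2sq (fmul S \<Phi>') = 1"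
      "L2sq (fmul r \<Phi>') = ennreal (x\<^sup>2)" using admissible_normalise[OF _ r(1,2)] by metis
    ultimately show ?thesis using x Xbd(2)[OF x(1)] by blast
  qed
  then obtain \<phi> \<Phi> g :: "nat \<Rightarrow> real^'d \<Rightarrow> complex" and x where seq:
    "\<And>n. admissible r S (\<phi> n) (\<Phi> n) (g n)" "\<And>n. L2sq (\<Phi> n) = 1" "\<And>n. L2sq (fmul S (\<Phi> n)) = 1"
    "\<And>n. C - 1 / real (Suc n) < x n" "\<And>n. 0 < x n" "\<And>n. x n \<le> C" "\<And>n. L2sq (fmul r (\<Phi> n)) = ennreal ((x n)\<^sup>2)"
    by metis
  have "(\<lambda>n. C - 1 / real (Suc n)) \<longlonglongrightarrow> C - 0"
    by (intro tendsto_diff tendsto_const) (rule LIMSEQ_Suc[OF lim_1_over_n])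
  then have "x \<longlonglongrightarrow> C"
    using seq(4,6) by (intro tendsto_sandwich[of "\<lambda>n. C - 1 / real (Suc n)" x sequentially "\<lambda>_. C"]) (auto intro!: always_eventually less_imp_le)
  then have lim: "(\<lambda>n. L2sq (fmul r (\<Phi> n))) \<longlonglongrightarrow> ennreal (C\<^sup>2)"
    unfolding seq(7) by (intro tendsto_ennrealI tendsto_power)
  have le1: "L2sq (fmul r (\<Phi> n)) \<le> 1" for n
  proof -
    have "(x n)\<^sup>2 \<le> 1" using seq(5,6)[of n] C1 by (intro power_le_one) auto
    then show ?thesis unfolding seq(7) by simp
  qed
  obtain \<phi>' \<Phi>' g' :: "real^'d \<Rightarrow> complex" where lim': "admissible r S \<phi>' \<Phi>' g'" "L2sq \<Phi>' \<le> 1" "L2sq (fmul S \<Phi>') \<le> 1" "L2sq (fmul r \<Phi>') = ennreal (C\<^sup>2)"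
    by (rule normalised_limit[OF r' seq(1-3) le1 lim])
  have F': "is_fourier \<phi>' \<Phi>'" using lim'(1) by (auto simp: admissible_def)
  note [measurable] = is_fourierD(2)[OF F']
  \<comment> \<open>The limit cannot vanish, since the norm of \<open>fmul r \<Phi>'\<close> is
    \<open>C\<close>, which is positive because the class contains a nonzero function.\<close>
  have nz: "\<not> (AE x in lborel. \<phi>' x = 0)"
  proof
    assume "AE x in lborel. \<phi>' x = 0"
    then have "AE \<xi> in lborel. fmul r \<Phi>' \<xi> = 0"
      using is_fourier_AE_zero_iff[OF F'] by (simp add: fmul_eq_0_iff)
    then have "L2sq (fmul r \<Phi>') = 0" by (subst L2sq_eq_0_iff) auto
    then show False using lim'(4) C0 by simp
  qed
  have "GN_ratio r S \<phi>' \<ge> C"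
  proof -
    have 1: "sqrt (enn2real (L2sq \<Phi>')) \<le> 1" "sqrt (enn2real (L2sq (fmul S \<Phi>'))) \<le> 1"
      using lim'(2,3) by (auto intro!: enn2real_leI simp: real_sqrt_le_1_iff)
    \<comment> \<open>The numerator is \<open>C\<close> and both norms in the denominator are at
      most 1; whatever they lost in the limit only increases the ratio.\<close>
    define D where "D = sqrt (enn2real (L2sq \<Phi>')) powr (1 - r/S) * sqrt (enn2real (L2sq (fmul S \<Phi>'))) powr (r/S)"
    have "D \<le> 1 * 1" unfolding D_def using 1 r by (intro mult_mono powr_le_1) auto
    have R: "GN_ratio r S \<phi>' = C / D" using C0 by (simp add: GN_ratio_eq[OF lim'(1)] lim'(4) D_def)
    have "D \<ge> 0" by (simp add: D_def)
    \<comment> \<open>Division by 0 yields 0, so \<open>D = 0\<close> would contradict the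
      positivity of the ratio.\<close>
    moreover have "D \<noteq> 0" using R GN_ratio_bounds(1)[OF lim'(1) r(1,2) nz] by auto
    ultimately have "D > 0" by simp
    then show ?thesis unfolding R using \<open>D \<le> 1 * 1\<close> C0 by (simp add: le_divide_eq mult_left_le)
  qed
  moreover have "GN_ratio r S \<phi>' \<le> C" unfolding C by (rule cSup_upper[OF Xin[OF lim'(1) nz] bdd])
  ultimately have max: "GN_ratio r S \<phi>' = C" by simp
  have "C < 1" using GN_ratio_bounds(2)[OF lim'(1) r(1,2) nz] max by simp
  moreover have "\<exists>\<phi> :: real^'d \<Rightarrow> complex. H_rad_plus S r \<phi> \<and> \<not> (AE x in lborel. \<phi> x = 0) \<and> GN_ratio r S \<phi> = C"
    using max nz lim'(1) Hiff by blast
  moreover have "Dnorm r \<phi> \<le> C * (L2norm \<phi> powr (1 - r/S) * Dnorm S \<phi> powr (r/S))" if H: "H_rad_plus S r \<phi>" for \<phi> :: "real^'d \<Rightarrow> complex"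
  proof -
    obtain \<Phi> g where adm: "admissible r S \<phi> \<Phi> g" using H Hiff by blast
    have F: "is_fourier \<phi> \<Phi>" "is_fourier g (fmul r \<Phi>)" using adm by (auto simp: admissible_def)
    note [measurable] = is_fourierD(2)[OF F(1)]
    let ?D = "L2norm \<phi> powr (1 - r/S) * Dnorm S \<phi> powr (r/S)"
    have D0: "?D \<ge> 0" by simp
    show ?thesis
    proof (cases "AE x in lborel. \<phi> x = 0")
      case True
      \<comment> \<open>Functions vanishing almost everywhere lie outside the set under the
        supremum, so the inequality is checked directly: its left side is 0.\<close>
      then have "AE \<xi> in lborel. fmul r \<Phi> \<xi> = 0"
        using is_fourier_AE_zero_iff[OF F(1)] by (simp add: fmul_eq_0_iff)
      then have "L2sq (fmul r \<Phi>) = 0" by (subst L2sq_eq_0_iff) auto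
      then have "Dnorm r \<phi> = 0" using Dnorm_eq[OF F(1), of r] by simp
      then show ?thesis using C0 by simp
    next
      case False
      have "GN_ratio r S \<phi> \<le> C" unfolding C by (rule cSup_upper[OF Xin[OF adm False] bdd])
      moreover have "GN_ratio r S \<phi> > 0" by (rule GN_ratio_bounds(1)[OF adm r(1,2) False])
      then have "?D \<noteq> 0" by (auto simp: GN_ratio_def)
      ultimately show ?thesis using D0 by (simp add: GN_ratio_def divide_le_eq)
    qed
  qed
  ultimately show ?thesis by blast
qed

end
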